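(* (i) For any $M\ge0$, $\mu\in\mathrm{Sign}_M^+$, and $u_1,\dots,u_M,v\in\mathbb{C}$ such that $\left|\frac{u_i-s}{1-su_i}\cdot\frac{v-s}{1-sv}\right|<1$ for $1\le i\le M$, we have $$\prod_{i=1}^M\frac{1-qu_iv}{1-u_iv}\,F_\mu(u_1,\dots,u_M)=\sum_{\nu\in\mathrm{Sign}_M^+}G^c_{\nu/\mu}(v)\,F_\nu(u_1,\dots,u_M).$$ (ii) For any $l,N\ge0$, $\lambda\in\mathrm{Sign}_l^+$, and $u,v_1,\dots,v_N\in\mathbb{C}$ such that $\left|\frac{u-s}{1-su}\cdot\frac{v_j-s}{1-sv_j}\right|<1$ for $1\le j\le N$, we have $$\prod_{j=1}^N\frac{1-quv_j}{1-uv_j}\,G^c_\lambda(v_1,\dots,v_N)=\frac{1-su}{1-q^{l+1}}\sum_{\nu\in\mathrm{Sign}_{l+1}^+}F_{\nu/\lambda}(u)\,G^c_\nu(v_1,\dots,v_N).$$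
   Context: Throughout, $q,s$ are fixed generic complex parameters, and variables are such that no denominator vanishes. $(a;q)_n=\prod_{r=0}^{n-1}(1-aq^r)$ for $n\ge1$, $(a;q)_0=1$. Signatures: a signature of length $L$ is a string of integers $\lambda=(\lambda_1\ge\dots\ge\lambda_L)$; $\mathrm{Sign}_L$ is the set of all of them, $\mathrm{Sign}_L^+$ those with nonnegative entries; $\mathrm{Sign}_0=\mathrm{Sign}_0^+=\{\varnothing\}$. Multiplicative notation: $\lambda=0^{m_0}1^{m_1}2^{m_2}\cdots$ with $m_j=|\{i:\lambda_i=j\}|$. Vertex weights: for $u\in\mathbb{C}$ and integers $m\ge 0$, $w_u(m,0;m,0)=\frac{1-sq^mu}{1-su}$, $w_u(m,1;m,1)=\frac{u-sq^m}{1-su}$, $w_u(m+1,0;m,1)=\frac{(1-s^2q^m)u}{1-su}$, $w_u(m,1;m+1,0)=\frac{1-q^{m+1}}{1-su}$, and $w_u(i_1,j_1;i_2,j_2)=0$ for all other nonnegative integers. Path weights: in the square grid, assign to each vertex $(i,j)$ the variable $u_j$ (constant along rows). A vertex is interior to an up-right path if it lies on the path and is not its beginning or ending vertex. The weight of a finite collection of up-right paths is the product, over all vertices interior to the paths of the collection, of $w_{u_j}(i_1,j_1;i_2,j_2)$, where $i_1,j_1,i_2,j_2$ are the numbers of paths of the collection containing the South, West, North, East edge at the vertex (weight $1$ if there are no interior vertices). Two collections are identified if they have the same interior vertices and the same numbers $(i_1,j_1,i_2,j_2)$ at each of them. $F$: for $L\ge M\ge0$, $\lambda\in\mathrm{Sign}^+_L$,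 $\mu\in\mathrm{Sign}^+_M$, $F_{\lambda/\mu}(u_1,\dots,u_{L-M})$ is the sum of weights of all collections of $L$ up-right paths that start with the vertical edges $(\mu_m,0)\to(\mu_m,1)$, $1\le m\le M$, and the horizontal edges $(-1,j)\to(0,j)$, $1\le j\le L-M$, and end with the vertical edges $(\lambda_l,L-M)\to(\lambda_l,L-M+1)$, $1\le l\le L$. $F_\lambda:=F_{\lambda/\varnothing}$. $G$: for $L,k\ge0$, $\lambda,\nu\in\mathrm{Sign}_L$, $G_{\lambda/\nu}(u_1,\dots,u_k)$ is the sum of weights of all collections of $L$ up-right paths that start with the vertical edges $(\nu_n,0)\to(\nu_n,1)$, $1\le n\le L$, and end with the vertical edges $(\lambda_l,k)\to(\lambda_l,k+1)$, $1\le l\le L$. Conjugation: for $\nu=0^{n_0}1^{n_1}2^{n_2}\cdots$ put $c(\nu)=\prod_{k\ge0}\frac{(s^2;q)_{n_k}}{(q;q)_{n_k}}$, and $G^c_{\lambda/\mu}=\frac{c(\lambda)}{c(\mu)}G_{\lambda/\mu}$. For $\lambda\in\mathrm{Sign}_L^+$, $G^c_\lambda:=G^c_{\lambda/(0,\dots,0)}$ (with $L$ zeros). *)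

theory Defs
  imports "HOL-Analysis.Analysis" "HOL-Library.Multiset"
begin

definition Sign :: "nat \<Rightarrow> int list set" where
  "Sign L = {lam. length lam = L \<and> sorted_wrt (\<ge>) lam}"

definition Sign_plus :: "nat \<Rightarrow> int list set" where
  "Sign_plus L = {lam \<in> Sign L. \<forall>x\<in>set lam. 0 \<le> x}"

definition qpochhammer :: "complex \<Rightarrow> complex \<Rightarrow> nat \<Rightarrow> complex" where
  "qpochhammer a q n = (\<Prod>r<n. 1 - a * q ^ r)"

(* The arguments of vertex_weight q s u are the numbers
   of paths on the South, West, North and East edge, in this order. *)

definition vertex_weight ::
  "complex \<Rightarrow> complex \<Rightarrow> complex \<Rightarrow> nat \<Rightarrow> nat \<Rightarrow> nat \<Rightarrow> nat \<Rightarrow> complex" where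
  "vertex_weight q s u i1 j1 i2 j2 =
     (if j1 = 0 \<and> j2 = 0 \<and> i1 = i2 then (1 - s * q ^ i1 * u) / (1 - s * u)
      else if j1 = 1 \<and> j2 = 1 \<and> i1 = i2 then (u - s * q ^ i1) / (1 - s * u)
      else if j1 = 0 \<and> j2 = 1 \<and> i1 = i2 + 1 then (1 - s\<^sup>2 * q ^ i2) * u / (1 - s * u)
      else if j1 = 1 \<and> j2 = 0 \<and> i2 = i1 + 1 then (1 - q ^ (i1 + 1)) / (1 - s * u)
      else 0)"


(* Up-right paths, as lists of the lattice points visited; an edge is the pair of
   its beginning and its ending vertex. Collections of paths are multisets. *)

type_synonym vertex = "int \<times> int"
type_synonym edge = "vertex \<times> vertex"

definition path_edges :: "vertex list \<Rightarrow> edge list" where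
  "path_edges p = zip p (tl p)"

definition up_right_path :: "vertex list \<Rightarrow> bool" where
  "up_right_path p \<longleftrightarrow> length p \<ge> 2 \<and>
     (\<forall>((x, y), b) \<in> set (path_edges p). b = (x + 1, y) \<or> b = (x, y + 1))"

definition path_collections :: "edge multiset \<Rightarrow> edge multiset \<Rightarrow> vertex list multiset set" where
  "path_collections S E =
     {P. (\<forall>p\<in>#P. up_right_path p) \<and>
         image_mset (\<lambda>p. hd (path_edges p)) P = S \<and>
         image_mset (\<lambda>p. last (path_edges p)) P = E}"

definition interior_vertices :: "vertex list multiset \<Rightarrow> vertex set" where
  "interior_vertices P = (\<Union>p\<in>set_mset P. set p - {hd p, last p})"

definition edge_count :: "vertex list multiset \<Rightarrow> edge \<Rightarrow> nat" where
  "edge_count P e = size {#p \<in># P. e \<in> set (path_edges p)#}"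

definition vertex_numbers :: "vertex list multiset \<Rightarrow> vertex \<Rightarrow> nat \<times> nat \<times> nat \<times> nat" where
  "vertex_numbers P = (\<lambda>(x, y).
     (edge_count P ((x, y - 1), (x, y)),
      edge_count P ((x - 1, y), (x, y)),
      edge_count P ((x, y), (x, y + 1)),
      edge_count P ((x, y), (x + 1, y))))"

(* Two collections are identified iff their configurations, which record the
   interior vertices and the four numbers at each of them, are equal. *)

definition configuration ::
  "vertex list multiset \<Rightarrow> (vertex \<rightharpoonup> nat \<times> nat \<times> nat \<times> nat)" where
  "configuration P = (\<lambda>z. if z \<in> interior_vertices P then Some (vertex_numbers P z) else None)"

definition configuration_weight ::
  "complex \<Rightarrow> complex \<Rightarrow> (nat \<Rightarrow> complex) \<Rightarrow> (vertex \<rightharpoonup> nat \<times> nat \<times> nat \<times> nat) \<Rightarrow> complex" where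
  "configuration_weight q s u C =
     (\<Prod>(x, y)\<in>dom C. case the (C (x, y)) of (i1, j1, i2, j2) \<Rightarrow>
        vertex_weight q s (u (nat y)) i1 j1 i2 j2)"

definition path_sum ::
  "complex \<Rightarrow> complex \<Rightarrow> (nat \<Rightarrow> complex) \<Rightarrow> edge multiset \<Rightarrow> edge multiset \<Rightarrow> complex" where
  "path_sum q s u S E =
     (\<Sum>C \<in> configuration ` path_collections S E. configuration_weight q s u C)"

definition vertical_edges :: "int list \<Rightarrow> nat \<Rightarrow> edge multiset" where
  "vertical_edges lam y = image_mset (\<lambda>x. ((x, int y), (x, int y + 1))) (mset lam)"

definition entering_edges :: "nat \<Rightarrow> edge multiset" where
  "entering_edges k = image_mset (\<lambda>j. ((-1, int j), (0, int j))) (mset_set {1..k})"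


(* The variables are u 1, u 2, ...: F_skew q s lam \<mu> u depends on u 1, ..., u (L - M),
   where L and M are the lengths of lam and \<mu>, and G_skew q s k lam \<nu> u on u 1, ..., u k. *)

definition F_skew ::
  "complex \<Rightarrow> complex \<Rightarrow> int list \<Rightarrow> int list \<Rightarrow> (nat \<Rightarrow> complex) \<Rightarrow> complex" where
  "F_skew q s lam \<mu> u =
     (let k = length lam - length \<mu>
      in path_sum q s u (vertical_edges \<mu> 0 + entering_edges k) (vertical_edges lam k))"

definition F_fun :: "complex \<Rightarrow> complex \<Rightarrow> int list \<Rightarrow> (nat \<Rightarrow> complex) \<Rightarrow> complex" where
  "F_fun q s lam u = F_skew q s lam [] u"

definition G_skew ::
  "complex \<Rightarrow> complex \<Rightarrow> nat \<Rightarrow> int list \<Rightarrow> int list \<Rightarrow> (nat \<Rightarrow> complex) \<Rightarrow> complex" where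
  "G_skew q s k lam \<nu> u = path_sum q s u (vertical_edges \<nu> 0) (vertical_edges lam k)"

(* Values k that do not occur in \<nu> have multiplicity 0 and contribute the factor 1. *)

definition conj_factor :: "complex \<Rightarrow> complex \<Rightarrow> int list \<Rightarrow> complex" where
  "conj_factor q s \<nu> =
     (\<Prod>k\<in>set \<nu>. qpochhammer (s\<^sup>2) q (count_list \<nu> k) / qpochhammer q q (count_list \<nu> k))"

definition Gc_skew ::
  "complex \<Rightarrow> complex \<Rightarrow> nat \<Rightarrow> int list \<Rightarrow> int list \<Rightarrow> (nat \<Rightarrow> complex) \<Rightarrow> complex" where
  "Gc_skew q s k lam \<mu> u = conj_factor q s lam / conj_factor q s \<mu> * G_skew q s k lam \<mu> u"

definition Gc_fun ::
  "complex \<Rightarrow> complex \<Rightarrow> nat \<Rightarrow> int list \<Rightarrow> (nat \<Rightarrow> complex) \<Rightarrow> complex" where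
  "Gc_fun q s k lam u = Gc_skew q s k lam (replicate (length lam) 0) u"


(* Genericity of q and s: (q;q)_n and (s^2;q)_n, which occur in denominators,
   do not vanish for any n. *)

definition generic_parameters :: "complex \<Rightarrow> complex \<Rightarrow> bool" where
  "generic_parameters q s \<longleftrightarrow> (\<forall>n\<ge>1. q ^ n \<noteq> 1) \<and> (\<forall>n. s\<^sup>2 * q ^ n \<noteq> 1)"

end

(* Write every function as a sum over rows of signatures: a configuration is a sequence of
   signatures, one for each level, and its weight is a product of one-row weights. Conjugating the
   weights of the v-row, both identities follow by iterating the one-row skew Cauchy identity

     sum_kappa F(mu -> kappa; u) G^c(lam -> kappa; v) =
       (1 - q u v) / (1 - u v) sum_rho F(rho -> lam; u) G^c(rho -> mu; v).

   Read column by column, both sides of it are products of 4 x 4 matrices indexed by the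
   occupation numbers of the two horizontal edges, and the Yang-Baxter equation intertwines these
   products by a fixed R-matrix. In the limit of infinitely many columns the state (1, 1)
   contributes the power of (u-s)/(1-su) (v-s)/(1-sv) and vanishes, and the factor in front is the
   quotient of the R-matrix entries at (1, 0) and (0, 0).

   For the exchange of infinite sums: the numbers of horizontal steps in a row add up to the
   difference of the sizes of its two signatures, so a row weight is at most a constant times
   rho^(|nu| - |kappa|) for any positive rho >= |(u-s)/(1-su)|. *)

theory Submission
  imports Defs
begin

section \<open>Vertex weights and the Yang--Baxter equation\<close>

text \<open>One path enters the \<open>u\<close>-row from the left and none enters the
  \<open>v\<close>-row. The left boundary state is therefore (1, 0), the only state with its
  difference of occupations; as the R-matrix preserves this difference, it acts there by a scalar.
  For given outer signatures only finitely many \<rho> contribute, whereas \<kappa> ranges over an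
  infinite set. Hence the intertwining is proved for \<open>X\<close> columns, where all sums are
  finite, and the passage to the infinite sum takes absolute summability as a separate input. The
  freedom in the rate has two uses: a rate slightly above the critical one pays for the number of
  intermediate signatures, and a large one makes the sum over lower signatures converge absolutely
  when the upper signature is fixed. The prefactor of (ii) is the inverse of the weight of a
  \<open>u\<close>-row leading from l zeros to l + 1 zeros. Since collections are identified through
  their numbers at vertices, every admissible sequence of signatures has to be realised by some
  collection: entries of equal index in consecutive levels are joined, and a new path goes to the
  smallest entry.\<close>

definition conj_ratio :: "complex \<Rightarrow> complex \<Rightarrow> nat \<Rightarrow> complex" where
  "conj_ratio q s n = qpochhammer (s\<^sup>2) q n / qpochhammer q q n"

text \<open>Spreads c(\<nu>)/c(\<kappa>) over the columns: the ratio at a vertex involves only the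
  multiplicities below and above it, so conjugation becomes a change of vertex weights and the
  column-by-column argument applies to the \<open>v\<close>-row.\<close>

definition conj_weight ::
  "complex \<Rightarrow> complex \<Rightarrow> complex \<Rightarrow> nat \<Rightarrow> nat \<Rightarrow> nat \<Rightarrow> nat \<Rightarrow> complex" where
  "conj_weight q s v i1 j1 i2 j2 =
     conj_ratio q s i2 / conj_ratio q s i1 * vertex_weight q s v i1 j1 i2 j2"

lemma generic_power_neq: "generic_parameters q s \<Longrightarrow> 1 - q * q ^ n \<noteq> 0"
  unfolding generic_parameters_def by (metis eq_iff_diff_eq_0 le_add1 plus_1_eq_Suc power_Suc)

lemma generic_sq_neq: "generic_parameters q s \<Longrightarrow> 1 - s\<^sup>2 * q ^ n \<noteq> 0"
  unfolding generic_parameters_def by simp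

lemma conj_ratio_nonzero: "generic_parameters q s \<Longrightarrow> conj_ratio q s n \<noteq> 0"
  using generic_sq_neq[of q s] generic_power_neq[of q s]
  by (auto simp: conj_ratio_def qpochhammer_def)

lemma conj_ratio_0 [simp]: "conj_ratio q s 0 = 1"
  by (simp add: conj_ratio_def qpochhammer_def)

lemma conj_ratio_Suc:
  "conj_ratio q s (Suc n) = conj_ratio q s n * ((1 - s\<^sup>2 * q ^ n) / (1 - q * q ^ n))"
  by (simp add: conj_ratio_def qpochhammer_def)

lemma vertex_weight_simps:
  "vertex_weight q s u n 0 n 0 = (1 - s * q ^ n * u) / (1 - s * u)"
  "vertex_weight q s u n (Suc 0) n (Suc 0) = (u - s * q ^ n) / (1 - s * u)"
  "vertex_weight q s u (Suc n) 0 n (Suc 0) = (1 - s\<^sup>2 * q ^ n) * u / (1 - s * u)"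
  "vertex_weight q s u n (Suc 0) (Suc n) 0 = (1 - q * q ^ n) / (1 - s * u)"
  by (simp_all add: vertex_weight_def)

lemma vertex_weight_conserves:
  "vertex_weight q s u i1 j1 i2 j2 \<noteq> 0 \<Longrightarrow> i1 + j1 = i2 + j2 \<and> j1 \<le> 1 \<and> j2 \<le> 1"
  by (auto simp: vertex_weight_def split: if_splits)

lemma vertex_weight_eq_0: "i1 + j1 \<noteq> i2 + j2 \<Longrightarrow> vertex_weight q s u i1 j1 i2 j2 = 0"
  using vertex_weight_conserves by blast

lemma conj_weight_conserves:
  "conj_weight q s u i1 j1 i2 j2 \<noteq> 0 \<Longrightarrow> i1 + j1 = i2 + j2 \<and> j1 \<le> 1 \<and> j2 \<le> 1"
  using vertex_weight_conserves[of q s u i1 j1 i2 j2] by (auto simp: conj_weight_def)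

lemma conj_weight_eq_0: "i1 + j1 \<noteq> i2 + j2 \<Longrightarrow> conj_weight q s u i1 j1 i2 j2 = 0"
  using conj_weight_conserves by blast

text \<open>Consecutive values of \<open>conj_ratio\<close> have the quotient (1 - s^2 q^n)/(1 -
  q^(n+1)), so conjugation swaps these two factors between the two turning weights and leaves the
  straight weights alone.\<close>

lemma conj_weight_simps:
  assumes "generic_parameters q s"
  shows
  "conj_weight q s v n 0 n 0 = (1 - s * q ^ n * v) / (1 - s * v)"
  "conj_weight q s v n (Suc 0) n (Suc 0) = (v - s * q ^ n) / (1 - s * v)"
  "conj_weight q s v (Suc n) 0 n (Suc 0) = (1 - q * q ^ n) * v / (1 - s * v)"
  "conj_weight q s v n (Suc 0) (Suc n) 0 = (1 - s\<^sup>2 * q ^ n) / (1 - s * v)"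
  using conj_ratio_nonzero[OF assms, of n] generic_power_neq[OF assms, of n]
    generic_sq_neq[OF assms, of n]
  by (simp_all add: conj_weight_def vertex_weight_simps conj_ratio_Suc)

text \<open>One column of the two-row partition functions: the \<open>u\<close>-row and the conjugated \<open>v\<close>-row
  share the middle multiplicity \<open>k\<close>, which conservation of paths determines. On the left they lead
  from \<open>m\<close> and \<open>n\<close> to \<open>k\<close>, on the right from \<open>k\<close> to \<open>n\<close> and \<open>m\<close>.\<close>

definition column_left ::
  "complex \<Rightarrow> complex \<Rightarrow> complex \<Rightarrow> complex \<Rightarrow> nat \<Rightarrow> nat \<Rightarrow> nat \<Rightarrow> nat \<Rightarrow> nat \<Rightarrow> nat \<Rightarrow> complex" where
  "column_left q s u v m n a b a' b' =
     (if a' \<le> m + a then vertex_weight q s u m a (m + a - a') a' *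
        conj_weight q s v n b (m + a - a') b' else 0)"

definition column_right ::
  "complex \<Rightarrow> complex \<Rightarrow> complex \<Rightarrow> complex \<Rightarrow> nat \<Rightarrow> nat \<Rightarrow> nat \<Rightarrow> nat \<Rightarrow> nat \<Rightarrow> nat \<Rightarrow> complex" where
  "column_right q s u v m n a b a' b' =
     (if a \<le> n + a' then vertex_weight q s u (n + a' - a) a n a' *
        conj_weight q s v (n + a' - a) b m b' else 0)"

text \<open>The six-vertex R-matrix with denominators cleared. Both rows run towards the same middle
  signature, or both away from it, so the conserved quantity is \<open>a - b\<close> instead of
  \<open>a + b\<close>. Hence (1, 0) and (0, 1) are fixed up to the scalar
  \<open>1 - q * u * v\<close>, and only (0, 0) and (1, 1) mix.\<close>

definition R_matrix ::
  "complex \<Rightarrow> complex \<Rightarrow> complex \<Rightarrow> nat \<Rightarrow> nat \<Rightarrow> nat \<Rightarrow> nat \<Rightarrow> complex" where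
  "R_matrix q u v a b a' b' =
     (if a = 0 \<and> b = 0 \<and> a' = 0 \<and> b' = 0 then 1 - u * v
      else if a = 0 \<and> b = 0 \<and> a' = 1 \<and> b' = 1 then (1 - q) * u * v
      else if a = 1 \<and> b = 1 \<and> a' = 0 \<and> b' = 0 then 1 - q
      else if a = 1 \<and> b = 1 \<and> a' = 1 \<and> b' = 1 then q * (1 - u * v)
      else if a = a' \<and> b = b' then 1 - q * u * v
      else 0)"

lemma column_left_eq_0:
  "m + a + b' \<noteq> n + b + a' \<Longrightarrow> column_left q s u v m n a b a' b' = 0"
  by (auto simp: column_left_def intro!: conj_weight_eq_0)

lemma column_right_eq_0:
  "m + a + b' \<noteq> n + b + a' \<Longrightarrow> column_right q s u v m n a b a' b' = 0"
  by (auto simp: column_right_def intro!: conj_weight_eq_0)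

lemma sum_lessThan_2: "(\<Sum>c<2. f c) = f 0 + f (Suc 0)" for f :: "nat \<Rightarrow> complex"
  by (simp add: numeral_2_eq_2)

text \<open>Conservation makes both sides zero unless \<open>m + a + b' = n + b + a'\<close>.
  Otherwise \<open>m\<close> and \<open>n\<close> differ by at most 2, which leaves five relative
  positions and sixteen boundary states to check.\<close>

lemma yang_baxter:
  assumes gen: "generic_parameters q s" and su: "1 - s * u \<noteq> 0" and sv: "1 - s * v \<noteq> 0"
    and ab: "a < 2" "b < 2" "a' < 2" "b' < 2"
  shows "(\<Sum>c<2. \<Sum>d<2. column_left q s u v m n a b c d * R_matrix q u v c d a' b') =
         (\<Sum>c<2. \<Sum>d<2. R_matrix q u v a b c d * column_right q s u v m n c d a' b')"
proof (cases "m + a + b' = n + b + a'")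
  case False
  have "column_left q s u v m n a b c d * R_matrix q u v c d a' b' = 0" for c d
    using False column_left_eq_0[of m a d n b c] by (auto simp: R_matrix_def split: if_splits)
  moreover have "R_matrix q u v a b c d * column_right q s u v m n c d a' b' = 0" for c d
    using False column_right_eq_0[of m c b' n d a'] by (auto simp: R_matrix_def split: if_splits)
  ultimately show ?thesis by (simp only: sum.neutral_const)
next
  case True
  txt \<open>Every term carries one weight of each row, so with the denominators abstracted the
    identity is polynomial.\<close>
  define iA where "iA = 1 / (1 - s * u)"
  define iB where "iB = 1 / (1 - s * v)"
  have w: "vertex_weight q s u n 0 n 0 = (1 - s * q ^ n * u) * iA"
    "vertex_weight q s u n (Suc 0) n (Suc 0) = (u - s * q ^ n) * iA"
    "vertex_weight q s u (Suc n) 0 n (Suc 0) = (1 - s * s * q ^ n) * u * iA"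
    "vertex_weight q s u n (Suc 0) (Suc n) 0 = (1 - q * q ^ n) * iA"
    "conj_weight q s v n 0 n 0 = (1 - s * q ^ n * v) * iB"
    "conj_weight q s v n (Suc 0) n (Suc 0) = (v - s * q ^ n) * iB"
    "conj_weight q s v (Suc n) 0 n (Suc 0) = (1 - q * q ^ n) * v * iB"
    "conj_weight q s v n (Suc 0) (Suc n) 0 = (1 - s * s * q ^ n) * iB" for n
    by (simp_all add: vertex_weight_simps conj_weight_simps[OF gen] iA_def iB_def power2_eq_square)
  note defs = sum_lessThan_2 R_matrix_def column_left_def column_right_def w
    conj_weight_eq_0 vertex_weight_eq_0
  have cs: "x = 0 \<or> x = Suc 0" if "x < 2" for x :: nat using that by auto
  have "n = m \<or> n = Suc m \<or> n = Suc (Suc m) \<or> m = Suc n \<or> m = Suc (Suc n)"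
    using True ab by arith
  then show ?thesis using cs[OF ab(1)] cs[OF ab(2)] cs[OF ab(3)] cs[OF ab(4)]
    apply (elim disjE)
    apply (insert True)
    apply (simp_all only: add_Suc_right add_Suc add_0_right add_0 Suc_inject nat.inject
      n_not_Suc_n Suc_n_not_n nat.distinct refl)
    apply (simp_all add: defs)
    apply (simp_all add: algebra_simps)
    \<comment> \<open>The middle multiplicity can be one less than \<open>n\<close>; the split drops
      such a term for \<open>n = 0\<close> and makes its turning weights explicit otherwise.\<close>
    apply (cases n; simp add: defs algebra_simps)+
    done
qed


section \<open>Two rows, column by column\<close>

text \<open>The number of paths on the horizontal edge entering a column, forced by conservation
  from the number \<open>e\<close> at the left. The subtraction is truncated: if a column has fewer
  incoming paths than \<open>n\<close> demands, its vertex weight is 0, whatever value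
  follows.\<close>

primrec flow :: "nat \<Rightarrow> (nat \<Rightarrow> nat) \<Rightarrow> (nat \<Rightarrow> nat) \<Rightarrow> nat \<Rightarrow> nat" where
  "flow e m n 0 = e"
| "flow e m n (Suc x) = flow e m n x + m x - n x"

definition row_prod ::
  "(nat \<Rightarrow> nat \<Rightarrow> nat \<Rightarrow> nat \<Rightarrow> complex) \<Rightarrow> nat \<Rightarrow> (nat \<Rightarrow> nat) \<Rightarrow> (nat \<Rightarrow> nat) \<Rightarrow> nat \<Rightarrow> complex" where
  "row_prod w e m n X = (\<Prod>x<X. w (m x) (flow e m n x) (n x) (flow e m n (Suc x)))"

lemma row_prod_0 [simp]: "row_prod w e m n 0 = 1"
  by (simp add: row_prod_def)

lemma row_prod_Suc:
  "row_prod w e m n (Suc X) =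
     row_prod w e m n X * w (m X) (flow e m n X) (n X) (flow e m n (Suc X))"
  by (simp add: row_prod_def)

lemma flow_cong:
  assumes "\<And>x. x < X \<Longrightarrow> m x = m' x" "\<And>x. x < X \<Longrightarrow> n x = n' x"
  shows "flow e m n X = flow e m' n' X"
  using assms by (induction X) auto

lemma row_prod_cong:
  assumes "\<And>x. x < X \<Longrightarrow> m x = m' x" "\<And>x. x < X \<Longrightarrow> n x = n' x"
  shows "row_prod w e m n X = row_prod w e m' n' X"
proof -
  have "flow e m n x = flow e m' n' x" if "x \<le> X" for x
    using that assms by (intro flow_cong) auto
  then show ?thesis
    using assms unfolding row_prod_def
    by (intro prod.cong refl) (metis Suc_leI lessThan_iff less_imp_le_nat)
qed

text \<open>Sums run over multiplicity functions without a constraint on the total, so that they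
  factor column by column; the bound \<open>B\<close> keeps them finite. The total is recovered
  later from the exit state.\<close>

definition bounded_mults :: "nat \<Rightarrow> nat \<Rightarrow> (nat \<Rightarrow> nat) set" where
  "bounded_mults B X = {k. (\<forall>x<X. k x \<le> B) \<and> (\<forall>x\<ge>X. k x = 0)}"

lemma bounded_mults_0: "bounded_mults B 0 = {\<lambda>_. 0}"
  by (auto simp: bounded_mults_def)

lemma bounded_mults_Suc_bij:
  "bij_betw (\<lambda>(k, j). k(X := j)) (bounded_mults B X \<times> {..B}) (bounded_mults B (Suc X))"
proof (rule bij_betw_byWitness[where f' = "\<lambda>k. (k(X := 0), k X)"])
  show "(\<lambda>(k, j). k(X := j)) ` (bounded_mults B X \<times> {..B}) \<subseteq> bounded_mults B (Suc X)"
    by (auto simp: bounded_mults_def)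
  show "(\<lambda>k. (k(X := 0), k X)) ` bounded_mults B (Suc X) \<subseteq> bounded_mults B X \<times> {..B}"
    by (auto simp: bounded_mults_def)
qed (auto simp: bounded_mults_def fun_eq_iff)

lemma finite_bounded_mults: "finite (bounded_mults B X)"
proof (induction X)
  case (Suc X)
  then show ?case
    using bij_betw_finite[OF bounded_mults_Suc_bij[of X B]] by simp
qed (simp add: bounded_mults_0)

lemma sum_bounded_mults_Suc:
  fixes g :: "(nat \<Rightarrow> nat) \<Rightarrow> complex"
  shows "(\<Sum>k\<in>bounded_mults B (Suc X). g k) = (\<Sum>k\<in>bounded_mults B X. \<Sum>j\<le>B. g (k(X := j)))"
  using sum.reindex_bij_betw[OF bounded_mults_Suc_bij[of X B], of g]
  by (simp add: sum.cartesian_product case_prod_unfold)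

text \<open>Both rows end at the common multiplicities \<open>k\<close> here, and both start from
  them in \<open>right_sum\<close>. The numbers 1 and 0 count the paths entering the
  \<open>u\<close>-row and the \<open>v\<close>-row; the exit numbers \<open>a\<close> and
  \<open>b\<close> stay free for the transfer-matrix recursion.\<close>

definition left_sum ::
  "complex \<Rightarrow> complex \<Rightarrow> complex \<Rightarrow> complex \<Rightarrow> (nat \<Rightarrow> nat) \<Rightarrow> (nat \<Rightarrow> nat) \<Rightarrow> nat \<Rightarrow> nat \<Rightarrow> nat \<Rightarrow> nat \<Rightarrow> complex" where
  "left_sum q s u v m n B X a b = (\<Sum>k\<in>bounded_mults B X.
     if flow 1 m k X = a \<and> flow 0 n k X = b
     then row_prod (vertex_weight q s u) 1 m k X * row_prod (conj_weight q s v) 0 n k X else 0)"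

definition right_sum ::
  "complex \<Rightarrow> complex \<Rightarrow> complex \<Rightarrow> complex \<Rightarrow> (nat \<Rightarrow> nat) \<Rightarrow> (nat \<Rightarrow> nat) \<Rightarrow> nat \<Rightarrow> nat \<Rightarrow> nat \<Rightarrow> nat \<Rightarrow> complex" where
  "right_sum q s u v m n B X a b = (\<Sum>k\<in>bounded_mults B X.
     if flow 1 k n X = a \<and> flow 0 k m X = b
     then row_prod (vertex_weight q s u) 1 k n X * row_prod (conj_weight q s v) 0 k m X else 0)"

text \<open>Conservation in the \<open>u\<close>-row leaves only \<open>j = m + c - a\<close>; since
  \<open>c\<close> is at most 1 in a nonzero term, \<open>m < B\<close> keeps it in the range of
  summation.\<close>

lemma sum_column_left:
  assumes "m < B"
  shows "(\<Sum>j\<le>B. if m + c - j = a \<and> n + d - j = b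
           then vertex_weight q s u m c j a * conj_weight q s v n d j b else 0) =
         column_left q s u v m n c d a b"
proof -
  have "(\<Sum>j\<le>B. if m + c - j = a \<and> n + d - j = b
           then vertex_weight q s u m c j a * conj_weight q s v n d j b else 0) =
        (\<Sum>j\<le>B. if j = m + c - a then column_left q s u v m n c d a b else 0)"
  proof (rule sum.cong[OF refl], goal_cases)
    case (1 j)
    show ?case
    proof (cases "j = m + c - a \<and> a \<le> m + c")
      case True
      then show ?thesis using conj_weight_conserves[of q s v n d j b]
        by (auto simp: column_left_def)
    next
      case False
      then have "vertex_weight q s u m c j a = 0" by (intro vertex_weight_eq_0) auto
      then show ?thesis using False by (auto simp: column_left_def)
    qed
  qed
  also have "\<dots> = (if m + c - a \<le> B then column_left q s u v m n c d a b else 0)"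
    by (simp add: sum.delta)
  also have "\<dots> = column_left q s u v m n c d a b"
    using assms vertex_weight_conserves[of q s u m c "m + c - a" a]
    by (cases "vertex_weight q s u m c (m + c - a) a = 0") (auto simp: column_left_def)
  finally show ?thesis .
qed

lemma sum_column_right:
  assumes "n < B"
  shows "(\<Sum>j\<le>B. if j + c - n = a \<and> j + d - m = b
           then vertex_weight q s u j c n a * conj_weight q s v j d m b else 0) =
         column_right q s u v m n c d a b"
proof -
  have "(\<Sum>j\<le>B. if j + c - n = a \<and> j + d - m = b
           then vertex_weight q s u j c n a * conj_weight q s v j d m b else 0) =
        (\<Sum>j\<le>B. if j = n + a - c then column_right q s u v m n c d a b else 0)"
  proof (rule sum.cong[OF refl], goal_cases)
    case (1 j)
    show ?case
    proof (cases "j = n + a - c \<and> c \<le> n + a")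
      case True
      then show ?thesis using conj_weight_conserves[of q s v j d m b]
        by (auto simp: column_right_def)
    next
      case False
      then have "vertex_weight q s u j c n a = 0" by (intro vertex_weight_eq_0) auto
      then show ?thesis using False by (auto simp: column_right_def)
    qed
  qed
  also have "\<dots> = (if n + a - c \<le> B then column_right q s u v m n c d a b else 0)"
    by (simp add: sum.delta)
  also have "\<dots> = column_right q s u v m n c d a b"
    using assms vertex_weight_conserves[of q s u "n + a - c" c n a]
    by (cases "vertex_weight q s u (n + a - c) c n a = 0") (auto simp: column_right_def)
  finally show ?thesis .
qed

lemma column_left_bounds:
  "column_left q s u v m n c d a b \<noteq> 0 \<Longrightarrow> c < 2 \<and> d < 2 \<and> a < 2 \<and> b < 2"
  using vertex_weight_conserves[of q s u m c "m + c - a" a]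
    conj_weight_conserves[of q s v n d "m + c - a" b]
  by (auto simp: column_left_def split: if_splits)

lemma column_right_bounds:
  "column_right q s u v m n c d a b \<noteq> 0 \<Longrightarrow> c < 2 \<and> d < 2 \<and> a < 2 \<and> b < 2"
  using vertex_weight_conserves[of q s u "n + a - c" c n a]
    conj_weight_conserves[of q s v "n + a - c" d m b]
  by (auto simp: column_right_def split: if_splits)

text \<open>Turns a column weight evaluated at the actual flows into a matrix product by summing
  over the four states of a pair of horizontal edges. The premise on \<open>g\<close> removes all
  other states.\<close>

lemma sum_states:
  fixes g :: "nat \<Rightarrow> nat \<Rightarrow> complex"
  assumes "\<And>c d. g c d \<noteq> 0 \<Longrightarrow> c < 2 \<and> d < 2"
  shows "W * g f h = (\<Sum>c<2. \<Sum>d<2. (if f = c \<and> h = d then W else 0) * g c d)"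
proof -
  have "(\<Sum>c<2. \<Sum>d<2. (if f = c \<and> h = d then W else 0) * g c d) =
        (\<Sum>c<2. if f = c then if h < 2 then W * g c h else 0 else 0)"
  proof (rule sum.cong[OF refl], goal_cases)
    case (1 c)
    have "(\<Sum>d<2. (if f = c \<and> h = d then W else 0) * g c d) =
          (\<Sum>d<2. if h = d then (if f = c then W * g c d else 0) else 0)"
      by (intro sum.cong refl) auto
    then show ?case by (simp add: sum.delta')
  qed
  also have "\<dots> = (if f < 2 then if h < 2 then W * g f h else 0 else 0)"
    by (subst sum.delta') auto
  also have "\<dots> = W * g f h"
    using assms[of f h] by auto
  finally show ?thesis by simp
qed

lemma left_sum_Suc:
  assumes "m X < B"
  shows "left_sum q s u v m n B (Suc X) a b =
    (\<Sum>c<2. \<Sum>d<2. left_sum q s u v m n B X c d * column_left q s u v (m X) (n X) c d a b)"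
proof -
  let ?W = "\<lambda>k. row_prod (vertex_weight q s u) 1 m k X * row_prod (conj_weight q s v) 0 n k X"
  have fl: "flow e m (k(X := j)) X = flow e m k X" for k j e m
    by (rule flow_cong) auto
  have rp: "row_prod w e m (k(X := j)) X = row_prod w e m k X" for k j e m w
    by (rule row_prod_cong) auto
  have "left_sum q s u v m n B (Suc X) a b = (\<Sum>k\<in>bounded_mults B X.
     \<Sum>j\<le>B. ?W k * (if m X + flow 1 m k X - j = a \<and> n X + flow 0 n k X - j = b then
        vertex_weight q s u (m X) (flow 1 m k X) j a * conj_weight q s v (n X) (flow 0 n k X) j b
        else 0))"
    unfolding left_sum_def sum_bounded_mults_Suc
    by (intro sum.cong refl) (auto simp: row_prod_Suc fl rp ac_simps)
  also have "\<dots> = (\<Sum>k\<in>bounded_mults B X.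
     ?W k * column_left q s u v (m X) (n X) (flow 1 m k X) (flow 0 n k X) a b)"
    by (simp only: sum_distrib_left[symmetric] sum_column_left[OF assms])
  also have "\<dots> = (\<Sum>k\<in>bounded_mults B X. \<Sum>c<2. \<Sum>d<2.
     (if flow 1 m k X = c \<and> flow 0 n k X = d then ?W k else 0) *
     column_left q s u v (m X) (n X) c d a b)"
    using column_left_bounds by (intro sum.cong refl sum_states) blast
  also have "\<dots> = (\<Sum>c<2. \<Sum>d<2. left_sum q s u v m n B X c d * column_left q s u v (m X) (n X) c d a b)"
    unfolding left_sum_def sum_distrib_right
    by (subst sum.swap, intro sum.cong refl, subst sum.swap, intro sum.cong refl)
  finally show ?thesis .
qed

lemma right_sum_Suc:
  assumes "n X < B"
  shows "right_sum q s u v m n B (Suc X) a b =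
    (\<Sum>c<2. \<Sum>d<2. right_sum q s u v m n B X c d * column_right q s u v (m X) (n X) c d a b)"
proof -
  let ?W = "\<lambda>k. row_prod (vertex_weight q s u) 1 k n X * row_prod (conj_weight q s v) 0 k m X"
  have fl: "flow e (k(X := j)) m X = flow e k m X" for k j e m
    by (rule flow_cong) auto
  have rp: "row_prod w e (k(X := j)) m X = row_prod w e k m X" for k j e m w
    by (rule row_prod_cong) auto
  have "right_sum q s u v m n B (Suc X) a b = (\<Sum>k\<in>bounded_mults B X.
     \<Sum>j\<le>B. ?W k * (if j + flow 1 k n X - n X = a \<and> j + flow 0 k m X - m X = b then
        vertex_weight q s u j (flow 1 k n X) (n X) a * conj_weight q s v j (flow 0 k m X) (m X) b
        else 0))"
    unfolding right_sum_def sum_bounded_mults_Suc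
    by (intro sum.cong refl) (auto simp: row_prod_Suc fl rp ac_simps)
  also have "\<dots> = (\<Sum>k\<in>bounded_mults B X.
     ?W k * column_right q s u v (m X) (n X) (flow 1 k n X) (flow 0 k m X) a b)"
    by (simp only: sum_distrib_left[symmetric] sum_column_right[OF assms])
  also have "\<dots> = (\<Sum>k\<in>bounded_mults B X. \<Sum>c<2. \<Sum>d<2.
     (if flow 1 k n X = c \<and> flow 0 k m X = d then ?W k else 0) *
     column_right q s u v (m X) (n X) c d a b)"
    using column_right_bounds by (intro sum.cong refl sum_states) blast
  also have "\<dots> = (\<Sum>c<2. \<Sum>d<2. right_sum q s u v m n B X c d * column_right q s u v (m X) (n X) c d a b)"
    unfolding right_sum_def sum_distrib_right
    by (subst sum.swap, intro sum.cong refl, subst sum.swap, intro sum.cong refl)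
  finally show ?thesis .
qed

text \<open>The R-matrix travels from the right end of the \<open>X\<close> columns to the left end
  by one Yang--Baxter exchange per column. There it meets the entering state (1, 0), on which it
  acts by \<open>1 - q * u * v\<close>.\<close>

lemma left_right_exchange:
  assumes gen: "generic_parameters q s" and su: "1 - s * u \<noteq> 0" and sv: "1 - s * v \<noteq> 0"
    and B: "\<And>x. m x < B" "\<And>x. n x < B" and ab: "a < 2" "b < 2"
  shows "(\<Sum>c<2. \<Sum>d<2. left_sum q s u v m n B X c d * R_matrix q u v c d a b) =
         (1 - q * u * v) * right_sum q s u v m n B X a b"
  using ab
proof (induction X arbitrary: a b)
  case 0
  then show ?case
    by (auto simp: sum_lessThan_2 left_sum_def right_sum_def bounded_mults_0 R_matrix_def)
next
  case (Suc X)
  let ?l = "left_sum q s u v m n B X" and ?r = "right_sum q s u v m n B X"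
  let ?L = "column_left q s u v (m X) (n X)" and ?R = "column_right q s u v (m X) (n X)"
  let ?M = "R_matrix q u v"
  have "(\<Sum>c<2. \<Sum>d<2. left_sum q s u v m n B (Suc X) c d * ?M c d a b) =
        (\<Sum>i<2. \<Sum>j<2. ?l i j * (\<Sum>c<2. \<Sum>d<2. ?L i j c d * ?M c d a b))"
    unfolding left_sum_Suc[of m X, OF B(1)] sum_lessThan_2 by (simp only: algebra_simps)
  also have "\<dots> = (\<Sum>i<2. \<Sum>j<2. ?l i j * (\<Sum>c<2. \<Sum>d<2. ?M i j c d * ?R c d a b))"
    by (intro sum.cong refl arg_cong2[where f = "(*)"] yang_baxter[OF gen su sv _ _ Suc.prems]) auto
  also have "\<dots> = (\<Sum>c<2. \<Sum>d<2. (\<Sum>i<2. \<Sum>j<2. ?l i j * ?M i j c d) * ?R c d a b)"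
    unfolding sum_lessThan_2 by (simp only: algebra_simps)
  also have "\<dots> = (\<Sum>c<2. \<Sum>d<2. ((1 - q * u * v) * ?r c d) * ?R c d a b)"
    by (intro sum.cong refl arg_cong2[where f = "(*)"] Suc.IH) auto
  also have "\<dots> = (1 - q * u * v) * right_sum q s u v m n B (Suc X) a b"
    unfolding right_sum_Suc[of n X, OF B(2)] sum_distrib_left by (simp only: mult.assoc)
  finally show ?case .
qed

text \<open>In an empty column nothing comes from below, so a path leaving to the right must have
  come from the left. Hence the state (1, 1) arises only from itself, with the two straight weights
  at multiplicity 0.\<close>

lemma left_sum_tail:
  assumes gen: "generic_parameters q s" and B: "0 < B"
    and z: "\<And>x. x \<ge> X0 \<Longrightarrow> m x = 0" "\<And>x. x \<ge> X0 \<Longrightarrow> n x = 0"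
  shows "left_sum q s u v m n B (X0 + i) 1 1 =
    left_sum q s u v m n B X0 1 1 * ((u - s) / (1 - s * u) * ((v - s) / (1 - s * v))) ^ i"
proof (induction i)
  case (Suc i)
  have "m (X0 + i) < B" using z B by simp
  from left_sum_Suc[of m, OF this] show ?case using z Suc
    by (simp add: sum_lessThan_2 column_left_def vertex_weight_simps conj_weight_simps[OF gen]
      conj_weight_eq_0 vertex_weight_eq_0)
qed simp

text \<open>Here the empty multiplicities lie above: with exit state (0, 0) nothing leaves the
  column at all, so nothing enters it and its weight is 1.\<close>

lemma right_sum_tail:
  assumes gen: "generic_parameters q s" and B: "0 < B" and su: "1 - s * u \<noteq> 0" and sv: "1 - s * v \<noteq> 0"
    and z: "\<And>x. x \<ge> X0 \<Longrightarrow> m x = 0" "\<And>x. x \<ge> X0 \<Longrightarrow> n x = 0"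
  shows "right_sum q s u v m n B (X0 + i) 0 0 = right_sum q s u v m n B X0 0 0"
proof (induction i)
  case (Suc i)
  have "n (X0 + i) < B" using z B by simp
  from right_sum_Suc[of n, OF this] show ?case using z Suc su sv
    by (simp add: sum_lessThan_2 column_right_def vertex_weight_simps conj_weight_simps[OF gen]
      conj_weight_eq_0 vertex_weight_eq_0)
qed simp

lemma left_sum_limit:
  assumes gen: "generic_parameters q s" and su: "1 - s * u \<noteq> 0" and sv: "1 - s * v \<noteq> 0"
    and uv: "1 - u * v \<noteq> 0"
    and t: "cmod ((u - s) / (1 - s * u) * ((v - s) / (1 - s * v))) < 1"
    and B: "\<And>x. m x < B" "\<And>x. n x < B"
    and z: "\<And>x. x \<ge> X0 \<Longrightarrow> m x = 0" "\<And>x. x \<ge> X0 \<Longrightarrow> n x = 0"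
  shows "(\<lambda>X. left_sum q s u v m n B X 0 0) \<longlonglongrightarrow>
    (1 - q * u * v) / (1 - u * v) * right_sum q s u v m n B X0 0 0"
proof -
  let ?t = "(u - s) / (1 - s * u) * ((v - s) / (1 - s * v))"
  let ?l = "left_sum q s u v m n B"
  have B0: "0 < B" using B(1)[of 0] by linarith
  have "?l (i + X0) 0 0 = (1 - q * u * v) / (1 - u * v) * right_sum q s u v m n B X0 0 0
      - (1 - q) / (1 - u * v) * (?l X0 1 1 * ?t ^ i)" for i
  proof -
    have alg: "x = c / d * y - e / d * z" if "d * x + e * z = c * y" "d \<noteq> 0" for x y z c d e :: complex
      using that by (simp add: field_simps)
    \<comment> \<open>Only (0, 0) and (1, 1) lead to (0, 0) under the R-matrix, with entries
      \<open>1 - u * v\<close> and \<open>1 - q\<close>; the relation is then solved for the sum at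
      (0, 0).\<close>
    have "(1 - u * v) * ?l (X0 + i) 0 0 + (1 - q) * ?l (X0 + i) 1 1
       = (1 - q * u * v) * right_sum q s u v m n B (X0 + i) 0 0"
      using left_right_exchange[where a = 0 and b = 0 and X = "X0 + i", OF gen su sv B]
      by (simp add: sum_lessThan_2 R_matrix_def ac_simps)
    from alg[OF this uv] show ?thesis
      by (simp only: left_sum_tail[OF gen B0 z] right_sum_tail[OF gen B0 su sv z] add.commute[of i])
  qed
  moreover have "(\<lambda>i. (1 - q * u * v) / (1 - u * v) * right_sum q s u v m n B X0 0 0
      - (1 - q) / (1 - u * v) * (?l X0 1 1 * ?t ^ i)) \<longlonglongrightarrow>
      (1 - q * u * v) / (1 - u * v) * right_sum q s u v m n B X0 0 0
      - (1 - q) / (1 - u * v) * (?l X0 1 1 * 0)"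
    by (intro tendsto_intros LIMSEQ_power_zero t)
  ultimately have "(\<lambda>i. ?l (i + X0) 0 0) \<longlonglongrightarrow>
      (1 - q * u * v) / (1 - u * v) * right_sum q s u v m n B X0 0 0"
    by simp
  then show ?thesis by (rule LIMSEQ_offset)
qed


section \<open>One-row weights of signatures\<close>

definition mults :: "int list \<Rightarrow> nat \<Rightarrow> nat" where
  "mults \<kappa> x = count (mset \<kappa>) (int x)"

lemma Sign_plus_0: "Sign_plus 0 = {[]}"
  by (auto simp: Sign_plus_def Sign_def)

lemma Sign_plus_nonneg: "\<kappa> \<in> Sign_plus L \<Longrightarrow> a \<in> set \<kappa> \<Longrightarrow> 0 \<le> a"
  by (simp add: Sign_plus_def)

lemma Sign_plus_length: "\<kappa> \<in> Sign_plus L \<Longrightarrow> length \<kappa> = L"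
  by (simp add: Sign_plus_def Sign_def)

lemma Sign_plus_sum_nonneg: "\<kappa> \<in> Sign_plus L \<Longrightarrow> 0 \<le> sum_list \<kappa>"
  by (auto simp: Sign_plus_def intro: sum_list_nonneg)

lemma Sign_plus_le_sum:
  assumes "\<kappa> \<in> Sign_plus L" "a \<in> set \<kappa>"
  shows "a \<le> sum_list \<kappa>"
proof -
  have "a \<le> sum_list \<kappa>" if "a \<in> set \<kappa>" "\<forall>b\<in>set \<kappa>. 0 \<le> b" for \<kappa>
    using that by (induction \<kappa>) (auto intro: add_increasing add_increasing2 sum_list_nonneg)
  then show ?thesis using assms(2) Sign_plus_nonneg[OF assms(1)] by blast
qed

lemma mults_eq_0: "int x \<notin> set \<kappa> \<Longrightarrow> mults \<kappa> x = 0"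
  by (simp add: mults_def)

lemma mults_tail: "\<forall>a\<in>set \<kappa>. a < int X \<Longrightarrow> x \<ge> X \<Longrightarrow> mults \<kappa> x = 0"
  by (intro mults_eq_0) auto

lemma mults_le: "\<kappa> \<in> Sign_plus L \<Longrightarrow> mults \<kappa> x \<le> L"
  unfolding mults_def by (metis Sign_plus_length count_le_length count_mset)

lemma sum_mults:
  assumes "\<forall>a\<in>set \<kappa>. 0 \<le> a \<and> a < int X"
  shows "(\<Sum>x<X. mults \<kappa> x) = length \<kappa>"
    and "int (\<Sum>x<X. x * mults \<kappa> x) = sum_list \<kappa>"
proof -
  have "(\<Sum>x<X. mults \<kappa> x) = length \<kappa> \<and> int (\<Sum>x<X. x * mults \<kappa> x) = sum_list \<kappa>"
    using assms
  proof (induction \<kappa>)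
    case (Cons a \<kappa>)
    then obtain y where y: "a = int y" "y < X"
      by (metis list.set_intros(1) nonneg_int_cases of_nat_less_iff)
    have m: "mults (a # \<kappa>) x = mults \<kappa> x + (if x = y then 1 else 0)" for x
      by (auto simp: mults_def y)
    have "(\<Sum>x<X. x * mults (a # \<kappa>) x) = (\<Sum>x<X. x * mults \<kappa> x) + (\<Sum>x<X. if x = y then y else 0)"
      unfolding m sum.distrib[symmetric] by (intro sum.cong) (auto simp: algebra_simps)
    moreover have "(\<Sum>x<X. mults (a # \<kappa>) x) = (\<Sum>x<X. mults \<kappa> x) + (\<Sum>x<X. if x = y then 1 else 0)"
      unfolding m sum.distrib[symmetric] by (intro sum.cong) auto
    ultimately show ?case using Cons y by simp
  qed (simp add: mults_def)
  then show "(\<Sum>x<X. mults \<kappa> x) = length \<kappa>"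
    and "int (\<Sum>x<X. x * mults \<kappa> x) = sum_list \<kappa>" by auto
qed

text \<open>Signatures that the first \<open>X\<close> columns see completely. These finite sets
  exhaust \<open>Sign_plus L\<close> and mediate between column products and infinite sums.\<close>

definition Sign_below :: "nat \<Rightarrow> nat \<Rightarrow> int list set" where
  "Sign_below L X = {\<kappa> \<in> Sign_plus L. \<forall>a\<in>set \<kappa>. a < int X}"

lemma Sign_below_sums:
  assumes "\<kappa> \<in> Sign_below L X"
  shows "(\<Sum>x<X. mults \<kappa> x) = L" and "(\<Sum>x<X. x * mults \<kappa> x) = nat (sum_list \<kappa>)"
proof -
  have "\<forall>a\<in>set \<kappa>. 0 \<le> a \<and> a < int X" "length \<kappa> = L"
    using assms by (auto simp: Sign_below_def Sign_plus_def Sign_def)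
  from sum_mults[OF this(1)] this(2)
  show "(\<Sum>x<X. mults \<kappa> x) = L" and "(\<Sum>x<X. x * mults \<kappa> x) = nat (sum_list \<kappa>)"
    by (simp_all only: nat_int flip: \<open>int _ = _\<close>)
qed

lemma inj_on_mults: "inj_on mults (Sign_plus L)"
proof
  fix \<kappa> \<nu> assume k: "\<kappa> \<in> Sign_plus L" and n: "\<nu> \<in> Sign_plus L" and e: "mults \<kappa> = mults \<nu>"
  have "count (mset \<kappa>) a = count (mset \<nu>) a" for a
  proof (cases "a \<ge> 0")
    case True
    then show ?thesis using fun_cong[OF e, of "nat a"] by (simp add: mults_def)
  next
    case False
    then have "a \<notin> set \<kappa>" "a \<notin> set \<nu>" using Sign_plus_nonneg k n by blast+
    then show ?thesis by (metis count_eq_zero_iff set_mset_mset)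
  qed
  then have "mset \<kappa> = mset \<nu>" by (rule multiset_eqI)
  moreover have "sorted (rev \<kappa>)" "sorted (rev \<nu>)"
    using k n by (auto simp: Sign_plus_def Sign_def sorted_wrt_rev)
  ultimately have "rev \<kappa> = rev \<nu>"
    by (metis mset_rev properties_for_sort)
  then show "\<kappa> = \<nu>" by simp
qed

lemma ex_Sign_below:
  assumes "\<And>x. x \<ge> X \<Longrightarrow> k x = 0"
  shows "\<exists>\<kappa>\<in>Sign_below (\<Sum>x<X. k x) X. mults \<kappa> = k"
  using assms
proof (induction X arbitrary: k)
  case 0
  then show ?case by (auto simp: Sign_below_def Sign_plus_0 mults_def fun_eq_iff)
next
  case (Suc X)
  have "\<exists>\<kappa>\<in>Sign_below (\<Sum>x<X. (k(X := 0)) x) X. mults \<kappa> = k(X := 0)"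
    using Suc.prems by (intro Suc.IH) (metis fun_upd_apply le_antisym not_less_eq_eq)
  then obtain \<kappa> where k: "\<kappa> \<in> Sign_below (\<Sum>x<X. k x) X" "mults \<kappa> = k(X := 0)"
    by auto
  \<comment> \<open>Signatures are weakly decreasing, so the copies of the new largest entry
    \<open>X\<close> go to the front.\<close>
  have "mults (replicate (k X) (int X) @ \<kappa>) x = k x" for x
    using fun_cong[OF k(2), of x] by (auto simp: mults_def)
  moreover have "replicate (k X) (int X) @ \<kappa> \<in> Sign_below (\<Sum>x<Suc X. k x) (Suc X)"
  proof -
    have "a < int X" "0 \<le> a" if "a \<in> set \<kappa>" for a
      using k(1) that by (auto simp: Sign_below_def Sign_plus_def)
    then have "\<forall>a\<in>set (replicate (k X) (int X) @ \<kappa>). 0 \<le> a \<and> a < int (Suc X)"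
      "\<forall>a\<in>set (replicate (k X) (int X)). \<forall>b\<in>set \<kappa>. b \<le> a"
      by (auto simp: less_imp_le) (smt (verit, best))
    moreover have "sorted_wrt (\<ge>) (replicate n c)" for n and c :: int
      by (induction n) auto
    ultimately show ?thesis
      using k(1) by (simp add: Sign_below_def Sign_plus_def Sign_def sorted_wrt_append)
  qed
  ultimately show ?case by blast
qed

lemma mults_image_subset: "L \<le> B \<Longrightarrow> mults ` Sign_below L X \<subseteq> bounded_mults B X"
  using mults_le[of _ L] mults_tail[of _ X]
  by (auto simp: Sign_below_def bounded_mults_def intro: order_trans)

lemma finite_Sign_below: "finite (Sign_below L X)"
proof (rule finite_imageD)
  show "finite (mults ` Sign_below L X)"
    using finite_subset[OF mults_image_subset finite_bounded_mults] by blast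
  show "inj_on mults (Sign_below L X)"
    using inj_on_mults by (rule inj_on_subset) (auto simp: Sign_below_def)
qed

text \<open>The functions of total \<open>L\<close> supported below \<open>X\<close> are exactly the
  multiplicities of the signatures in \<open>Sign_below L X\<close>; the premise on \<open>g\<close>
  removes all others.\<close>

lemma sum_Sign_below:
  assumes "L \<le> B" and "\<And>k. k \<in> bounded_mults B X \<Longrightarrow> g k \<noteq> 0 \<Longrightarrow> (\<Sum>x<X. k x) = L"
  shows "(\<Sum>k\<in>bounded_mults B X. g k) = (\<Sum>\<kappa>\<in>Sign_below L X. g (mults \<kappa>))"
proof -
  have inj: "inj_on mults (Sign_below L X)"
    using inj_on_mults by (rule inj_on_subset) (auto simp: Sign_below_def)
  have "g k = 0" if "k \<in> bounded_mults B X - mults ` Sign_below L X" for k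
  proof (rule ccontr)
    assume "g k \<noteq> 0"
    then have "(\<Sum>x<X. k x) = L" using that assms(2) by blast
    moreover have "\<exists>\<kappa>\<in>Sign_below (\<Sum>x<X. k x) X. mults \<kappa> = k"
      using that by (intro ex_Sign_below) (auto simp: bounded_mults_def)
    ultimately show False using that by auto
  qed
  then have "(\<Sum>k\<in>bounded_mults B X. g k) = (\<Sum>k\<in>mults ` Sign_below L X. g k)"
    using mults_image_subset[OF assms(1)] finite_bounded_mults
    by (intro sum.mono_neutral_right) auto
  also have "\<dots> = (\<Sum>\<kappa>\<in>Sign_below L X. g (mults \<kappa>))"
    by (simp add: sum.reindex[OF inj])
  finally show ?thesis .
qed

section \<open>One row: conservation, displacement and the bound on its weight\<close>

definition path_weights :: "(nat \<Rightarrow> nat \<Rightarrow> nat \<Rightarrow> nat \<Rightarrow> complex) \<Rightarrow> bool" where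
  "path_weights w \<longleftrightarrow> w 0 0 0 0 = 1 \<and>
     (\<forall>i1 j1 i2 j2. w i1 j1 i2 j2 \<noteq> 0 \<longrightarrow> i1 + j1 = i2 + j2 \<and> j1 \<le> 1 \<and> j2 \<le> 1)"

lemma path_weights_vertex_weight: "1 - s * u \<noteq> 0 \<Longrightarrow> path_weights (vertex_weight q s u)"
  using vertex_weight_conserves by (auto simp: path_weights_def vertex_weight_simps)

lemma path_weights_conj_weight: "1 - s * u \<noteq> 0 \<Longrightarrow> path_weights (conj_weight q s u)"
  using conj_weight_conserves by (auto simp: path_weights_def conj_weight_def vertex_weight_simps)

lemma row_prod_flow:
  assumes "path_weights w" "row_prod w e m n X \<noteq> 0"
  shows "\<forall>x<X. flow e m n (Suc x) + n x = flow e m n x + m x"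
proof (intro allI impI)
  fix x assume "x < X"
  then have "w (m x) (flow e m n x) (n x) (flow e m n (Suc x)) \<noteq> 0"
    using assms(2) by (auto simp: row_prod_def)
  then show "flow e m n (Suc x) + n x = flow e m n x + m x"
    using assms(1) unfolding path_weights_def by (metis add.commute)
qed

lemma flow_total:
  assumes "\<forall>x<X. flow e m n (Suc x) + n x = flow e m n x + m x"
  shows "flow e m n X + (\<Sum>x<X. n x) = e + (\<Sum>x<X. m x)"
  using assms
proof (induction X)
  case (Suc X)
  then have "flow e m n (Suc X) + n X = flow e m n X + m X" by (simp del: flow.simps)
  moreover have "flow e m n X + (\<Sum>x<X. n x) = e + (\<Sum>x<X. m x)"
    using Suc by (simp del: flow.simps)
  ultimately show ?case unfolding sum.lessThan_Suc by linarith
qed simp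

text \<open>The edges from column x to x + 1 count the steps to the right, so their sum is the total
  displacement of the paths. Entering paths count as starting in column 0, and those still
  travelling at the end as having reached column \<open>X\<close>.\<close>

lemma flow_displacement:
  assumes "\<forall>x<X. flow e m n (Suc x) + n x = flow e m n x + m x"
  shows "(\<Sum>x<X. flow e m n (Suc x)) + (\<Sum>x<X. x * m x) = (\<Sum>x<X. x * n x) + X * flow e m n X"
  using assms
proof (induction X)
  case (Suc X)
  have "flow e m n (Suc X) + n X = flow e m n X + m X" using Suc by (simp del: flow.simps)
  then have "X * (flow e m n (Suc X) + n X) = X * (flow e m n X + m X)" by simp
  moreover have "(\<Sum>x<X. flow e m n (Suc x)) + (\<Sum>x<X. x * m x) = (\<Sum>x<X. x * n x) + X * flow e m n X"
    using Suc by (simp del: flow.simps)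
  ultimately show ?case unfolding sum.lessThan_Suc
    by (simp add: algebra_simps del: flow.simps)
qed simp

text \<open>The columns beyond the largest possible entry carry no path and contribute the factor 1,
  so the cut-off is immaterial.\<close>

definition row_weight ::
  "(nat \<Rightarrow> nat \<Rightarrow> nat \<Rightarrow> nat \<Rightarrow> complex) \<Rightarrow> nat \<Rightarrow> int list \<Rightarrow> int list \<Rightarrow> complex" where
  "row_weight w e \<kappa> \<nu> =
     row_prod w e (mults \<kappa>) (mults \<nu>) (Suc (nat (sum_list \<kappa> + sum_list \<nu>)))"

lemma row_prod_flow_0:
  assumes "path_weights w" "row_prod w e (mults \<kappa>) (mults \<nu>) X \<noteq> 0"
    and "\<kappa> \<in> Sign_below L X" "\<nu> \<in> Sign_below (L + e) X"
  shows "flow e (mults \<kappa>) (mults \<nu>) X = 0"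
  using flow_total[OF row_prod_flow[OF assms(1,2)]]
    Sign_below_sums(1)[OF assms(3)] Sign_below_sums(1)[OF assms(4)] by simp

lemma row_prod_extend:
  assumes "path_weights w" "\<kappa> \<in> Sign_below L X" "\<nu> \<in> Sign_below (L + e) X"
  shows "row_prod w e (mults \<kappa>) (mults \<nu>) (X + i) = row_prod w e (mults \<kappa>) (mults \<nu>) X"
proof (induction i)
  case (Suc i)
  have z: "mults \<kappa> (X + i) = 0" "mults \<nu> (X + i) = 0"
    using assms(2,3) by (auto simp: Sign_below_def intro!: mults_tail)
  show ?case
  proof (cases "row_prod w e (mults \<kappa>) (mults \<nu>) (X + i) = 0")
    case False
    have "flow e (mults \<kappa>) (mults \<nu>) (X + i) = 0"
      using assms by (intro row_prod_flow_0[OF assms(1) False]) (force simp: Sign_below_def)+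
    then show ?thesis using Suc z assms(1) by (simp add: row_prod_Suc path_weights_def)
  qed (use Suc in \<open>simp add: row_prod_Suc\<close>)
qed simp

lemma Sign_plus_below:
  assumes "\<kappa> \<in> Sign_plus L" "sum_list \<kappa> < int X" shows "\<kappa> \<in> Sign_below L X"
  using assms Sign_plus_le_sum[OF assms(1)] by (force simp: Sign_below_def)

lemma Sign_plus_below_cutoff:
  assumes "\<kappa> \<in> Sign_plus L" "\<nu> \<in> Sign_plus M"
  shows "\<kappa> \<in> Sign_below L (Suc (nat (sum_list \<kappa> + sum_list \<nu>)))"
    and "\<nu> \<in> Sign_below M (Suc (nat (sum_list \<kappa> + sum_list \<nu>)))"
  using assms Sign_plus_sum_nonneg[OF assms(1)] Sign_plus_sum_nonneg[OF assms(2)]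
  by (auto intro!: Sign_plus_below)

lemma row_weight_eq:
  assumes "path_weights w" "\<kappa> \<in> Sign_below L X" "\<nu> \<in> Sign_below (L + e) X"
  shows "row_weight w e \<kappa> \<nu> = row_prod w e (mults \<kappa>) (mults \<nu>) X"
proof -
  let ?Y = "Suc (nat (sum_list \<kappa> + sum_list \<nu>))"
  have Y: "\<kappa> \<in> Sign_below L ?Y" "\<nu> \<in> Sign_below (L + e) ?Y"
    using assms Sign_plus_below_cutoff[of \<kappa> L \<nu> "L + e"] by (auto simp: Sign_below_def)
  \<comment> \<open>The two cut-offs are compared by extending each of them to their sum.\<close>
  show ?thesis
    using row_prod_extend[OF assms, of ?Y] row_prod_extend[OF assms(1) Y, of X]
    by (simp add: row_weight_def add.commute)
qed

text \<open>Paths never move left, so the total displacement |\<nu>| - |\<kappa>| is nonnegative.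
  This leaves finitely many lower signatures for a given upper one.\<close>

lemma row_weight_sum_le:
  assumes "path_weights w" "row_weight w e \<kappa> \<nu> \<noteq> 0"
    and "\<kappa> \<in> Sign_plus L" "\<nu> \<in> Sign_plus (L + e)"
  shows "sum_list \<kappa> \<le> sum_list \<nu>"
proof -
  let ?X = "Suc (nat (sum_list \<kappa> + sum_list \<nu>))"
  note b = Sign_plus_below_cutoff[OF assms(3,4)]
  have nz: "row_prod w e (mults \<kappa>) (mults \<nu>) ?X \<noteq> 0" using assms(2) by (simp add: row_weight_def)
  have "(\<Sum>x<?X. x * mults \<kappa> x) \<le> (\<Sum>x<?X. x * mults \<nu> x)"
    using flow_displacement[OF row_prod_flow[OF assms(1) nz]] row_prod_flow_0[OF assms(1) nz b]
    by (simp only: mult_0_right add_0_right)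
  then show ?thesis
    unfolding Sign_below_sums(2)[OF b(1)] Sign_below_sums(2)[OF b(2)]
    using Sign_plus_sum_nonneg[OF assms(3)] Sign_plus_sum_nonneg[OF assms(4)] by linarith
qed

text \<open>Each vertex is charged \<open>\<rho>\<close> for an outgoing horizontal path and a
  constant for each path on its vertical edges. The latter number 2 L + e over the whole row, the
  former |\<nu>| - |\<kappa>| by displacement. At vertices without vertical paths the weight is 1 or
  \<open>w 0 1 0 1\<close>, so no constant is lost in the unbounded number of such columns.\<close>

lemma row_weight_bound:
  assumes w: "path_weights w" and rho: "0 < \<rho>" "cmod (w 0 1 0 1) \<le> \<rho>"
  shows "\<exists>D>0. \<forall>\<kappa>\<in>Sign_plus L. \<forall>\<nu>\<in>Sign_plus (L + e).
           cmod (row_weight w e \<kappa> \<nu>) \<le> D * \<rho> ^ nat (sum_list \<nu>) / \<rho> ^ nat (sum_list \<kappa>)"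
proof -
  define S where "S = (\<lambda>(i1, j1, i2, j2). cmod (w i1 j1 i2 j2)) `
    ({..L + e} \<times> {..1} \<times> {..L + e} \<times> {..1})"
  have fS: "finite S" by (simp add: S_def)
  define C where "C = Max (insert 1 S)"
  \<comment> \<open>Chosen so that \<open>C\<close> is at most \<open>D * \<rho> ^ j\<close> for j =
    0 and for j = 1, whether \<open>\<rho>\<close> is small or large.\<close>
  define D where "D = max C (C / \<rho>)"
  have C: "1 \<le> C" using fS by (simp add: C_def)
  have Cw: "cmod (w i1 j1 i2 j2) \<le> C" if "i1 \<le> L + e" "i2 \<le> L + e" "j1 \<le> 1" "j2 \<le> 1" for i1 j1 i2 j2
  proof -
    have "(i1, j1, i2, j2) \<in> {..L + e} \<times> {..1} \<times> {..L + e} \<times> {..1}" using that by simp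
    then have "cmod (w i1 j1 i2 j2) \<in> S" unfolding S_def by (rule rev_image_eqI) simp
    then show ?thesis using fS unfolding C_def by (intro Max_ge) auto
  qed
  have D: "1 \<le> D" "C \<le> D" "C \<le> D * \<rho>"
    using C rho by (auto simp: D_def max_mult_distrib_right le_max_iff_disj)
  have local: "cmod (w i1 j1 i2 j2) \<le> D ^ (i1 + i2) * \<rho> ^ j2"
    if "i1 \<le> L + e" "i2 \<le> L + e" for i1 j1 i2 j2
  proof (cases "w i1 j1 i2 j2 = 0")
    case False
    then have j: "i1 + j1 = i2 + j2" "j1 \<le> 1" "j2 \<le> 1" using w by (auto simp: path_weights_def)
    show ?thesis
    proof (cases "i1 + i2 = 0")
      case True
      then show ?thesis using j w rho by (cases "j1 = 0") (auto simp: path_weights_def le_Suc_eq)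
    next
      case False
      then have *: "D \<le> D ^ (i1 + i2)" using D(1) by (intro self_le_power) auto
      have "C \<le> D * \<rho> ^ j2" using j D by (cases "j2 = 0") (auto simp: le_Suc_eq)
      also have "\<dots> \<le> D ^ (i1 + i2) * \<rho> ^ j2" using * rho by (intro mult_right_mono) auto
      finally show ?thesis using Cw[OF that j(2,3)] by linarith
    qed
  qed (use D rho in auto)
  show ?thesis
  proof (intro exI[of _ "D ^ (L + (L + e))"] conjI ballI)
    fix \<kappa> \<nu> assume kn: "\<kappa> \<in> Sign_plus L" "\<nu> \<in> Sign_plus (L + e)"
    let ?X = "Suc (nat (sum_list \<kappa> + sum_list \<nu>))"
    let ?h = "flow e (mults \<kappa>) (mults \<nu>)"
    note b = Sign_plus_below_cutoff[OF kn]
    show "cmod (row_weight w e \<kappa> \<nu>)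
       \<le> D ^ (L + (L + e)) * \<rho> ^ nat (sum_list \<nu>) / \<rho> ^ nat (sum_list \<kappa>)"
    proof (cases "row_weight w e \<kappa> \<nu> = 0")
      case False
      then have nz: "row_prod w e (mults \<kappa>) (mults \<nu>) ?X \<noteq> 0" by (simp add: row_weight_def)
      note sm = Sign_below_sums[OF b(1)] Sign_below_sums[OF b(2)]
      have disp: "(\<Sum>x<?X. ?h (Suc x)) + nat (sum_list \<kappa>) = nat (sum_list \<nu>)"
        using flow_displacement[OF row_prod_flow[OF w nz]] row_prod_flow_0[OF w nz b]
        by (simp only: sm mult_0_right add_0_right)
      have "cmod (row_weight w e \<kappa> \<nu>) =
          (\<Prod>x<?X. cmod (w (mults \<kappa> x) (?h x) (mults \<nu> x) (?h (Suc x))))"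
        unfolding row_weight_def row_prod_def prod_norm ..
      also have "\<dots> \<le> (\<Prod>x<?X. D ^ (mults \<kappa> x + mults \<nu> x) * \<rho> ^ ?h (Suc x))"
        using mults_le[OF kn(1)] mults_le[OF kn(2)]
        by (intro prod_mono conjI local norm_ge_zero) (auto intro: trans_le_add1)
      also have "\<dots> = D ^ (L + (L + e)) * \<rho> ^ (\<Sum>x<?X. ?h (Suc x))"
        unfolding prod.distrib power_sum[symmetric] sum.distrib sm ..
      also have "\<dots> = D ^ (L + (L + e)) * \<rho> ^ nat (sum_list \<nu>) / \<rho> ^ nat (sum_list \<kappa>)"
        using rho unfolding disp[symmetric] power_add by simp
      finally show ?thesis .
    qed (use D rho in simp)
  qed (use D in simp)
qed

section \<open>Infinite sums over signatures of fixed length\<close>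

lemma summable_lists:
  fixes \<tau> :: real
  assumes "0 \<le> \<tau>" "\<tau> < 1"
  shows "(\<lambda>\<nu>. \<tau> ^ sum_list \<nu>) summable_on {\<nu>::nat list. length \<nu> = L}"
proof (induction L)
  case (Suc L)
  have geo: "(\<lambda>n. \<tau> ^ n) summable_on (UNIV::nat set)"
    using assms by (intro norm_summable_imp_summable_on) (auto intro!: summable_geometric)
  have "(\<lambda>(n, \<nu>). \<tau> ^ n * \<tau> ^ sum_list \<nu>) summable_on UNIV \<times> {\<nu>::nat list. length \<nu> = L}"
  proof (rule summable_on_SigmaI)
    show "((\<lambda>\<nu>. case (n, \<nu>) of (n, \<nu>) \<Rightarrow> \<tau> ^ n * \<tau> ^ sum_list \<nu>) has_sum
        \<tau> ^ n * (\<Sum>\<^sub>\<infinity>\<nu>\<in>{\<nu>. length \<nu> = L}. \<tau> ^ sum_list \<nu>)) {\<nu>. length \<nu> = L}" for n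
      using has_sum_infsum[OF Suc] by (auto intro: has_sum_cmult_right)
  qed (use geo assms in \<open>auto intro: summable_on_cmult_left\<close>)
  moreover have "bij_betw (\<lambda>(n, \<nu>). n # \<nu>) (UNIV \<times> {\<nu>::nat list. length \<nu> = L}) {\<nu>. length \<nu> = Suc L}"
    by (rule bij_betw_byWitness[where f' = "\<lambda>\<nu>. (hd \<nu>, tl \<nu>)"]) (auto simp: length_Suc_conv)
  ultimately show ?case
    by (subst summable_on_reindex_bij_betw[symmetric]) (auto simp: case_prod_unfold power_add)
qed (simp add: summable_on_finite)

text \<open>Signatures embed into lists of naturals of the same length; forgetting the order leaves
  a product of \<open>L\<close> geometric series.\<close>

lemma summable_Sign_plus:
  fixes \<tau> :: real
  assumes "0 \<le> \<tau>" "\<tau> < 1"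
  shows "(\<lambda>\<nu>. \<tau> ^ nat (sum_list \<nu>)) summable_on Sign_plus L"
proof -
  have sl: "sum_list (map nat \<nu>) = nat (sum_list \<nu>)" if "\<forall>a\<in>set \<nu>. 0 \<le> a" for \<nu>
    using that by (induction \<nu>) (auto simp: nat_add_distrib sum_list_nonneg)
  have inj: "inj_on (map nat) (Sign_plus L)"
  proof (rule inj_on_inverseI[where g = "map int"])
    show "map int (map nat \<nu>) = \<nu>" if "\<nu> \<in> Sign_plus L" for \<nu>
      using Sign_plus_nonneg[OF that] by (induction \<nu>) auto
  qed
  have "(\<lambda>\<nu>. \<tau> ^ sum_list \<nu>) summable_on map nat ` Sign_plus L"
    by (rule summable_on_subset_banach[OF summable_lists[OF assms, of L]])
      (auto simp: Sign_plus_def Sign_def)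
  then have "((\<lambda>\<nu>. \<tau> ^ sum_list \<nu>) \<circ> map nat) summable_on Sign_plus L"
    using summable_on_reindex[OF inj] by blast
  then show ?thesis
    by (rule summable_on_cong[THEN iffD1, rotated]) (auto simp: sl Sign_plus_def)
qed

text \<open>An infinite sum is a limit along the net of finite subsets. Every finite set of
  signatures fits below some \<open>X\<close>, so the cut-off sets form a cofinal sequence in this
  net.\<close>

lemma infsum_Sign_below_limit:
  fixes f :: "int list \<Rightarrow> complex"
  assumes "f summable_on Sign_plus L"
  shows "(\<lambda>X. \<Sum>\<nu>\<in>Sign_below L X. f \<nu>) \<longlonglongrightarrow> infsum f (Sign_plus L)"
proof -
  have "filterlim (\<lambda>X. Sign_below L X) (finite_subsets_at_top (Sign_plus L)) sequentially"
    unfolding filterlim_finite_subsets_at_top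
  proof (intro allI impI, elim conjE)
    fix F assume F: "finite F" "F \<subseteq> Sign_plus L"
    have fin: "finite (sum_list ` F)" using F by simp
    show "\<forall>\<^sub>F X in sequentially. finite (Sign_below L X) \<and> F \<subseteq> Sign_below L X \<and> Sign_below L X \<subseteq> Sign_plus L"
    proof (rule eventually_sequentiallyI)
      fix X assume "Suc (nat (Max (insert 0 (sum_list ` F)))) \<le> X"
      then have X: "nat (Max (insert 0 (sum_list ` F))) < X" by simp
      have "sum_list \<nu> < int X" if "\<nu> \<in> F" for \<nu>
      proof -
        have "sum_list \<nu> \<le> Max (insert 0 (sum_list ` F))" using fin that by (intro Max_ge) auto
        with X show ?thesis by linarith
      qed
      then show "finite (Sign_below L X) \<and> F \<subseteq> Sign_below L X \<and> Sign_below L X \<subseteq> Sign_plus L"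
        using F Sign_plus_below finite_Sign_below by (auto simp: Sign_below_def)
    qed
  qed
  moreover have "(sum f \<longlongrightarrow> infsum f (Sign_plus L)) (finite_subsets_at_top (Sign_plus L))"
    using assms by (metis has_sum_def has_sum_infsum)
  ultimately show ?thesis
    by (rule filterlim_compose[rotated])
qed

section \<open>The one-row skew Cauchy identity\<close>

lemma left_sum_Sign_below:
  assumes su: "1 - s * u \<noteq> 0" and sv: "1 - s * v \<noteq> 0" and "Suc l \<le> B"
    and mu: "\<mu> \<in> Sign_below l X" and lam: "lam \<in> Sign_below (Suc l) X"
  shows "left_sum q s u v (mults \<mu>) (mults lam) B X 0 0 = (\<Sum>\<kappa>\<in>Sign_below (Suc l) X.
    row_weight (vertex_weight q s u) 1 \<mu> \<kappa> * row_weight (conj_weight q s v) 0 lam \<kappa>)"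
proof -
  note w = path_weights_vertex_weight[OF su, of q] path_weights_conj_weight[OF sv, of q]
  have "left_sum q s u v (mults \<mu>) (mults lam) B X 0 0 = (\<Sum>\<kappa>\<in>Sign_below (Suc l) X.
      if flow 1 (mults \<mu>) (mults \<kappa>) X = 0 \<and> flow 0 (mults lam) (mults \<kappa>) X = 0
      then row_prod (vertex_weight q s u) 1 (mults \<mu>) (mults \<kappa>) X *
        row_prod (conj_weight q s v) 0 (mults lam) (mults \<kappa>) X else 0)"
    unfolding left_sum_def
  \<comment> \<open>One path enters the \<open>u\<close>-row and none leaves it, so a contributing
    \<open>k\<close> has total l + 1: the exit state selects the signatures of the right
    length.\<close>
  proof (rule sum_Sign_below[OF assms(3)], goal_cases)
    case (1 k)
    then have "row_prod (vertex_weight q s u) 1 (mults \<mu>) k X \<noteq> 0" "flow 1 (mults \<mu>) k X = 0"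
      by (auto split: if_splits)
    then show ?case
      using flow_total[OF row_prod_flow[OF w(1)]] Sign_below_sums(1)[OF mu] by fastforce
  qed
  also have "\<dots> = (\<Sum>\<kappa>\<in>Sign_below (Suc l) X.
    row_weight (vertex_weight q s u) 1 \<mu> \<kappa> * row_weight (conj_weight q s v) 0 lam \<kappa>)"
  proof (rule sum.cong[OF refl], goal_cases)
    case (1 \<kappa>)
    have "row_weight (vertex_weight q s u) 1 \<mu> \<kappa> =
        row_prod (vertex_weight q s u) 1 (mults \<mu>) (mults \<kappa>) X"
      "row_weight (conj_weight q s v) 0 lam \<kappa> =
        row_prod (conj_weight q s v) 0 (mults lam) (mults \<kappa>) X"
      using 1 by (auto intro!: row_weight_eq[OF w(1) mu] row_weight_eq[OF w(2) lam])
    moreover have "row_prod (vertex_weight q s u) 1 (mults \<mu>) (mults \<kappa>) X = 0 \<or> flow 1 (mults \<mu>) (mults \<kappa>) X = 0"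
      using row_prod_flow_0[OF w(1) _ mu] 1 by fastforce
    moreover have "row_prod (conj_weight q s v) 0 (mults lam) (mults \<kappa>) X = 0 \<or> flow 0 (mults lam) (mults \<kappa>) X = 0"
      using row_prod_flow_0[OF w(2) _ lam] 1 by fastforce
    ultimately show ?case by auto
  qed
  finally show ?thesis .
qed

lemma right_sum_Sign_below:
  assumes su: "1 - s * u \<noteq> 0" and sv: "1 - s * v \<noteq> 0" and "l \<le> B"
    and mu: "\<mu> \<in> Sign_below l X" and lam: "lam \<in> Sign_below (Suc l) X"
  shows "right_sum q s u v (mults \<mu>) (mults lam) B X 0 0 = (\<Sum>\<rho>\<in>Sign_below l X.
    row_weight (vertex_weight q s u) 1 \<rho> lam * row_weight (conj_weight q s v) 0 \<rho> \<mu>)"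
proof -
  note w = path_weights_vertex_weight[OF su, of q] path_weights_conj_weight[OF sv, of q]
  have "right_sum q s u v (mults \<mu>) (mults lam) B X 0 0 = (\<Sum>\<rho>\<in>Sign_below l X.
      if flow 1 (mults \<rho>) (mults lam) X = 0 \<and> flow 0 (mults \<rho>) (mults \<mu>) X = 0
      then row_prod (vertex_weight q s u) 1 (mults \<rho>) (mults lam) X *
        row_prod (conj_weight q s v) 0 (mults \<rho>) (mults \<mu>) X else 0)"
    unfolding right_sum_def
  proof (rule sum_Sign_below[OF assms(3)], goal_cases)
    case (1 k)
    then have "row_prod (conj_weight q s v) 0 k (mults \<mu>) X \<noteq> 0" "flow 0 k (mults \<mu>) X = 0"
      by (auto split: if_splits)
    then show ?case
      using flow_total[OF row_prod_flow[OF w(2)]] Sign_below_sums(1)[OF mu] by fastforce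
  qed
  also have "\<dots> = (\<Sum>\<rho>\<in>Sign_below l X.
    row_weight (vertex_weight q s u) 1 \<rho> lam * row_weight (conj_weight q s v) 0 \<rho> \<mu>)"
  proof (rule sum.cong[OF refl], goal_cases)
    case (1 \<rho>)
    have lam': "lam \<in> Sign_below (l + 1) X" and mu': "\<mu> \<in> Sign_below (l + 0) X" using lam mu by auto
    have "row_weight (vertex_weight q s u) 1 \<rho> lam =
        row_prod (vertex_weight q s u) 1 (mults \<rho>) (mults lam) X"
      "row_weight (conj_weight q s v) 0 \<rho> \<mu> =
        row_prod (conj_weight q s v) 0 (mults \<rho>) (mults \<mu>) X"
      by (rule row_weight_eq[OF w(1) 1 lam'] row_weight_eq[OF w(2) 1 mu'])+
    moreover have "row_prod (vertex_weight q s u) 1 (mults \<rho>) (mults lam) X = 0 \<or> flow 1 (mults \<rho>) (mults lam) X = 0"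
      using row_prod_flow_0[OF w(1) _ 1 lam'] by metis
    moreover have "row_prod (conj_weight q s v) 0 (mults \<rho>) (mults \<mu>) X = 0 \<or> flow 0 (mults \<rho>) (mults \<mu>) X = 0"
      using row_prod_flow_0[OF w(2) _ 1 mu'] by metis
    ultimately show ?case by auto
  qed
  finally show ?thesis .
qed

lemma infsum_Sign_plus_finite:
  fixes f :: "int list \<Rightarrow> complex"
  assumes "\<And>\<rho>. \<rho> \<in> Sign_plus L \<Longrightarrow> f \<rho> \<noteq> 0 \<Longrightarrow> sum_list \<rho> < int X"
  shows "infsum f (Sign_plus L) = (\<Sum>\<rho>\<in>Sign_below L X. f \<rho>)"
proof -
  have "f \<rho> = 0" if "\<rho> \<in> Sign_plus L - Sign_below L X" for \<rho>
    using assms[of \<rho>] Sign_plus_below[of \<rho> L X] that by blast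
  then have "infsum f (Sign_plus L) = infsum f (Sign_below L X)"
    by (intro infsum_cong_neutral) (auto simp: Sign_below_def)
  then show ?thesis by (simp add: finite_Sign_below)
qed

text \<open>The column argument yields the limit of the cut-off sums. Summability is a premise
  because it identifies this limit with the infinite sum; growth bounds supply it in
  \<open>skew_cauchy_row\<close>.\<close>

lemma skew_cauchy_row_summable:
  assumes gen: "generic_parameters q s" and su: "1 - s * u \<noteq> 0" and sv: "1 - s * v \<noteq> 0"
    and uv: "1 - u * v \<noteq> 0"
    and t: "cmod ((u - s) / (1 - s * u) * ((v - s) / (1 - s * v))) < 1"
    and mu: "\<mu> \<in> Sign_plus l" and lam: "lam \<in> Sign_plus (Suc l)"
    and summable: "(\<lambda>\<kappa>. row_weight (vertex_weight q s u) 1 \<mu> \<kappa> *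
      row_weight (conj_weight q s v) 0 lam \<kappa>) summable_on Sign_plus (Suc l)"
  shows "(\<Sum>\<^sub>\<infinity>\<kappa>\<in>Sign_plus (Suc l).
      row_weight (vertex_weight q s u) 1 \<mu> \<kappa> * row_weight (conj_weight q s v) 0 lam \<kappa>) =
    (1 - q * u * v) / (1 - u * v) * (\<Sum>\<^sub>\<infinity>\<rho>\<in>Sign_plus l.
      row_weight (vertex_weight q s u) 1 \<rho> lam * row_weight (conj_weight q s v) 0 \<rho> \<mu>)"
proof -
  \<comment> \<open>Beyond all entries of \<open>\<mu>\<close> and \<open>lam\<close>, and also
    beyond those of every contributing \<open>\<rho>\<close>, whose size is at most that of
    \<open>lam\<close>.\<close>
  define X0 where "X0 = Suc (nat (sum_list \<mu> + sum_list lam))"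
  note w = path_weights_vertex_weight[OF su, of q] path_weights_conj_weight[OF sv, of q]
  have b: "\<mu> \<in> Sign_below l X" "lam \<in> Sign_below (Suc l) X" if "X \<ge> X0" for X
    using Sign_plus_below_cutoff[OF mu lam] that less_le_trans[OF _ of_nat_mono[OF that, where 'a = int]]
    unfolding X0_def[symmetric] by (auto simp: Sign_below_def)
  have B: "mults \<mu> x < Suc (Suc l)" "mults lam x < Suc (Suc l)" for x
    using mults_le[OF mu, of x] mults_le[OF lam, of x] by auto
  have z: "mults \<mu> x = 0" "mults lam x = 0" if "x \<ge> X0" for x
    using b[of X0] that by (auto simp: Sign_below_def intro!: mults_tail)
  let ?f = "\<lambda>\<kappa>. row_weight (vertex_weight q s u) 1 \<mu> \<kappa> * row_weight (conj_weight q s v) 0 lam \<kappa>"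
  let ?g = "\<lambda>\<rho>. row_weight (vertex_weight q s u) 1 \<rho> lam * row_weight (conj_weight q s v) 0 \<rho> \<mu>"
  have "sum_list \<rho> < int X0" if "\<rho> \<in> Sign_plus l" "?g \<rho> \<noteq> 0" for \<rho>
  proof -
    have "sum_list \<rho> \<le> sum_list lam"
      using row_weight_sum_le[OF w(1) _ that(1), of 1 lam] that(2) lam by simp
    then show ?thesis using Sign_plus_sum_nonneg[OF mu] by (simp add: X0_def)
  qed
  then have r: "infsum ?g (Sign_plus l) =
      right_sum q s u v (mults \<mu>) (mults lam) (Suc (Suc l)) X0 0 0"
    using right_sum_Sign_below[where B = "Suc (Suc l)" and q = q, OF su sv _ b[OF order_refl]] infsum_Sign_plus_finite[of l ?g X0]
    by simp
  have "(\<lambda>X. left_sum q s u v (mults \<mu>) (mults lam) (Suc (Suc l)) X 0 0) \<longlonglongrightarrow>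
      (1 - q * u * v) / (1 - u * v) * infsum ?g (Sign_plus l)"
    unfolding r by (rule left_sum_limit[OF gen su sv uv t B z])
  moreover have "\<forall>\<^sub>F X in sequentially. left_sum q s u v (mults \<mu>) (mults lam) (Suc (Suc l)) X 0 0 =
      sum ?f (Sign_below (Suc l) X)"
    using b by (intro eventually_sequentiallyI[of X0] left_sum_Sign_below[OF su sv]) auto
  ultimately have "(\<lambda>X. sum ?f (Sign_below (Suc l) X)) \<longlonglongrightarrow>
      (1 - q * u * v) / (1 - u * v) * infsum ?g (Sign_plus l)"
    by (rule Lim_transform_eventually)
  with infsum_Sign_below_limit[OF summable] show ?thesis
    by (rule LIMSEQ_unique)
qed


section \<open>Exchange of infinite sums\<close>

text \<open>Functions of signatures that grow at most like \<open>a\<close> to the power of the size, up to an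
  arbitrarily small loss; the loss absorbs the number of intermediate signatures.\<close>

definition growth :: "(int list \<Rightarrow> complex) \<Rightarrow> nat \<Rightarrow> real \<Rightarrow> bool" where
  "growth g L a \<longleftrightarrow> (\<forall>\<rho>>0. a < \<rho> \<longrightarrow> (\<exists>C>0. \<forall>\<kappa>\<in>Sign_plus L. cmod (g \<kappa>) \<le> C * \<rho> ^ nat (sum_list \<kappa>)))"

text \<open>One common \<open>\<rho>\<close> governs both arguments, since the row bound involves
  only the difference of sizes. Raising it improves the decay in \<open>\<kappa>\<close> at the
  expense of the growth in \<open>\<nu>\<close>; quantifying over all rates leaves this choice to
  each application.\<close>

definition kernel_bound :: "(int list \<Rightarrow> int list \<Rightarrow> complex) \<Rightarrow> nat \<Rightarrow> nat \<Rightarrow> real \<Rightarrow> bool" where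
  "kernel_bound K L M a \<longleftrightarrow> (\<forall>\<rho>>0. a < \<rho> \<longrightarrow> (\<exists>D>0. \<forall>\<kappa>\<in>Sign_plus L. \<forall>\<nu>\<in>Sign_plus M.
     cmod (K \<kappa> \<nu>) \<le> D * \<rho> ^ nat (sum_list \<nu>) / \<rho> ^ nat (sum_list \<kappa>)))"

lemma growthE:
  assumes "growth g L a" "0 < \<rho>" "a < \<rho>"
  obtains C where "C > 0" "\<forall>\<kappa>\<in>Sign_plus L. cmod (g \<kappa>) \<le> C * \<rho> ^ nat (sum_list \<kappa>)"
  using assms unfolding growth_def by metis

lemma kernel_boundE:
  assumes "kernel_bound K L M a" "0 < \<rho>" "a < \<rho>"
  obtains D where "D > 0" "\<forall>\<kappa>\<in>Sign_plus L. \<forall>\<nu>\<in>Sign_plus M.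
     cmod (K \<kappa> \<nu>) \<le> D * \<rho> ^ nat (sum_list \<nu>) / \<rho> ^ nat (sum_list \<kappa>)"
  using assms unfolding kernel_bound_def by metis

lemma kernel_bound_row_weight:
  assumes "path_weights w" "cmod (w 0 1 0 1) \<le> a"
  shows "kernel_bound (row_weight w e) L (L + e) a"
  using row_weight_bound[OF assms(1), of _ L e] assms(2) unfolding kernel_bound_def by fastforce

lemma growth_kernel:
  assumes "kernel_bound K L M a" "\<kappa> \<in> Sign_plus L"
  shows "growth (K \<kappa>) M a"
  unfolding growth_def
proof (intro allI impI)
  fix \<rho> :: real assume r: "0 < \<rho>" "a < \<rho>"
  obtain D where D: "D > 0" "\<forall>\<kappa>\<in>Sign_plus L. \<forall>\<nu>\<in>Sign_plus M.
     cmod (K \<kappa> \<nu>) \<le> D * \<rho> ^ nat (sum_list \<nu>) / \<rho> ^ nat (sum_list \<kappa>)"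
    using kernel_boundE[OF assms(1) r] .
  with r assms(2) show "\<exists>C>0. \<forall>\<nu>\<in>Sign_plus M. cmod (K \<kappa> \<nu>) \<le> C * \<rho> ^ nat (sum_list \<nu>)"
    by (intro exI[of _ "D / \<rho> ^ nat (sum_list \<kappa>)"]) auto
qed

lemma ex_growth_rates:
  fixes a b :: real
  assumes "0 \<le> a" "0 \<le> b" "a * b < 1"
  obtains \<rho> \<sigma> where "a < \<rho>" "b < \<sigma>" "0 < \<rho>" "0 < \<sigma>" "\<rho> * \<sigma> < 1"
proof -
  have "((\<lambda>e. (a + e) * (b + e)) \<longlongrightarrow> (a + 0) * (b + 0)) (at_right 0)"
    by (intro tendsto_intros)
  then have "\<forall>\<^sub>F e in at_right 0. (a + e) * (b + e) < 1"
    using assms(3) by (intro order_tendstoD) auto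
  moreover have "\<forall>\<^sub>F e in at_right (0::real). 0 < e"
    by (simp add: eventually_at_right_less)
  ultimately have "\<forall>\<^sub>F e in at_right 0. (a + e) * (b + e) < 1 \<and> 0 < e"
    by (rule eventually_conj)
  then obtain e where "(a + e) * (b + e) < 1" "0 < e"
    using eventually_happens[where net = "at_right (0::real)"] trivial_limit_at_right_real by blast
  then show thesis using assms by (intro that[of "a + e" "b + e"]) auto
qed

lemma summable_on_bounded:
  fixes f :: "'a \<Rightarrow> complex"
  assumes "g summable_on A" "\<And>x. x \<in> A \<Longrightarrow> cmod (f x) \<le> g x"
  shows "f summable_on A"
proof (rule abs_summable_summable)
  show "(\<lambda>x. cmod (f x)) summable_on A"
    by (rule summable_on_comparison_test[OF assms(1)]) (use assms(2) in auto)
qed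

lemma summable_on_Times_powers:
  fixes \<sigma> \<tau> :: real
  assumes "0 \<le> \<sigma>" "\<sigma> < 1" "0 \<le> \<tau>" "\<tau> < 1"
  shows "(\<lambda>(\<nu>, \<kappa>). C * (\<sigma> ^ nat (sum_list \<nu>) * \<tau> ^ nat (sum_list \<kappa>)))
    summable_on Sign_plus L \<times> Sign_plus M"
proof -
  have "(\<lambda>(\<nu>, \<kappa>). \<sigma> ^ nat (sum_list \<nu>) * \<tau> ^ nat (sum_list \<kappa>)) summable_on Sign_plus L \<times> Sign_plus M"
  proof (rule summable_on_SigmaI)
    show "((\<lambda>\<kappa>. case (\<nu>, \<kappa>) of (\<nu>, \<kappa>) \<Rightarrow> \<sigma> ^ nat (sum_list \<nu>) * \<tau> ^ nat (sum_list \<kappa>)) has_sum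
        \<sigma> ^ nat (sum_list \<nu>) * (\<Sum>\<^sub>\<infinity>\<kappa>\<in>Sign_plus M. \<tau> ^ nat (sum_list \<kappa>))) (Sign_plus M)" for \<nu>
      using has_sum_infsum[OF summable_Sign_plus[OF assms(3,4), of M]]
      by (auto intro: has_sum_cmult_right)
  qed (use assms in \<open>auto intro: summable_on_cmult_left summable_Sign_plus\<close>)
  from summable_on_cmult_right[OF this, of C] show ?thesis
    by (simp add: case_prod_unfold)
qed

lemma growth_summable:
  assumes "growth X L x" "growth g L y" "0 \<le> x" "0 \<le> y" "x * y < 1"
  shows "(\<lambda>\<nu>. X \<nu> * g \<nu>) summable_on Sign_plus L"
proof -
  obtain \<rho> \<sigma> where r: "x < \<rho>" "y < \<sigma>" "0 < \<rho>" "0 < \<sigma>" "\<rho> * \<sigma> < 1"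
    using ex_growth_rates assms by blast
  obtain C where C: "C > 0" "\<forall>\<kappa>\<in>Sign_plus L. cmod (X \<kappa>) \<le> C * \<rho> ^ nat (sum_list \<kappa>)"
    using growthE[OF assms(1) r(3,1)] .
  obtain D where D: "D > 0" "\<forall>\<kappa>\<in>Sign_plus L. cmod (g \<kappa>) \<le> D * \<sigma> ^ nat (sum_list \<kappa>)"
    using growthE[OF assms(2) r(4,2)] .
  show ?thesis
  proof (rule summable_on_bounded)
    show "(\<lambda>\<nu>. C * D * (\<rho> * \<sigma>) ^ nat (sum_list \<nu>)) summable_on Sign_plus L"
      using r by (intro summable_on_cmult_right summable_Sign_plus) auto
    show "cmod (X \<nu> * g \<nu>) \<le> C * D * (\<rho> * \<sigma>) ^ nat (sum_list \<nu>)" if "\<nu> \<in> Sign_plus L" for \<nu>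
    proof -
      have "cmod (X \<nu> * g \<nu>) \<le> (C * \<rho> ^ nat (sum_list \<nu>)) * (D * \<sigma> ^ nat (sum_list \<nu>))"
        unfolding norm_mult using C D r that by (intro mult_mono) auto
      then show ?thesis by (simp add: power_mult_distrib mult_ac)
    qed
  qed
qed

text \<open>Estimating \<open>Y\<close> at a rate \<open>\<rho>\<close> and \<open>g\<close> at a
  smaller one makes the sum over \<open>\<kappa>\<close> a convergent series in their quotient. The
  critical rate \<open>y\<close> is unchanged, so any number of rows can be added.\<close>

lemma growth_step:
  assumes "kernel_bound Y L M y" "growth g L y" "0 \<le> y"
  shows "growth (\<lambda>\<nu>. \<Sum>\<^sub>\<infinity>\<kappa>\<in>Sign_plus L. Y \<kappa> \<nu> * g \<kappa>) M y"
  unfolding growth_def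
proof (intro allI impI)
  fix \<rho> :: real assume r: "0 < \<rho>" "y < \<rho>"
  obtain \<rho>1 where r1: "y < \<rho>1" "\<rho>1 < \<rho>" using dense r by blast
  obtain D where D: "D > 0" "\<forall>\<kappa>\<in>Sign_plus L. \<forall>\<nu>\<in>Sign_plus M.
     cmod (Y \<kappa> \<nu>) \<le> D * \<rho> ^ nat (sum_list \<nu>) / \<rho> ^ nat (sum_list \<kappa>)"
    using kernel_boundE[OF assms(1) r] .
  obtain C where C: "C > 0" "\<forall>\<kappa>\<in>Sign_plus L. cmod (g \<kappa>) \<le> C * \<rho>1 ^ nat (sum_list \<kappa>)"
    using growthE[OF assms(2) le_less_trans[OF assms(3) r1(1)] r1(1)] .
  define S where "S = (\<Sum>\<^sub>\<infinity>\<kappa>\<in>Sign_plus L. (\<rho>1 / \<rho>) ^ nat (sum_list \<kappa>))"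
  have tau: "0 \<le> \<rho>1 / \<rho>" "\<rho>1 / \<rho> < 1" using r r1 assms(3) by auto
  have S: "0 \<le> S" unfolding S_def using tau by (intro infsum_nonneg) auto
  show "\<exists>C>0. \<forall>\<nu>\<in>Sign_plus M. cmod (\<Sum>\<^sub>\<infinity>\<kappa>\<in>Sign_plus L. Y \<kappa> \<nu> * g \<kappa>) \<le> C * \<rho> ^ nat (sum_list \<nu>)"
  proof (intro exI[of _ "D * C * (S + 1)"] conjI ballI)
    fix \<nu> assume nu: "\<nu> \<in> Sign_plus M"
    let ?b = "\<lambda>\<kappa>. D * C * \<rho> ^ nat (sum_list \<nu>) * (\<rho>1 / \<rho>) ^ nat (sum_list \<kappa>)"
    have le: "cmod (Y \<kappa> \<nu> * g \<kappa>) \<le> ?b \<kappa>" if "\<kappa> \<in> Sign_plus L" for \<kappa>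
    proof -
      have "cmod (Y \<kappa> \<nu> * g \<kappa>) \<le> (D * \<rho> ^ nat (sum_list \<nu>) / \<rho> ^ nat (sum_list \<kappa>)) *
          (C * \<rho>1 ^ nat (sum_list \<kappa>))"
        unfolding norm_mult using C D r nu that by (intro mult_mono) auto
      then show ?thesis by (simp add: power_divide mult_ac)
    qed
    have sb: "?b summable_on Sign_plus L"
      using tau by (intro summable_on_cmult_right summable_Sign_plus)
    have "cmod (\<Sum>\<^sub>\<infinity>\<kappa>\<in>Sign_plus L. Y \<kappa> \<nu> * g \<kappa>) \<le> (\<Sum>\<^sub>\<infinity>\<kappa>\<in>Sign_plus L. ?b \<kappa>)"
      by (rule norm_infsum_le[OF has_sum_infsum[OF summable_on_bounded[OF sb le]] has_sum_infsum[OF sb] le])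
    also have "\<dots> = D * C * \<rho> ^ nat (sum_list \<nu>) * S"
      unfolding S_def by (rule infsum_cmult_right')
    also have "\<dots> \<le> D * C * (S + 1) * \<rho> ^ nat (sum_list \<nu>)"
      using C D r by (simp add: algebra_simps)
    finally show "cmod (\<Sum>\<^sub>\<infinity>\<kappa>\<in>Sign_plus L. Y \<kappa> \<nu> * g \<kappa>) \<le> D * C * (S + 1) * \<rho> ^ nat (sum_list \<nu>)" .
  qed (use C D S in auto)
qed

text \<open>\<open>X\<close> is a row attached to a fixed signature, \<open>Y\<close> the row that
  it passes, and \<open>g\<close> stands for the rows behind. The one-row identity needs the sum
  over \<nu> innermost, so the order of summation is changed before it for (\<nu>, \<kappa>) and
  after it for (\<kappa>, \<rho>).\<close>

lemma kernel_exchange: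
  assumes x: "0 \<le> x" and y: "0 \<le> y" and xy: "x * y < 1"
    and X: "growth X n1 x" and Y: "kernel_bound Y n2 n1 y" and g: "growth g n2 y"
    and X': "kernel_bound X' n3 n2 x" and Y': "kernel_bound Y' n3 m y" and mu: "\<mu> \<in> Sign_plus m"
    and commute: "\<And>\<kappa>. \<kappa> \<in> Sign_plus n2 \<Longrightarrow>
      (\<Sum>\<^sub>\<infinity>\<nu>\<in>Sign_plus n1. X \<nu> * Y \<kappa> \<nu>) = f * (\<Sum>\<^sub>\<infinity>\<rho>\<in>Sign_plus n3. Y' \<rho> \<mu> * X' \<rho> \<kappa>)"
  shows "(\<Sum>\<^sub>\<infinity>\<nu>\<in>Sign_plus n1. X \<nu> * (\<Sum>\<^sub>\<infinity>\<kappa>\<in>Sign_plus n2. Y \<kappa> \<nu> * g \<kappa>)) =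
    f * (\<Sum>\<^sub>\<infinity>\<rho>\<in>Sign_plus n3. Y' \<rho> \<mu> * (\<Sum>\<^sub>\<infinity>\<kappa>\<in>Sign_plus n2. X' \<rho> \<kappa> * g \<kappa>))"
proof -
  obtain \<sigma> \<rho> where r: "x < \<sigma>" "y < \<rho>" "0 < \<sigma>" "0 < \<rho>" "\<sigma> * \<rho> < 1"
    using ex_growth_rates x y xy by blast
  obtain \<rho>1 where r1: "y < \<rho>1" "\<rho>1 < \<rho>" using dense r by blast
  obtain C where C: "C > 0" "\<forall>\<kappa>\<in>Sign_plus n2. cmod (g \<kappa>) \<le> C * \<rho>1 ^ nat (sum_list \<kappa>)"
    using growthE[OF g le_less_trans[OF y r1(1)] r1(1)] .
  obtain A where A: "A > 0" "\<forall>\<nu>\<in>Sign_plus n1. cmod (X \<nu>) \<le> A * \<sigma> ^ nat (sum_list \<nu>)"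
    using growthE[OF X r(3,1)] .
  obtain D where D: "D > 0" "\<forall>\<kappa>\<in>Sign_plus n2. \<forall>\<nu>\<in>Sign_plus n1.
     cmod (Y \<kappa> \<nu>) \<le> D * \<rho> ^ nat (sum_list \<nu>) / \<rho> ^ nat (sum_list \<kappa>)"
    using kernel_boundE[OF Y r(4,2)] .
  obtain E where E: "E > 0" "\<forall>\<kappa>\<in>Sign_plus n3. \<forall>\<nu>\<in>Sign_plus n2.
     cmod (X' \<kappa> \<nu>) \<le> E * \<sigma> ^ nat (sum_list \<nu>) / \<sigma> ^ nat (sum_list \<kappa>)"
    using kernel_boundE[OF X' r(3,1)] .
  \<comment> \<open>The upper end \<open>\<mu>\<close> of \<open>Y'\<close> is fixed, so
    \<open>Y'\<close> may be estimated at a large rate at the cost of a constant;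
    \<open>R * \<sigma> > 1\<close> makes the sum over the lower signature converge
    geometrically.\<close>
  define R where "R = y + 1 + 1 / \<sigma>"
  have R: "0 < R" "y < R" "1 < R * \<sigma>"
    using r y by (auto simp: R_def field_simps add_pos_nonneg)
  obtain H where H: "H > 0" "\<forall>\<kappa>\<in>Sign_plus n3. \<forall>\<nu>\<in>Sign_plus m.
     cmod (Y' \<kappa> \<nu>) \<le> H * R ^ nat (sum_list \<nu>) / R ^ nat (sum_list \<kappa>)"
    using kernel_boundE[OF Y' R(1,2)] .
  have tau: "0 \<le> \<rho>1 / \<rho>" "\<rho>1 / \<rho> < 1" "0 \<le> \<sigma> * \<rho>" "0 \<le> \<sigma> * \<rho>1" "\<sigma> * \<rho>1 < 1"
    using r r1 y by (auto intro: less_trans[OF mult_strict_left_mono])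
  have s1: "(\<lambda>(\<nu>, \<kappa>). X \<nu> * Y \<kappa> \<nu> * g \<kappa>) summable_on Sign_plus n1 \<times> Sign_plus n2"
  proof (rule summable_on_bounded)
    show "(\<lambda>(\<nu>, \<kappa>). (A * D * C) * ((\<sigma> * \<rho>) ^ nat (sum_list \<nu>) * (\<rho>1 / \<rho>) ^ nat (sum_list \<kappa>)))
        summable_on Sign_plus n1 \<times> Sign_plus n2"
      using r tau by (intro summable_on_Times_powers) auto
    fix z assume "z \<in> Sign_plus n1 \<times> Sign_plus n2"
    then obtain \<nu> \<kappa> where z: "z = (\<nu>, \<kappa>)" "\<nu> \<in> Sign_plus n1" "\<kappa> \<in> Sign_plus n2" by auto
    have "cmod (X \<nu> * Y \<kappa> \<nu> * g \<kappa>) \<le> (A * \<sigma> ^ nat (sum_list \<nu>)) *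
        (D * \<rho> ^ nat (sum_list \<nu>) / \<rho> ^ nat (sum_list \<kappa>)) * (C * \<rho>1 ^ nat (sum_list \<kappa>))"
      unfolding norm_mult using A C D r z by (intro mult_mono) auto
    then show "cmod (case z of (\<nu>, \<kappa>) \<Rightarrow> X \<nu> * Y \<kappa> \<nu> * g \<kappa>) \<le> (case z of (\<nu>, \<kappa>) \<Rightarrow>
        (A * D * C) * ((\<sigma> * \<rho>) ^ nat (sum_list \<nu>) * (\<rho>1 / \<rho>) ^ nat (sum_list \<kappa>)))"
      by (simp add: z power_divide power_mult_distrib mult_ac)
  qed
  have s2: "(\<lambda>(\<kappa>, \<theta>). Y' \<theta> \<mu> * X' \<theta> \<kappa> * g \<kappa>) summable_on Sign_plus n2 \<times> Sign_plus n3"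
  proof (rule summable_on_bounded)
    show "(\<lambda>(\<kappa>, \<theta>). (H * R ^ nat (sum_list \<mu>) * E * C) *
        ((\<sigma> * \<rho>1) ^ nat (sum_list \<kappa>) * (1 / (R * \<sigma>)) ^ nat (sum_list \<theta>)))
        summable_on Sign_plus n2 \<times> Sign_plus n3"
      using R tau by (intro summable_on_Times_powers) auto
    fix z assume "z \<in> Sign_plus n2 \<times> Sign_plus n3"
    then obtain \<kappa> \<theta> where z: "z = (\<kappa>, \<theta>)" "\<kappa> \<in> Sign_plus n2" "\<theta> \<in> Sign_plus n3" by auto
    have "cmod (Y' \<theta> \<mu> * X' \<theta> \<kappa> * g \<kappa>) \<le> (H * R ^ nat (sum_list \<mu>) / R ^ nat (sum_list \<theta>)) *
        (E * \<sigma> ^ nat (sum_list \<kappa>) / \<sigma> ^ nat (sum_list \<theta>)) * (C * \<rho>1 ^ nat (sum_list \<kappa>))"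
      unfolding norm_mult using H E C R r z mu by (intro mult_mono) auto
    then show "cmod (case z of (\<kappa>, \<theta>) \<Rightarrow> Y' \<theta> \<mu> * X' \<theta> \<kappa> * g \<kappa>) \<le> (case z of (\<kappa>, \<theta>) \<Rightarrow>
        (H * R ^ nat (sum_list \<mu>) * E * C) *
        ((\<sigma> * \<rho>1) ^ nat (sum_list \<kappa>) * (1 / (R * \<sigma>)) ^ nat (sum_list \<theta>)))"
      by (simp add: z power_divide power_mult_distrib mult_ac)
  qed
  have "(\<Sum>\<^sub>\<infinity>\<nu>\<in>Sign_plus n1. X \<nu> * (\<Sum>\<^sub>\<infinity>\<kappa>\<in>Sign_plus n2. Y \<kappa> \<nu> * g \<kappa>)) =
      (\<Sum>\<^sub>\<infinity>\<nu>\<in>Sign_plus n1. \<Sum>\<^sub>\<infinity>\<kappa>\<in>Sign_plus n2. X \<nu> * Y \<kappa> \<nu> * g \<kappa>)"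
    by (simp add: mult.assoc infsum_cmult_right')
  also have "\<dots> = (\<Sum>\<^sub>\<infinity>\<kappa>\<in>Sign_plus n2. \<Sum>\<^sub>\<infinity>\<nu>\<in>Sign_plus n1. X \<nu> * Y \<kappa> \<nu> * g \<kappa>)"
    by (rule infsum_swap_banach[OF s1])
  also have "\<dots> = (\<Sum>\<^sub>\<infinity>\<kappa>\<in>Sign_plus n2. f * (\<Sum>\<^sub>\<infinity>\<theta>\<in>Sign_plus n3. Y' \<theta> \<mu> * X' \<theta> \<kappa> * g \<kappa>))"
    by (intro infsum_cong) (simp add: infsum_cmult_left' commute)
  also have "\<dots> = f * (\<Sum>\<^sub>\<infinity>\<theta>\<in>Sign_plus n3. \<Sum>\<^sub>\<infinity>\<kappa>\<in>Sign_plus n2. Y' \<theta> \<mu> * X' \<theta> \<kappa> * g \<kappa>)"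
    by (simp add: infsum_cmult_right' infsum_swap_banach[OF s2])
  also have "\<dots> = f * (\<Sum>\<^sub>\<infinity>\<rho>\<in>Sign_plus n3. Y' \<rho> \<mu> * (\<Sum>\<^sub>\<infinity>\<kappa>\<in>Sign_plus n2. X' \<rho> \<kappa> * g \<kappa>))"
    by (simp add: mult.assoc infsum_cmult_right')
  finally show ?thesis .
qed

section \<open>Iteration over the rows\<close>

lemma ex_common_bound:
  fixes a :: "nat \<Rightarrow> real"
  assumes "\<And>i. i \<in> {1..M} \<Longrightarrow> a i * b < 1"
  obtains y where "0 \<le> y" "\<And>i. i \<in> {1..M} \<Longrightarrow> a i \<le> y" "y * b < 1"
proof -
  let ?y = "Max (insert 0 (a ` {1..M}))"
  have "?y \<in> insert 0 (a ` {1..M})" by (intro Max_in) auto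
  then have "?y * b < 1" using assms by auto
  moreover have "a i \<le> ?y" if "i \<in> {1..M}" for i using that by (intro Max_ge) auto
  moreover have "0 \<le> ?y" by (intro Max_ge) auto
  ultimately show thesis using that by blast
qed

lemma skew_cauchy_row:
  assumes "generic_parameters q s" "1 - s * u \<noteq> 0" "1 - s * v \<noteq> 0" "1 - u * v \<noteq> 0"
    and t: "cmod ((u - s) / (1 - s * u) * ((v - s) / (1 - s * v))) < 1"
    and mu: "\<mu> \<in> Sign_plus l" and lam: "lam \<in> Sign_plus (Suc l)"
  shows "(\<Sum>\<^sub>\<infinity>\<kappa>\<in>Sign_plus (Suc l).
      row_weight (vertex_weight q s u) 1 \<mu> \<kappa> * row_weight (conj_weight q s v) 0 lam \<kappa>) =
    (1 - q * u * v) / (1 - u * v) * (\<Sum>\<^sub>\<infinity>\<rho>\<in>Sign_plus l.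
      row_weight (vertex_weight q s u) 1 \<rho> lam * row_weight (conj_weight q s v) 0 \<rho> \<mu>)"
proof (rule skew_cauchy_row_summable[OF assms])
  have "kernel_bound (row_weight (vertex_weight q s u) 1) l (Suc l) (cmod ((u - s) / (1 - s * u)))"
    using kernel_bound_row_weight[OF path_weights_vertex_weight[OF assms(2)], of q _ 1 l]
    by (simp add: vertex_weight_simps)
  moreover have "kernel_bound (row_weight (conj_weight q s v) 0) (Suc l) (Suc l) (cmod ((v - s) / (1 - s * v)))"
    using kernel_bound_row_weight[OF path_weights_conj_weight[OF assms(3)], of q _ 0 "Suc l"]
    by (simp add: conj_weight_simps[OF assms(1)])
  ultimately show "(\<lambda>\<kappa>. row_weight (vertex_weight q s u) 1 \<mu> \<kappa> *
      row_weight (conj_weight q s v) 0 lam \<kappa>) summable_on Sign_plus (Suc l)"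
    using t unfolding norm_mult
    by (intro growth_summable[OF growth_kernel[OF _ mu] growth_kernel[OF _ lam]]) auto
qed

lemma growth_0: "growth F 0 a"
  unfolding growth_def Sign_plus_0
  by (auto intro!: exI[of _ "cmod (F []) + 1"] add_nonneg_pos)

text \<open>The \<open>v\<close>-row passes through the \<open>u\<close>-rows one at a time, each
  exchange contributing a factor, until it acts on the empty signature and disappears.
  \<open>F\<close> enters only through its recursion in the number of rows, and all
  \<open>u\<close>-rows are estimated with one common rate \<open>y\<close>.\<close>

lemma cauchy_F_rows:
  fixes F :: "nat \<Rightarrow> int list \<Rightarrow> complex"
  assumes gen: "generic_parameters q s"
    and u: "\<And>i. i \<in> {1..M} \<Longrightarrow> 1 - s * u i \<noteq> 0 \<and> 1 - s * v \<noteq> 0 \<and> 1 - u i * v \<noteq> 0 \<and>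
            cmod ((u i - s) / (1 - s * u i) * ((v - s) / (1 - s * v))) < 1"
    and F_Suc: "\<And>j \<nu>. j < M \<Longrightarrow> \<nu> \<in> Sign_plus (Suc j) \<Longrightarrow> F (Suc j) \<nu> =
      (\<Sum>\<^sub>\<infinity>\<kappa>\<in>Sign_plus j. row_weight (vertex_weight q s (u (Suc j))) 1 \<kappa> \<nu> * F j \<kappa>)"
    and M: "0 < M" and mu: "\<mu> \<in> Sign_plus M"
  shows "(\<lambda>\<nu>. row_weight (conj_weight q s v) 0 \<mu> \<nu> * F M \<nu>) summable_on Sign_plus M"
    and "(\<Sum>\<^sub>\<infinity>\<nu>\<in>Sign_plus M. row_weight (conj_weight q s v) 0 \<mu> \<nu> * F M \<nu>) =
      (\<Prod>i=1..M. (1 - q * u i * v) / (1 - u i * v)) * F M \<mu>"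
proof -
  let ?V = "row_weight (conj_weight q s v) 0"
  let ?U = "\<lambda>j. row_weight (vertex_weight q s (u j)) 1"
  have sv: "1 - s * v \<noteq> 0" using u[of 1] M by auto
  obtain y where y: "0 \<le> y" "\<And>i. i \<in> {1..M} \<Longrightarrow> cmod ((u i - s) / (1 - s * u i)) \<le> y"
      "y * cmod ((v - s) / (1 - s * v)) < 1"
    using ex_common_bound[of M "\<lambda>i. cmod ((u i - s) / (1 - s * u i))"] u unfolding norm_mult
    by blast
  let ?x = "cmod ((v - s) / (1 - s * v))"
  have xy: "?x * y < 1" using y(3) by (simp only: mult.commute)
  have V: "kernel_bound ?V L L ?x" for L
    using kernel_bound_row_weight[OF path_weights_conj_weight[OF sv], of q _ 0 L]
    by (simp add: conj_weight_simps[OF gen])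
  have U: "kernel_bound (?U (Suc j)) L (Suc L) y" if "j < M" for j L
    using kernel_bound_row_weight[OF path_weights_vertex_weight, of s "u (Suc j)" q y 1 L]
      u[of "Suc j"] y(2)[of "Suc j"] that by (simp add: vertex_weight_simps)
  have growth: "growth (F j) j y" if "j \<le> M" for j
    using that
  proof (induction j)
    case (Suc j)
    then have "growth (\<lambda>\<nu>. \<Sum>\<^sub>\<infinity>\<kappa>\<in>Sign_plus j. ?U (Suc j) \<kappa> \<nu> * F j \<kappa>) (Suc j) y"
      by (intro growth_step U y) auto
    then show ?case using F_Suc[of j] Suc.prems by (simp add: growth_def)
  qed (rule growth_0)
  show "(\<lambda>\<nu>. ?V \<mu> \<nu> * F M \<nu>) summable_on Sign_plus M"
    using growth_summable[OF growth_kernel[OF V mu] growth[OF order_refl] _ y(1) xy] by simp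
  \<comment> \<open>General in \<open>\<mu>\<close>, because after the exchange the
    \<open>v\<close>-row starts from the summation variable \<rho>.\<close>
  have "(\<Sum>\<^sub>\<infinity>\<nu>\<in>Sign_plus j. ?V \<mu> \<nu> * F j \<nu>) =
      (\<Prod>i=1..j. (1 - q * u i * v) / (1 - u i * v)) * F j \<mu>"
    if "j \<le> M" "\<mu> \<in> Sign_plus j" for j \<mu>
    using that
  proof (induction j arbitrary: \<mu>)
    case 0
    then show ?case
      using path_weights_conj_weight[OF sv, of q]
      by (simp add: Sign_plus_0 row_weight_def row_prod_def mults_def path_weights_def)
  next
    case (Suc j)
    then have j: "j < M" by simp
    let ?f = "(1 - q * u (Suc j) * v) / (1 - u (Suc j) * v)"
    have "(\<Sum>\<^sub>\<infinity>\<nu>\<in>Sign_plus (Suc j). ?V \<mu> \<nu> * F (Suc j) \<nu>) =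
        (\<Sum>\<^sub>\<infinity>\<nu>\<in>Sign_plus (Suc j). ?V \<mu> \<nu> * (\<Sum>\<^sub>\<infinity>\<kappa>\<in>Sign_plus j. ?U (Suc j) \<kappa> \<nu> * F j \<kappa>))"
      by (intro infsum_cong) (simp add: F_Suc[OF j])
    also have "\<dots> = ?f * (\<Sum>\<^sub>\<infinity>\<rho>\<in>Sign_plus j. ?U (Suc j) \<rho> \<mu> * (\<Sum>\<^sub>\<infinity>\<kappa>\<in>Sign_plus j. ?V \<rho> \<kappa> * F j \<kappa>))"
    proof (rule kernel_exchange[OF norm_ge_zero y(1) xy growth_kernel[OF V Suc.prems(2)]
          U[OF j] growth V U[OF j] Suc.prems(2)])
      fix \<kappa> assume k: "\<kappa> \<in> Sign_plus j"
      have "Suc j \<in> {1..M}" using j by simp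
      from u[OF this] skew_cauchy_row[OF gen _ sv _ _ k Suc.prems(2), of "u (Suc j)"]
      show "(\<Sum>\<^sub>\<infinity>\<nu>\<in>Sign_plus (Suc j). ?V \<mu> \<nu> * ?U (Suc j) \<kappa> \<nu>) =
          ?f * (\<Sum>\<^sub>\<infinity>\<rho>\<in>Sign_plus j. ?U (Suc j) \<rho> \<mu> * ?V \<rho> \<kappa>)"
        by (simp add: mult.commute)
    qed (use j in simp)
    also have "\<dots> = ?f * (\<Sum>\<^sub>\<infinity>\<rho>\<in>Sign_plus j. (\<Prod>i=1..j. (1 - q * u i * v) / (1 - u i * v)) *
        (?U (Suc j) \<rho> \<mu> * F j \<rho>))"
      by (intro arg_cong[where f = "(*) ?f"] infsum_cong)
        (simp only: Suc.IH[OF less_imp_le[OF j]] mult.left_commute)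
    also have "\<dots> = ?f * ((\<Prod>i=1..j. (1 - q * u i * v) / (1 - u i * v)) * F (Suc j) \<mu>)"
      by (simp only: infsum_cmult_right' F_Suc[OF j Suc.prems(2)])
    also have "\<dots> = (\<Prod>i=1..Suc j. (1 - q * u i * v) / (1 - u i * v)) * F (Suc j) \<mu>"
      by (simp add: mult_ac)
    finally show ?case .
  qed
  from this[OF order_refl mu]
  show "(\<Sum>\<^sub>\<infinity>\<nu>\<in>Sign_plus M. ?V \<mu> \<nu> * F M \<nu>) =
      (\<Prod>i=1..M. (1 - q * u i * v) / (1 - u i * v)) * F M \<mu>" .
qed

text \<open>The size cannot decrease along a row, so a row ending in zeros starts from zeros. Then
  only column 0 is occupied, and its vertex (l, 1; l + 1, 0) gives the whole weight.\<close>

lemma row_weight_zeros: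
  assumes "1 - s * u \<noteq> 0" "lam \<in> Sign_plus l"
  shows "row_weight (vertex_weight q s u) 1 lam (replicate (Suc l) 0) =
    (if lam = replicate l 0 then (1 - q ^ (l + 1)) / (1 - s * u) else 0)"
proof -
  have z: "replicate n 0 \<in> Sign_plus n" for n
    by (induction n) (auto simp: Sign_plus_def Sign_def)
  show ?thesis
  proof (cases "lam = replicate l 0")
    case True
    then show ?thesis
      by (simp add: row_weight_def row_prod_def mults_def vertex_weight_simps sum_list_replicate)
  next
    case False
    have "\<not> sum_list lam \<le> 0"
    proof
      assume s: "sum_list lam \<le> 0"
      have "a = 0" if "a \<in> set lam" for a
        using Sign_plus_le_sum[OF assms(2) that] Sign_plus_nonneg[OF assms(2) that] s by simp
      then show False using False Sign_plus_length[OF assms(2)] by (metis replicate_eqI)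
    qed
    then have "row_weight (vertex_weight q s u) 1 lam (replicate (Suc l) 0) = 0"
      using row_weight_sum_le[OF path_weights_vertex_weight[OF assms(1)] _ assms(2), of q 1 "replicate (Suc l) 0"]
        z[of "Suc l"] by (auto simp: sum_list_replicate)
    then show ?thesis using False by simp
  qed
qed

lemma growth_finite_support:
  assumes "\<And>\<nu>. \<nu> \<in> Sign_plus L \<Longrightarrow> \<nu> \<noteq> \<nu>0 \<Longrightarrow> g \<nu> = 0"
  shows "growth g L a"
  unfolding growth_def
proof (intro allI impI)
  fix \<rho> :: real assume r: "0 < \<rho>"
  show "\<exists>C>0. \<forall>\<kappa>\<in>Sign_plus L. cmod (g \<kappa>) \<le> C * \<rho> ^ nat (sum_list \<kappa>)"
  proof (intro exI[of _ "(cmod (g \<nu>0) + 1) / \<rho> ^ nat (sum_list \<nu>0)"] conjI ballI)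
    fix \<kappa> assume "\<kappa> \<in> Sign_plus L"
    then show "cmod (g \<kappa>) \<le> (cmod (g \<nu>0) + 1) / \<rho> ^ nat (sum_list \<nu>0) * \<rho> ^ nat (sum_list \<kappa>)"
      using assms[of \<kappa>] r by (cases "\<kappa> = \<nu>0") auto
  qed (use r in \<open>auto intro!: divide_pos_pos add_nonneg_pos\<close>)
qed

text \<open>The \<open>u\<close>-row passes through the \<open>v\<close>-rows. Since it adds one
  part, \<open>G\<close> is needed both for length l and for length l + 1. At the bottom
  \<open>G\<close> is concentrated at the zero signature, where \<open>row_weight_zeros\<close>
  supplies the constant factor.\<close>

lemma cauchy_G_rows:
  fixes G :: "nat \<Rightarrow> nat \<Rightarrow> int list \<Rightarrow> complex"
  assumes gen: "generic_parameters q s" and su: "1 - s * u \<noteq> 0"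
    and v: "\<And>j. j \<in> {1..N} \<Longrightarrow> 1 - s * v j \<noteq> 0 \<and> 1 - u * v j \<noteq> 0 \<and>
            cmod ((u - s) / (1 - s * u) * ((v j - s) / (1 - s * v j))) < 1"
    and G_0: "\<And>L \<nu>. \<nu> \<in> Sign_plus L \<Longrightarrow> G L 0 \<nu> = (if \<nu> = replicate L 0 then 1 else 0)"
    and G_Suc: "\<And>L j \<nu>. j < N \<Longrightarrow> \<nu> \<in> Sign_plus L \<Longrightarrow> G L (Suc j) \<nu> =
      (\<Sum>\<^sub>\<infinity>\<kappa>\<in>Sign_plus L. row_weight (conj_weight q s (v (Suc j))) 0 \<kappa> \<nu> * G L j \<kappa>)"
    and lam: "lam \<in> Sign_plus l"
  shows "(\<lambda>\<nu>. row_weight (vertex_weight q s u) 1 lam \<nu> * G (Suc l) N \<nu>) summable_on Sign_plus (Suc l)"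
    and "(\<Sum>\<^sub>\<infinity>\<nu>\<in>Sign_plus (Suc l). row_weight (vertex_weight q s u) 1 lam \<nu> * G (Suc l) N \<nu>) =
      (1 - q ^ (l + 1)) / (1 - s * u) * ((\<Prod>j=1..N. (1 - q * u * v j) / (1 - u * v j)) * G l N lam)"
proof -
  let ?V = "\<lambda>j. row_weight (conj_weight q s (v j)) 0"
  let ?U = "row_weight (vertex_weight q s u) 1"
  let ?x = "cmod ((u - s) / (1 - s * u))"
  have lt: "cmod ((v j - s) / (1 - s * v j)) * ?x < 1" if "j \<in> {1..N}" for j
    using v[OF that] unfolding norm_mult by (simp only: mult.commute)
  obtain y where y: "0 \<le> y" "\<And>i. i \<in> {1..N} \<Longrightarrow> cmod ((v i - s) / (1 - s * v i)) \<le> y" "y * ?x < 1"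
    using ex_common_bound[of N "\<lambda>j. cmod ((v j - s) / (1 - s * v j))" ?x] lt by blast
  have xy: "?x * y < 1" using y(3) by (simp only: mult.commute)
  have U: "kernel_bound ?U L (Suc L) ?x" for L
    using kernel_bound_row_weight[OF path_weights_vertex_weight[OF su], of q _ 1 L]
    by (simp add: vertex_weight_simps)
  have V: "kernel_bound (?V (Suc j)) L L y" if "j < N" for j L
    using kernel_bound_row_weight[OF path_weights_conj_weight, of s "v (Suc j)" q y 0 L]
      v[of "Suc j"] y(2)[of "Suc j"] that by (simp add: conj_weight_simps[OF gen])
  have growth: "growth (G L j) L y" if "j \<le> N" for j L
    using that
  proof (induction j)
    case 0
    show ?case by (rule growth_finite_support[of _ "replicate L 0"]) (simp add: G_0)
  next
    case (Suc j)
    then have "growth (\<lambda>\<nu>. \<Sum>\<^sub>\<infinity>\<kappa>\<in>Sign_plus L. ?V (Suc j) \<kappa> \<nu> * G L j \<kappa>) L y"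
      by (intro growth_step V y) auto
    then show ?case using G_Suc[of j] Suc.prems by (simp add: growth_def)
  qed
  show "(\<lambda>\<nu>. ?U lam \<nu> * G (Suc l) N \<nu>) summable_on Sign_plus (Suc l)"
    using growth_summable[OF growth_kernel[OF U lam] growth[OF order_refl] _ y(1) xy] by simp
  have "(\<Sum>\<^sub>\<infinity>\<nu>\<in>Sign_plus (Suc l). ?U lam \<nu> * G (Suc l) j \<nu>) =
      (1 - q ^ (l + 1)) / (1 - s * u) * ((\<Prod>i=1..j. (1 - q * u * v i) / (1 - u * v i)) * G l j lam)"
    if "j \<le> N" "lam \<in> Sign_plus l" for j lam
    using that
  proof (induction j arbitrary: lam)
    case 0
    have "(\<Sum>\<^sub>\<infinity>\<nu>\<in>Sign_plus (Suc l). ?U lam \<nu> * G (Suc l) 0 \<nu>) =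
        (\<Sum>\<^sub>\<infinity>\<nu>\<in>{replicate (Suc l) 0}. ?U lam \<nu> * G (Suc l) 0 \<nu>)"
    proof (rule infsum_cong_neutral)
      have "replicate (Suc l) (0::int) \<in> Sign_plus (Suc l)"
        by (induction l) (auto simp: Sign_plus_def Sign_def)
      then show "?U lam \<nu> * G (Suc l) 0 \<nu> = 0" if "\<nu> \<in> {replicate (Suc l) 0} - Sign_plus (Suc l)" for \<nu>
        using that by blast
    qed (auto simp: G_0)
    also have "\<dots> = ?U lam (replicate (Suc l) 0)"
      using G_0[of "replicate (Suc l) 0" "Suc l"]
      by (auto simp: Sign_plus_def Sign_def sorted_wrt_iff_nth_less nth_Cons')
    finally show ?case
      using row_weight_zeros[OF su 0(2), of q] G_0[OF 0(2)] by simp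
  next
    case (Suc j)
    then have j: "j < N" by simp
    let ?f = "(1 - q * u * v (Suc j)) / (1 - u * v (Suc j))"
    let ?K = "(1 - q ^ (l + 1)) / (1 - s * u)"
    have "(\<Sum>\<^sub>\<infinity>\<nu>\<in>Sign_plus (Suc l). ?U lam \<nu> * G (Suc l) (Suc j) \<nu>) =
        (\<Sum>\<^sub>\<infinity>\<nu>\<in>Sign_plus (Suc l). ?U lam \<nu> *
          (\<Sum>\<^sub>\<infinity>\<kappa>\<in>Sign_plus (Suc l). ?V (Suc j) \<kappa> \<nu> * G (Suc l) j \<kappa>))"
      by (intro infsum_cong) (simp add: G_Suc[OF j])
    also have "\<dots> = ?f * (\<Sum>\<^sub>\<infinity>\<rho>\<in>Sign_plus l. ?V (Suc j) \<rho> lam *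
        (\<Sum>\<^sub>\<infinity>\<kappa>\<in>Sign_plus (Suc l). ?U \<rho> \<kappa> * G (Suc l) j \<kappa>))"
    proof (rule kernel_exchange[OF norm_ge_zero y(1) xy growth_kernel[OF U Suc.prems(2)]
          V[OF j] growth U V[OF j] Suc.prems(2)])
      fix \<kappa> assume k: "\<kappa> \<in> Sign_plus (Suc l)"
      have "Suc j \<in> {1..N}" using j by simp
      from v[OF this] skew_cauchy_row[OF gen su _ _ _ Suc.prems(2) k, of "v (Suc j)"]
      show "(\<Sum>\<^sub>\<infinity>\<nu>\<in>Sign_plus (Suc l). ?U lam \<nu> * ?V (Suc j) \<kappa> \<nu>) =
          ?f * (\<Sum>\<^sub>\<infinity>\<rho>\<in>Sign_plus l. ?V (Suc j) \<rho> lam * ?U \<rho> \<kappa>)"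
        by (simp add: mult.commute)
    qed (use j in simp)
    also have "\<dots> = ?f * (\<Sum>\<^sub>\<infinity>\<rho>\<in>Sign_plus l. (?K * (\<Prod>i=1..j. (1 - q * u * v i) / (1 - u * v i))) *
        (?V (Suc j) \<rho> lam * G l j \<rho>))"
      by (intro arg_cong[where f = "(*) ?f"] infsum_cong)
        (subst Suc.IH[OF less_imp_le[OF j]], assumption, simp only: mult_ac)
    also have "\<dots> = ?f * ((?K * (\<Prod>i=1..j. (1 - q * u * v i) / (1 - u * v i))) * G l (Suc j) lam)"
      by (simp only: infsum_cmult_right' G_Suc[OF j Suc.prems(2)])
    also have "\<dots> = ?K * ((\<Prod>i=1..Suc j. (1 - q * u * v i) / (1 - u * v i)) * G l (Suc j) lam)"
      by (simp add: mult_ac)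
    finally show ?case .
  qed
  from this[OF order_refl lam]
  show "(\<Sum>\<^sub>\<infinity>\<nu>\<in>Sign_plus (Suc l). ?U lam \<nu> * G (Suc l) N \<nu>) =
      (1 - q ^ (l + 1)) / (1 - s * u) * ((\<Prod>j=1..N. (1 - q * u * v j) / (1 - u * v j)) * G l N lam)" .
qed


section \<open>Path collections\<close>

lemma path_edges_iff:
  "(a, b) \<in> set (path_edges p) \<longleftrightarrow> (\<exists>i. Suc i < length p \<and> a = p ! i \<and> b = p ! Suc i)"
  by (auto simp: path_edges_def set_zip nth_tl less_diff_conv)

lemma path_edges_Cons: "path_edges (a # b # p) = (a, b) # path_edges (b # p)"
  by (simp add: path_edges_def)

lemma path_edges_append: "path_edges (p @ [a] @ r) = path_edges (p @ [a]) @ path_edges (a # r)"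
proof (induction p)
  case (Cons b p)
  then show ?case by (cases p) (simp_all add: path_edges_def)
qed (simp add: path_edges_def)

lemma length_path_edges: "length (path_edges p) = length p - 1"
  by (simp add: path_edges_def)

lemma path_edges_vertices: "(a, b) \<in> set (path_edges p) \<Longrightarrow> a \<in> set p \<and> b \<in> set p"
  by (auto simp: path_edges_iff)

context
  fixes p :: "vertex list"
  assumes path: "up_right_path p"
begin

lemma up_right_length: "2 \<le> length p"
  using path by (simp add: up_right_path_def)

lemma hd_path_edges: "hd (path_edges p) = (p ! 0, p ! 1)"
  using up_right_length
  by (subst hd_conv_nth) (auto simp: path_edges_def nth_tl simp flip: length_0_conv)

lemma last_path_edges: "last (path_edges p) = (p ! (length p - 2), p ! (length p - 1))"
  using up_right_length
  by (subst last_conv_nth) (auto simp: path_edges_def nth_tl numeral_2_eq_2 Suc_diff_Suc simp flip: length_0_conv)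

lemma up_right_step:
  assumes "Suc i < length p"
  shows "p ! Suc i = (fst (p ! i) + 1, snd (p ! i)) \<or> p ! Suc i = (fst (p ! i), snd (p ! i) + 1)"
proof -
  have "(p ! i, p ! Suc i) \<in> set (path_edges p)" using assms by (auto simp: path_edges_iff)
  then show ?thesis using path by (cases "p ! i") (force simp: up_right_path_def)
qed

lemma up_right_mono:
  assumes "i + d < length p"
  shows "fst (p ! i) \<le> fst (p ! (i + d)) \<and> snd (p ! i) \<le> snd (p ! (i + d)) \<and>
    fst (p ! (i + d)) + snd (p ! (i + d)) = fst (p ! i) + snd (p ! i) + int d"
  using assms
proof (induction d)
  case (Suc d)
  then show ?case using up_right_step[of "i + d"] by auto
qed simp

lemma up_right_mono':
  assumes "i \<le> j" "j < length p"
  shows "fst (p ! i) \<le> fst (p ! j)" "snd (p ! i) \<le> snd (p ! j)"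
  using up_right_mono[of i "j - i"] assms by auto

text \<open>The coordinate sum grows by one with every step, so a vertex determines its position on
  the path.\<close>

lemma up_right_inj:
  assumes "i < length p" "j < length p" "p ! i = p ! j"
  shows "i = j"
proof -
  have "i = j" if "i \<le> j" "j < length p" "p ! i = p ! j" for i j
    using up_right_mono[of i "j - i"] that by auto
  then show ?thesis using assms by (metis nle_le)
qed

lemma edge_in_iff:
  assumes "0 < i" "i < length p"
  shows "(a, p ! i) \<in> set (path_edges p) \<longleftrightarrow> a = p ! (i - 1)"
proof
  assume "(a, p ! i) \<in> set (path_edges p)"
  then obtain j where j: "Suc j < length p" "a = p ! j" "p ! i = p ! Suc j"
    by (auto simp: path_edges_iff)
  then show "a = p ! (i - 1)" using up_right_inj[OF assms(2) j(1,3)] by simp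
next
  assume "a = p ! (i - 1)"
  then show "(a, p ! i) \<in> set (path_edges p)"
    using assms by (auto simp: path_edges_iff intro!: exI[of _ "i - 1"])
qed

lemma edge_out_iff:
  assumes "Suc i < length p"
  shows "(p ! i, b) \<in> set (path_edges p) \<longleftrightarrow> b = p ! Suc i"
proof
  assume "(p ! i, b) \<in> set (path_edges p)"
  then obtain j where j: "Suc j < length p" "p ! i = p ! j" "b = p ! Suc j"
    by (auto simp: path_edges_iff)
  then show "b = p ! Suc i" using up_right_inj[of i j] assms by simp
qed (use assms in \<open>auto simp: path_edges_iff\<close>)

end

text \<open>What the prescribed edges of a collection with \<open>k\<close> rows say about each
  single path, for F and G alike.\<close>

definition lattice_path :: "nat \<Rightarrow> vertex list \<Rightarrow> bool" where
  "lattice_path k p \<longleftrightarrow> up_right_path p \<and>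
     ((\<exists>x\<ge>0. hd (path_edges p) = ((x, 0), (x, 1))) \<or>
      (\<exists>j\<ge>1. hd (path_edges p) = ((-1, j), (0, j)))) \<and>
     (\<exists>x\<ge>0. last (path_edges p) = ((x, int k), (x, int k + 1)))"

lemma lattice_path_up_right: "lattice_path k p \<Longrightarrow> up_right_path p"
  by (simp add: lattice_path_def)

lemma lattice_path_start:
  assumes "lattice_path k p"
  shows "snd (p ! 0) = 0 \<or> fst (p ! 0) = -1"
  using assms hd_path_edges[of p] by (auto simp: lattice_path_def)

lemma lattice_path_after_start:
  assumes "lattice_path k p" "0 < i" "i < length p"
  shows "0 \<le> fst (p ! i)" "1 \<le> snd (p ! i)"
proof -
  have "0 \<le> fst (p ! 1) \<and> 1 \<le> snd (p ! 1)"
    using assms(1) hd_path_edges[of p] by (auto simp: lattice_path_def)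
  then show "0 \<le> fst (p ! i)" "1 \<le> snd (p ! i)"
    using up_right_mono'[OF lattice_path_up_right[OF assms(1)], of 1 i] assms(2,3) by auto
qed

lemma lattice_path_before_end:
  assumes "lattice_path k p" "Suc i < length p"
  shows "snd (p ! i) \<le> int k"
proof -
  have "snd (p ! (length p - 2)) = int k"
    using assms(1) last_path_edges[of p] by (auto simp: lattice_path_def)
  then show ?thesis
    using up_right_mono'[OF lattice_path_up_right[OF assms(1)], of i "length p - 2"] assms(2) by auto
qed

lemma lattice_path_end:
  assumes "lattice_path k p"
  shows "snd (p ! (length p - 1)) = int k + 1"
  using assms last_path_edges[of p] by (auto simp: lattice_path_def)

text \<open>The first and the last vertex lie outside the strip x \<ge> 0, 1 \<le> y \<le> k, and
  all others inside. So being interior depends only on the position, and a vertex of the strip is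
  interior as soon as some path visits it.\<close>

lemma lattice_path_interior:
  assumes p: "lattice_path k p" and i: "i < length p"
  shows "0 \<le> fst (p ! i) \<and> 1 \<le> snd (p ! i) \<and> snd (p ! i) \<le> int k \<longleftrightarrow> 0 < i \<and> Suc i < length p"
proof
  assume *: "0 \<le> fst (p ! i) \<and> 1 \<le> snd (p ! i) \<and> snd (p ! i) \<le> int k"
  have "i \<noteq> 0" using lattice_path_start[OF p] * by (metis not_one_le_zero neg_0_le_iff_le)
  moreover have "i \<noteq> length p - 1" using lattice_path_end[OF p] * by force
  ultimately show "0 < i \<and> Suc i < length p" using i by auto
qed (use lattice_path_after_start[OF p] lattice_path_before_end[OF p] i in auto)

text \<open>A path visits a vertex of the strip at most once and neither begins nor ends there, so a
  visit uses exactly one of the two incoming and one of the two outgoing edges. Summed over a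
  collection, this is conservation.\<close>

lemma lattice_path_vertex:
  assumes p: "lattice_path k p" and z: "0 \<le> x" "1 \<le> y" "y \<le> int k"
  shows "of_bool (((x, y - 1), (x, y)) \<in> set (path_edges p)) +
      of_bool (((x - 1, y), (x, y)) \<in> set (path_edges p)) = (of_bool ((x, y) \<in> set p) :: nat)"
    and "of_bool (((x, y), (x, y + 1)) \<in> set (path_edges p)) +
      of_bool (((x, y), (x + 1, y)) \<in> set (path_edges p)) = (of_bool ((x, y) \<in> set p) :: nat)"
proof -
  note u = lattice_path_up_right[OF p]
  have "of_bool (((x, y - 1), (x, y)) \<in> set (path_edges p)) +
      of_bool (((x - 1, y), (x, y)) \<in> set (path_edges p)) = (of_bool ((x, y) \<in> set p) :: nat) \<and>
      of_bool (((x, y), (x, y + 1)) \<in> set (path_edges p)) +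
      of_bool (((x, y), (x + 1, y)) \<in> set (path_edges p)) = (of_bool ((x, y) \<in> set p) :: nat)"
  proof (cases "(x, y) \<in> set p")
    case True
    then obtain i where i: "i < length p" "p ! i = (x, y)" by (auto simp: in_set_conv_nth)
    then have j: "0 < i" "Suc i < length p" using lattice_path_interior[OF p i(1)] z by auto
    have "p ! i = (fst (p ! (i - 1)) + 1, snd (p ! (i - 1))) \<or>
        p ! i = (fst (p ! (i - 1)), snd (p ! (i - 1)) + 1)"
      using up_right_step[OF u, of "i - 1"] j by simp
    then have "p ! (i - 1) = (x, y - 1) \<or> p ! (i - 1) = (x - 1, y)"
      unfolding i(2) by (elim disjE) (simp_all add: prod_eq_iff)
    moreover have "p ! Suc i = (x + 1, y) \<or> p ! Suc i = (x, y + 1)"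
      using up_right_step[OF u j(2)] i(2) by simp
    moreover have edges: "(a, (x, y)) \<in> set (path_edges p) \<longleftrightarrow> a = p ! (i - 1)"
      "((x, y), a) \<in> set (path_edges p) \<longleftrightarrow> a = p ! Suc i" for a
      using edge_in_iff[OF u j(1) i(1)] edge_out_iff[OF u j(2)] i(2) by metis+
    ultimately show ?thesis by (elim disjE) (simp_all add: True edges)
  next
    case False
    then show ?thesis using path_edges_vertices[of _ _ p] by auto
  qed
  then show "of_bool (((x, y - 1), (x, y)) \<in> set (path_edges p)) +
      of_bool (((x - 1, y), (x, y)) \<in> set (path_edges p)) = (of_bool ((x, y) \<in> set p) :: nat)"
    and "of_bool (((x, y), (x, y + 1)) \<in> set (path_edges p)) +
      of_bool (((x, y), (x + 1, y)) \<in> set (path_edges p)) = (of_bool ((x, y) \<in> set p) :: nat)"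
    by auto
qed

text \<open>After its first step a path has left the boundary y = 0 or x = -1 for good. The counts
  of edges issuing from the boundary are therefore prescribed.\<close>

lemma lattice_path_first_edge:
  assumes p: "lattice_path k p" and a: "snd a = 0 \<or> fst a = -1"
  shows "(a, b) \<in> set (path_edges p) \<longleftrightarrow> hd (path_edges p) = (a, b)"
proof
  note u = lattice_path_up_right[OF p]
  assume "(a, b) \<in> set (path_edges p)"
  then obtain i where i: "Suc i < length p" "a = p ! i" "b = p ! Suc i" by (auto simp: path_edges_iff)
  then have "i = 0" using lattice_path_after_start[OF p, of i] a by (cases i) auto
  then show "hd (path_edges p) = (a, b)" using hd_path_edges[OF u] i by simp
next
  have "path_edges p \<noteq> []"
    using up_right_length[OF lattice_path_up_right[OF p]] length_path_edges[of p] by auto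
  then show "(a, b) \<in> set (path_edges p)" if "hd (path_edges p) = (a, b)"
    using hd_in_set[of "path_edges p"] that by simp
qed

lemma lattice_path_last_edge:
  assumes p: "lattice_path k p" and b: "snd b = int k + 1"
  shows "(a, b) \<in> set (path_edges p) \<longleftrightarrow> last (path_edges p) = (a, b)"
proof
  note u = lattice_path_up_right[OF p]
  assume "(a, b) \<in> set (path_edges p)"
  then obtain i where i: "Suc i < length p" "a = p ! i" "b = p ! Suc i" by (auto simp: path_edges_iff)
  then have "\<not> Suc (Suc i) < length p" using lattice_path_before_end[OF p, of "Suc i"] b by auto
  then have "length p = Suc (Suc i)" using i by simp
  then show "last (path_edges p) = (a, b)" using last_path_edges[OF u] i by simp
next
  have "path_edges p \<noteq> []"
    using up_right_length[OF lattice_path_up_right[OF p]] length_path_edges[of p] by auto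
  then show "(a, b) \<in> set (path_edges p)" if "last (path_edges p) = (a, b)"
    using last_in_set[of "path_edges p"] that by simp
qed

section \<open>Edge counts of a collection and their encoding by signatures\<close>

lemma edge_count_sum: "edge_count P e = (\<Sum>p\<in>#P. of_bool (e \<in> set (path_edges p)))"
  unfolding edge_count_def by (induction P) auto

lemma count_image_mset_sum: "count (image_mset f P) e = (\<Sum>p\<in>#P. of_bool (f p = e))"
  by (induction P) auto

lemma count_vertical_edges:
  "count (vertical_edges \<kappa> y) ((x, int y'), (x', z)) =
     (if y' = y \<and> x' = x \<and> z = int y + 1 then count (mset \<kappa>) x else 0)"
  unfolding vertical_edges_def by (induction \<kappa>) auto

lemma count_entering_edges:
  "count (entering_edges k) ((-1, y), (0, y)) = (if 1 \<le> y \<and> y \<le> int k then 1 else 0)"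
proof -
  have inj: "inj (\<lambda>j. ((-1::int, int j), (0::int, int j)))" by (auto simp: inj_on_def)
  have "entering_edges k = mset_set ((\<lambda>j. ((-1, int j), (0, int j))) ` {1..k})"
    unfolding entering_edges_def using inj_on_subset[OF inj] by (intro image_mset_mset_set) auto
  moreover have "((-1, y), (0, y)) \<in> (\<lambda>j. ((-1::int, int j), (0::int, int j))) ` {1..k} \<longleftrightarrow> 1 \<le> y \<and> y \<le> int k"
    by (auto simp: image_iff Bex_def intro!: exI[of _ "nat y"])
  ultimately show ?thesis by simp
qed

lemma entering_edges_set: "a \<in># entering_edges k \<Longrightarrow> \<exists>j. 1 \<le> j \<and> j \<le> k \<and> a = ((-1, int j), (0, int j))"
  by (auto simp: entering_edges_def)

text \<open>Treats both functions at once: \<open>e = 1\<close> for F, where one path enters every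
  row, and \<open>e = 0\<close> for G.\<close>

definition start_edges :: "nat \<Rightarrow> nat \<Rightarrow> int list \<Rightarrow> edge multiset" where
  "start_edges e k \<mu> = vertical_edges \<mu> 0 + entering_edges (e * k)"

lemma path_collections_lattice_path:
  assumes P: "P \<in> path_collections (start_edges e k \<mu>) (vertical_edges lam k)"
    and "\<mu> \<in> Sign_plus L" "lam \<in> Sign_plus M" "p \<in># P"
  shows "lattice_path k p"
proof -
  have "up_right_path p" using P assms(4) by (simp add: path_collections_def)
  moreover have "hd (path_edges p) \<in># start_edges e k \<mu>" "last (path_edges p) \<in># vertical_edges lam k"
    using P assms(4) unfolding path_collections_def by (metis (mono_tags, lifting) CollectD image_eqI set_image_mset)+
  ultimately show ?thesis
    using Sign_plus_nonneg[OF assms(2)] Sign_plus_nonneg[OF assms(3)]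
    by (fastforce simp: lattice_path_def start_edges_def vertical_edges_def dest!: entering_edges_set)
qed

text \<open>Says that the subtraction in \<open>flow\<close> is never truncated: two consecutive
  levels are compatible with conservation, whatever the weights are.\<close>

definition row_ok :: "nat \<Rightarrow> (nat \<Rightarrow> nat) \<Rightarrow> (nat \<Rightarrow> nat) \<Rightarrow> bool" where
  "row_ok e m n \<longleftrightarrow> (\<forall>x. n x \<le> flow e m n x + m x)"

lemma row_ok_flow: "row_ok e m n \<Longrightarrow> \<forall>x<X. flow e m n (Suc x) + n x = flow e m n x + m x"
  by (simp add: row_ok_def)

text \<open>A configuration is encoded by the signatures \<open>K y\<close> of the vertical edges leaving row \<open>y\<close>;
  the numbers on horizontal edges are then determined by conservation.\<close>

definition vertex_data :: "nat \<Rightarrow> (nat \<Rightarrow> int list) \<Rightarrow> nat \<Rightarrow> nat \<Rightarrow> nat \<times> nat \<times> nat \<times> nat" where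
  "vertex_data e K y x = (let m = mults (K y); n = mults (K (Suc y)) in
     (m x, flow e m n x, n x, flow e m n (Suc x)))"

text \<open>The domain has to be the set of interior vertices, which are met by some path; hence
  vertices with four zeros are left out.\<close>

definition level_config ::
  "nat \<Rightarrow> nat \<Rightarrow> (nat \<Rightarrow> int list) \<Rightarrow> vertex \<rightharpoonup> nat \<times> nat \<times> nat \<times> nat" where
  "level_config e k K = (\<lambda>(x, y).
     if 0 \<le> x \<and> 1 \<le> y \<and> y \<le> int k \<and> vertex_data e K (nat y - 1) (nat x) \<noteq> (0, 0, 0, 0)
     then Some (vertex_data e K (nat y - 1) (nat x)) else None)"

text \<open>Values above level \<open>k\<close> are fixed to the empty list so that a sequence is
  determined by its configuration.\<close>

definition level_seqs :: "nat \<Rightarrow> nat \<Rightarrow> int list \<Rightarrow> int list \<Rightarrow> (nat \<Rightarrow> int list) set" where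
  "level_seqs e k \<mu> lam = {K. K 0 = \<mu> \<and> K k = lam \<and> (\<forall>y\<le>k. K y \<in> Sign_plus (length \<mu> + e * y)) \<and>
     (\<forall>y>k. K y = []) \<and> (\<forall>y<k. row_ok e (mults (K y)) (mults (K (Suc y))))}"

section \<open>From a collection of paths to a sequence of signatures\<close>

locale path_collection =
  fixes e k L :: nat and \<mu> lam :: "int list" and P :: "vertex list multiset"
  assumes P: "P \<in> path_collections (start_edges e k \<mu>) (vertical_edges lam k)"
    and mu: "\<mu> \<in> Sign_plus L" and lam: "lam \<in> Sign_plus (L + e * k)" and e: "e \<le> 1"
begin

lemma lattice: "p \<in># P \<Longrightarrow> lattice_path k p"
  using path_collections_lattice_path[OF P mu lam] .

definition vertical :: "nat \<Rightarrow> nat \<Rightarrow> nat" where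
  "vertical y x = edge_count P ((int x, int y), (int x, int y + 1))"

definition horizontal :: "nat \<Rightarrow> nat \<Rightarrow> nat" where
  "horizontal y x = edge_count P ((int x - 1, int y), (int x, int y))"

lemma conservation:
  assumes "y < k"
  shows "vertical y x + horizontal (Suc y) x = (\<Sum>p\<in>#P. of_bool ((int x, int (Suc y)) \<in> set p))"
    and "vertical (Suc y) x + horizontal (Suc y) (Suc x) =
      (\<Sum>p\<in>#P. of_bool ((int x, int (Suc y)) \<in> set p))"
  unfolding vertical_def horizontal_def edge_count_sum sum_mset.distrib[symmetric]
  using assms lattice_path_vertex[OF lattice, of _ "int x" "int (Suc y)"]
  by (auto intro!: arg_cong[where f = sum_mset] image_mset_cong simp: algebra_simps)

lemma edge_count_first:
  assumes "snd a = 0 \<or> fst a = -1"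
  shows "edge_count P (a, b) = count (start_edges e k \<mu>) (a, b)"
proof -
  have "edge_count P (a, b) = (\<Sum>p\<in>#P. of_bool (hd (path_edges p) = (a, b)))"
    unfolding edge_count_sum
    by (intro arg_cong[where f = sum_mset] image_mset_cong)
      (simp only: lattice_path_first_edge[OF lattice assms])
  also have "\<dots> = count (image_mset (\<lambda>p. hd (path_edges p)) P) (a, b)"
    by (rule count_image_mset_sum[symmetric])
  finally show ?thesis using P by (simp add: path_collections_def)
qed

lemma edge_count_last:
  assumes "snd b = int k + 1"
  shows "edge_count P (a, b) = count (vertical_edges lam k) (a, b)"
proof -
  have "edge_count P (a, b) = (\<Sum>p\<in>#P. of_bool (last (path_edges p) = (a, b)))"
    unfolding edge_count_sum
    by (intro arg_cong[where f = sum_mset] image_mset_cong)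
      (simp only: lattice_path_last_edge[OF lattice assms])
  also have "\<dots> = count (image_mset (\<lambda>p. last (path_edges p)) P) (a, b)"
    by (rule count_image_mset_sum[symmetric])
  finally show ?thesis using P by (simp add: path_collections_def)
qed

lemma vertical_0: "vertical 0 x = mults \<mu> x"
proof -
  have "((int x, 0), (int x, 1)) \<notin># entering_edges (e * k)"
    using entering_edges_set by fastforce
  then have "count (entering_edges (e * k)) ((int x, 0), (int x, 1)) = 0"
    by (simp add: count_eq_zero_iff)
  then show ?thesis
    using count_vertical_edges[of \<mu> 0 "int x" 0 "int x" 1]
    by (simp add: vertical_def edge_count_first start_edges_def mults_def)
qed

lemma vertical_k: "vertical k x = mults lam x"
  using count_vertical_edges[of lam k "int x" k "int x" "int k + 1"]
  by (simp add: vertical_def edge_count_last mults_def)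

lemma horizontal_0: "y < k \<Longrightarrow> horizontal (Suc y) 0 = e"
proof -
  assume y: "y < k"
  have "horizontal (Suc y) 0 = count (start_edges e k \<mu>) ((-1, int (Suc y)), (0, int (Suc y)))"
    unfolding horizontal_def by (subst edge_count_first) auto
  also have "\<dots> = count (entering_edges (e * k)) ((-1, int (Suc y)), (0, int (Suc y)))"
    using count_vertical_edges[of \<mu> 0 "-1" "Suc y" 0 "int (Suc y)"]
    by (simp add: start_edges_def)
  also have "\<dots> = e"
    unfolding count_entering_edges using y e by (cases e) auto
  finally show ?thesis .
qed

lemma flow_eq:
  assumes "y < k"
  shows "flow e (vertical y) (vertical (Suc y)) x = horizontal (Suc y) x"
proof (induction x)
  case 0
  then show ?case by (simp add: horizontal_0 assms)
next
  case (Suc x)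
  then show ?case using conservation[OF assms, of x] by simp
qed

lemma row_ok_vertical: "y < k \<Longrightarrow> row_ok e (vertical y) (vertical (Suc y))"
  unfolding row_ok_def using conservation[of y] flow_eq[of y] by (metis add.commute le_add1)

lemma ex_bound: "\<exists>X. \<forall>y. \<forall>x\<ge>X. vertical y x = 0 \<and> horizontal y x = 0"
proof -
  let ?S = "fst ` (\<Union>p\<in>set_mset P. set p)"
  have fin: "finite ?S" by simp
  define X where "X = nat (Max (insert 0 ?S)) + 1"
  have lt: "x < int X" if "(x, y) \<in> set p" "p \<in># P" for x y p
  proof -
    have "x \<in> ?S" using that by force
    then have "x \<le> Max (insert 0 ?S)" using fin by (intro Max_ge) auto
    then show ?thesis unfolding X_def by linarith
  qed
  have z: "edge_count P (a, (int x, b)) = 0" if "X \<le> x" for a x b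
  proof -
    have "(a, (int x, b)) \<notin> set (path_edges p)" if "p \<in># P" for p
      using path_edges_vertices[of a "(int x, b)" p] lt[OF _ that, of "int x" b] \<open>X \<le> x\<close> by auto
    then show ?thesis by (simp add: edge_count_def)
  qed
  then show ?thesis by (intro exI[of _ X]) (simp add: vertical_def horizontal_def)
qed

text \<open>The vertical edge numbers of a level have finite support, hence are the multiplicities
  of a signature. Its length grows by \<open>e\<close> per row because no horizontal path is left
  beyond \<open>X\<close>.\<close>

lemma ex_levels: "\<exists>K\<in>level_seqs e k \<mu> lam. \<forall>y\<le>k. mults (K y) = vertical y"
proof -
  obtain X where X: "\<And>y x. x \<ge> X \<Longrightarrow> vertical y x = 0" "\<And>y x. x \<ge> X \<Longrightarrow> horizontal y x = 0"
    using ex_bound by blast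
  have below: "\<exists>\<kappa>\<in>Sign_below (\<Sum>x<X. vertical y x) X. mults \<kappa> = vertical y" for y
    by (rule ex_Sign_below) (rule X)
  have "(\<Sum>x<X. vertical y x) = L + e * y" if "y \<le> k" for y
    using that
  proof (induction y)
    case 0
    obtain \<kappa> where k: "\<kappa> \<in> Sign_below (\<Sum>x<X. vertical 0 x) X" "mults \<kappa> = vertical 0" using below by blast
    then have "\<kappa> = \<mu>"
    proof -
      have "mults \<kappa> = mults \<mu>" using k vertical_0 by auto
      \<comment> \<open>The cut-offs for \<open>vertical 0\<close> and for \<open>\<mu>\<close> are
        unrelated, so both totals are compared at their maximum.\<close>
      moreover have "\<mu> \<in> Sign_below L (max X (Suc (nat (sum_list \<mu>))))"
        using Sign_plus_below[OF mu] by simp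
      then have "(\<Sum>x<max X (Suc (nat (sum_list \<mu>))). mults \<mu> x) = L" by (rule Sign_below_sums)
      moreover have "(\<Sum>x<max X (Suc (nat (sum_list \<mu>))). mults \<kappa> x) = (\<Sum>x<X. vertical 0 x)"
        unfolding k(2) by (rule sum.mono_neutral_right) (auto simp: X)
      ultimately have "(\<Sum>x<X. vertical 0 x) = L" by simp
      then show ?thesis
        using inj_onD[OF inj_on_mults \<open>mults \<kappa> = mults \<mu>\<close>] k(1) mu by (auto simp: Sign_below_def)
    qed
    then show ?case using k(1) mu by (auto simp: Sign_below_def dest!: Sign_plus_length)
  next
    case (Suc y)
    then have "y < k" by simp
    from flow_total[OF row_ok_flow[OF row_ok_vertical[OF this]], of X] Suc show ?case
      by (simp add: flow_eq X)
  qed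
  then have "\<forall>y. \<exists>\<kappa>. y \<le> k \<longrightarrow> \<kappa> \<in> Sign_plus (L + e * y) \<and> mults \<kappa> = vertical y"
    using below unfolding Sign_below_def by (metis (no_types, lifting) mem_Collect_eq)
  then obtain K where K: "\<And>y. y \<le> k \<Longrightarrow> K y \<in> Sign_plus (L + e * y)" "\<And>y. y \<le> k \<Longrightarrow> mults (K y) = vertical y"
    by metis
  define K' where "K' y = (if y \<le> k then K y else [])" for y
  have "K 0 = \<mu>"
    using inj_onD[OF inj_on_mults, of "K 0" \<mu> L] K[of 0] mu vertical_0 by auto
  moreover have "K k = lam"
    using inj_onD[OF inj_on_mults, of "K k" lam "L + e * k"] K[of k] lam vertical_k by auto
  moreover have "length \<mu> = L" using Sign_plus_length[OF mu] .
  ultimately have "K' \<in> level_seqs e k \<mu> lam"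
    using K row_ok_vertical by (auto simp: level_seqs_def K'_def)
  then show ?thesis using K(2) by (intro bexI[of _ K']) (auto simp: K'_def)
qed

text \<open>All interior vertices lie in the strip. Inside it, conservation shows that a vertex is
  met by a path if and only if its four numbers are not all zero, which is the condition in
  \<open>level_config\<close>.\<close>

lemma configuration_eq:
  assumes K: "\<And>y. y \<le> k \<Longrightarrow> mults (K y) = vertical y"
  shows "configuration P = level_config e k K"
proof
  fix z :: vertex
  obtain x y where z: "z = (x, y)" by (cases z)
  show "configuration P z = level_config e k K z"
  proof (cases "0 \<le> x \<and> 1 \<le> y \<and> y \<le> int k")
    case False
    have "z \<notin> set p - {hd p, last p}" if p: "p \<in># P" for p
    proof
      note u = lattice_path_up_right[OF lattice[OF p]]
      assume *: "z \<in> set p - {hd p, last p}"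
      then obtain i where i: "i < length p" "z = p ! i" by (auto simp: in_set_conv_nth)
      moreover have "p \<noteq> []" using i by auto
      ultimately have "i \<noteq> 0" "i \<noteq> length p - 1" using * by (metis Diff_iff hd_conv_nth insertCI,
        metis Diff_iff insertCI last_conv_nth)
      then show False
        using lattice_path_interior[OF lattice[OF p] i(1)] i(1) False
        unfolding i(2)[symmetric] z by auto
    qed
    then have "z \<notin> interior_vertices P" by (auto simp: interior_vertices_def)
    then show ?thesis using False by (auto simp: z configuration_def level_config_def)
  next
    case True
    define x' y' where "x' = nat x" and "y' = nat y - 1"
    have xy: "x = int x'" "y = int (Suc y')" "y' < k" using True by (auto simp: x'_def y'_def)
    define S :: nat where "S = (\<Sum>p\<in>#P. of_bool ((int x', int (Suc y')) \<in> set p))"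
    have data: "vertex_data e K y' x' = vertex_numbers P z"
      using xy K[of y'] K[of "Suc y'"] flow_eq[OF xy(3), of x'] flow_eq[OF xy(3), of "Suc x'"]
      by (simp add: vertex_data_def Let_def vertex_numbers_def z vertical_def horizontal_def
          add.commute del: flow.simps)
    have "z \<in> interior_vertices P \<longleftrightarrow> (\<exists>p\<in>#P. z \<in> set p)"
    proof
      assume "\<exists>p\<in>#P. z \<in> set p"
      then obtain p i where p: "p \<in># P" and i: "i < length p" "p ! i = z" by (auto simp: in_set_conv_nth)
      note u = lattice_path_up_right[OF lattice[OF p]]
      have "0 < i" "Suc i < length p" using lattice_path_interior[OF lattice[OF p] i(1)] i z True by auto
      then have "z \<noteq> p ! 0" "z \<noteq> p ! (length p - 1)"
        using up_right_inj[OF u i(1), of 0] up_right_inj[OF u i(1), of "length p - 1"] i(2)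
        by (force, force)
      moreover have "p \<noteq> []" "z \<in> set p" using i by auto
      ultimately show "z \<in> interior_vertices P"
        using p by (auto simp: interior_vertices_def hd_conv_nth last_conv_nth)
    qed (auto simp: interior_vertices_def)
    also have "\<dots> \<longleftrightarrow> S \<noteq> 0" by (auto simp: z xy S_def)
    also have "\<dots> \<longleftrightarrow> vertex_data e K y' x' \<noteq> (0, 0, 0, 0)"
      using conservation[OF xy(3), of x', folded S_def] K[of y'] K[of "Suc y'"] xy(3)
        flow_eq[OF xy(3), of x'] flow_eq[OF xy(3), of "Suc x'"]
      by (auto simp: vertex_data_def Let_def simp del: flow.simps)
    finally have "z \<in> interior_vertices P \<longleftrightarrow> vertex_data e K y' x' \<noteq> (0, 0, 0, 0)" .
    moreover have "level_config e k K z = (if vertex_data e K y' x' \<noteq> (0, 0, 0, 0)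
        then Some (vertex_data e K y' x') else None)"
      unfolding level_config_def z x'_def y'_def using True by simp
    ultimately show ?thesis using data by (simp add: configuration_def)
  qed
qed

end

section \<open>From a sequence of signatures to a collection of paths\<close>

definition segment :: "int \<Rightarrow> int \<Rightarrow> int \<Rightarrow> vertex list" where
  "segment a b y = map (\<lambda>t. (t, y)) [a..b] @ [(b, y + 1)]"

lemma segment_simps:
  "segment a a y = [(a, y), (a, y + 1)]"
  "a < b \<Longrightarrow> segment a b y = (a, y) # segment (a + 1) b y"
  by (simp_all add: segment_def upto_rec1)

lemma segment_props:
  assumes "a \<le> b"
  shows "up_right_path (segment a b y) \<and> hd (segment a b y) = (a, y) \<and>
    last (path_edges (segment a b y)) = ((b, y), (b, y + 1)) \<and>
    (\<forall>x z. ((x, z), (x, z + 1)) \<in> set (path_edges (segment a b y)) \<longleftrightarrow> x = b \<and> z = y)"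
  using assms
proof (induction "nat (b - a)" arbitrary: a)
  case 0
  then have "a = b" by simp
  then show ?case by (auto simp: segment_simps up_right_path_def path_edges_def)
next
  case (Suc n)
  then have ab: "a < b" by linarith
  then have IH: "up_right_path (segment (a + 1) b y)" "hd (segment (a + 1) b y) = (a + 1, y)"
    "last (path_edges (segment (a + 1) b y)) = ((b, y), (b, y + 1))"
    "\<And>x z. ((x, z), (x, z + 1)) \<in> set (path_edges (segment (a + 1) b y)) \<longleftrightarrow> x = b \<and> z = y"
    using Suc.hyps(1)[of "a + 1"] Suc.hyps(2) by auto
  obtain r where r: "segment (a + 1) b y = (a + 1, y) # r"
    using IH(1,2) by (cases "segment (a + 1) b y") (auto simp: up_right_path_def)
  have s: "segment a b y = (a, y) # (a + 1, y) # r" using segment_simps(2)[OF ab] r by simp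
  have "path_edges ((a + 1, y) # r) \<noteq> []"
    using up_right_length[OF IH(1)] length_path_edges[of "segment (a + 1) b y"] r by auto
  then show ?case
    using IH unfolding r s path_edges_Cons
    by (auto simp: up_right_path_def path_edges_Cons)
qed

text \<open>The endpoint of \<open>p\<close> is also the first vertex of the segment, hence
  \<open>butlast\<close>.\<close>

definition extend_path :: "vertex list \<Rightarrow> int \<Rightarrow> int \<Rightarrow> vertex list" where
  "extend_path p b y = butlast p @ segment (fst (last p)) b y"

lemma extend_path_edges:
  assumes "p \<noteq> []" "last p = (a, y)" "a \<le> b"
  shows "path_edges (extend_path p b y) = path_edges p @ path_edges (segment a b y)"
proof -
  obtain r where r: "segment a b y = (a, y) # r"
    using segment_props[OF assms(3), of y]
    by (cases "segment a b y") (auto simp: up_right_path_def)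
  have "extend_path p b y = butlast p @ [(a, y)] @ r" using assms(2) r by (simp add: extend_path_def)
  then have "path_edges (extend_path p b y) = path_edges (butlast p @ [(a, y)]) @ path_edges ((a, y) # r)"
    by (simp only: path_edges_append)
  then show ?thesis using assms(1,2) r by (metis append_butlast_last_id)
qed

text \<open>If \<open>\<nu> ! i < \<kappa> ! i\<close>, the columns up to \<open>\<nu> ! i\<close>
  contain at least L + e - i entries of \<open>\<nu>\<close>, but only L - i - 1 entries of
  \<open>\<kappa>\<close> and \<open>e\<close> entering paths can supply them, one too few.\<close>

lemma row_ok_nth_le:
  assumes "row_ok e (mults \<kappa>) (mults \<nu>)" "\<kappa> \<in> Sign_plus L" "\<nu> \<in> Sign_plus (L + e)"
  shows "i < L \<Longrightarrow> \<kappa> ! i \<le> \<nu> ! i"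
proof (rule ccontr)
  assume i: "i < L" and "\<not> \<kappa> ! i \<le> \<nu> ! i"
  then have lt: "\<nu> ! i < \<kappa> ! i" by simp
  have len: "length \<kappa> = L" "length \<nu> = L + e" using assms Sign_plus_length by auto
  have sorted: "\<kappa> ! b \<le> \<kappa> ! a" if "a \<le> b" "b < L" for a b
    using assms(2) that sorted_wrt_iff_nth_less[of "(\<ge>)" \<kappa>] len
    by (cases "a = b") (auto simp: Sign_plus_def Sign_def)
  have sorted': "\<nu> ! b \<le> \<nu> ! a" if "a \<le> b" "b < L + e" for a b
    using assms(3) that sorted_wrt_iff_nth_less[of "(\<ge>)" \<nu>] len
    by (cases "a = b") (auto simp: Sign_plus_def Sign_def)
  define X where "X = Suc (nat (\<nu> ! i))"
  have "0 \<le> \<nu> ! i" using Sign_plus_nonneg[OF assms(3)] i len by simp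
  then have X: "a < int X \<longleftrightarrow> a \<le> \<nu> ! i" for a by (auto simp: X_def)
  have below: "(\<Sum>x<X. mults \<xi> x) = card {j. j < length \<xi> \<and> \<xi> ! j \<le> \<nu> ! i}" if "\<xi> \<in> Sign_plus M" for \<xi> M
  proof -
    have "filter (\<lambda>a. a < int X) \<xi> \<in> Sign_below (length (filter (\<lambda>a. a < int X) \<xi>)) X"
      using that by (auto simp: Sign_below_def Sign_plus_def Sign_def sorted_wrt_filter)
    from Sign_below_sums(1)[OF this]
    have "(\<Sum>x<X. mults (filter (\<lambda>a. a < int X) \<xi>) x) = length (filter (\<lambda>a. a < int X) \<xi>)" .
    also have "(\<Sum>x<X. mults (filter (\<lambda>a. a < int X) \<xi>) x) = (\<Sum>x<X. mults \<xi> x)"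
      by (intro sum.cong) (auto simp: mults_def)
    finally show ?thesis by (simp add: length_filter_conv_card X)
  qed
  have "card {j. j < length \<nu> \<and> \<nu> ! j \<le> \<nu> ! i} \<ge> card {i..<L + e}"
    using sorted' len by (intro card_mono) auto
  moreover have "card {j. j < length \<kappa> \<and> \<kappa> ! j \<le> \<nu> ! i} \<le> card {Suc i..<L}"
  proof (intro card_mono subsetI)
    fix j assume "j \<in> {j. j < length \<kappa> \<and> \<kappa> ! j \<le> \<nu> ! i}"
    then have "j < L" "\<kappa> ! j < \<kappa> ! i" using lt len by auto
    then show "j \<in> {Suc i..<L}" using sorted[of j i] i by (cases "j \<le> i") auto
  qed auto
  moreover have "(\<Sum>x<X. mults \<nu> x) \<le> e + (\<Sum>x<X. mults \<kappa> x)"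
    using flow_total[OF row_ok_flow[OF assms(1)], of X] by linarith
  ultimately show False unfolding below[OF assms(2)] below[OF assms(3)] using i by simp
qed

lemma edge_count_mset:
  "edge_count (mset ps) f = card {i. i < length ps \<and> f \<in> set (path_edges (ps ! i))}"
proof -
  have "edge_count (mset ps) f = length (filter (\<lambda>p. f \<in> set (path_edges p)) ps)"
    by (simp add: edge_count_def flip: mset_filter)
  then show ?thesis by (simp add: length_filter_conv_card)
qed

lemma count_mset_nth: "count (mset xs) x = card {i. i < length xs \<and> xs ! i = x}"
  by (simp add: count_mset count_list_eq_length_filter length_filter_conv_card eq_commute)

lemma start_edges_Suc:
  assumes "e \<le> 1"
  shows "start_edges e (Suc k) \<mu> = start_edges e k \<mu> +
    (if e = 1 then {#((-1, int (Suc k)), (0, int (Suc k)))#} else {#})"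
  using assms by (cases e) (auto simp: start_edges_def entering_edges_def atLeastAtMostSuc_conv)

lemma vertical_edge_level:
  assumes "up_right_path p" "snd (last p) = y"
  shows "((x, y), (x, y + 1)) \<notin> set (path_edges p)"
proof
  assume "((x, y), (x, y + 1)) \<in> set (path_edges p)"
  then obtain i where i: "Suc i < length p" "p ! Suc i = (x, y + 1)" by (auto simp: path_edges_iff)
  then have "p \<noteq> []" "Suc i \<le> length p - 1" by auto
  then show False
    using i up_right_mono'(2)[OF assms(1), of "Suc i" "length p - 1"] assms(2) last_conv_nth[of p]
    by auto
qed

lemma last_up_right_path:
  assumes "up_right_path p" "last (path_edges p) = (a, b)"
  shows "last p = b"
proof -
  have "p \<noteq> []" using up_right_length[OF assms(1)] by auto
  then show ?thesis using last_path_edges[OF assms(1)] assms(2) last_conv_nth[of p] by simp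
qed

text \<open>Paths are built level by level: the path with index \<open>i\<close> is extended to the
  \<open>i\<close>-th entry of the next level, which \<open>row_ok_nth_le\<close> allows, and for
  \<open>e = 1\<close> a new path enters at the left. Lists keep track of this matching. Vertical
  counts suffice, since they determine the horizontal ones.\<close>

lemma ex_path_list:
  assumes e: "e \<le> 1"
    and K: "\<And>y. y \<le> k \<Longrightarrow> K y \<in> Sign_plus (L + e * y)"
    and ok: "\<And>y. y < k \<Longrightarrow> row_ok e (mults (K y)) (mults (K (Suc y)))"
  shows "\<exists>ps. length ps = length (K k) \<and>
    (\<forall>i<length ps. up_right_path (ps ! i) \<and>
      last (path_edges (ps ! i)) = ((K k ! i, int k), (K k ! i, int k + 1))) \<and>
    mset (map (\<lambda>p. hd (path_edges p)) ps) = start_edges e k (K 0) \<and>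
    (\<forall>y\<le>k. \<forall>x. edge_count (mset ps) ((x, int y), (x, int y + 1)) = count (mset (K y)) x)"
  using K ok
proof (induction k)
  case 0
  define ps where "ps = map (\<lambda>x. [(x, 0::int), (x, 1)]) (K 0)"
  have "edge_count (mset ps) ((x, 0), (x, 1)) = count (mset (K 0)) x" for x
    unfolding edge_count_mset count_mset_nth
    by (rule arg_cong[where f = card]) (auto simp: ps_def path_edges_def)
  moreover have "mset (map (\<lambda>p. hd (path_edges p)) ps) = start_edges e 0 (K 0)"
    by (simp add: ps_def path_edges_def start_edges_def vertical_edges_def entering_edges_def comp_def)
  ultimately show ?case
    by (intro exI[of _ ps]) (auto simp: ps_def path_edges_def up_right_path_def)
next
  case (Suc k)
  then obtain ps where len: "length ps = length (K k)"
    and ps: "\<And>i. i < length ps \<Longrightarrow> up_right_path (ps ! i)"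
      "\<And>i. i < length ps \<Longrightarrow> last (path_edges (ps ! i)) = ((K k ! i, int k), (K k ! i, int k + 1))"
    and start: "mset (map (\<lambda>p. hd (path_edges p)) ps) = start_edges e k (K 0)"
    and count: "\<And>y x. y \<le> k \<Longrightarrow> edge_count (mset ps) ((x, int y), (x, int y + 1)) = count (mset (K y)) x"
    by (metis (no_types, lifting) le_SucI less_SucI)
  let ?y = "int (Suc k)"
  have Kk: "K k \<in> Sign_plus (L + e * k)" "K (Suc k) \<in> Sign_plus (L + e * k + e)"
    using Suc.prems(1)[of k] Suc.prems(1)[of "Suc k"] by (auto simp: algebra_simps)
  have lenK: "length ps = L + e * k" "length (K (Suc k)) = length ps + e"
    using Sign_plus_length[OF Kk(1)] Sign_plus_length[OF Kk(2)] len by auto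
  have le: "K k ! i \<le> K (Suc k) ! i" if "i < length ps" for i
    using row_ok_nth_le[OF Suc.prems(2)[of k] Kk] that lenK by simp
  have nonneg: "0 \<le> K (Suc k) ! i" if "i < length (K (Suc k))" for i
    using Sign_plus_nonneg[OF Kk(2)] that by simp
  have lastp: "last (ps ! i) = (K k ! i, ?y)" if "i < length ps" for i
    using last_up_right_path[OF ps(1)[OF that] ps(2)[OF that]] by simp
  have ne: "ps ! i \<noteq> []" "path_edges (ps ! i) \<noteq> []" if "i < length ps" for i
    using up_right_length[OF ps(1)[OF that]] length_path_edges[of "ps ! i"] by auto
  define f where "f i = (if i < length ps then extend_path (ps ! i) (K (Suc k) ! i) ?y
    else segment (-1) (K (Suc k) ! i) ?y)" for i
  define qs where "qs = map f [0..<length (K (Suc k))]"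
  have seg: "segment (K k ! i) (K (Suc k) ! i) ?y \<noteq> []"
    "path_edges (segment (K k ! i) (K (Suc k) ! i) ?y) \<noteq> []" if "i < length ps" for i
    using up_right_length[OF segment_props[OF le[OF that], of ?y, THEN conjunct1]]
      length_path_edges[of "segment (K k ! i) (K (Suc k) ! i) ?y"] by auto
  have f_edges: "path_edges (f i) = path_edges (ps ! i) @ path_edges (segment (K k ! i) (K (Suc k) ! i) ?y)"
    if "i < length ps" for i
    using extend_path_edges[OF ne(1)[OF that] lastp[OF that] le[OF that]] that by (simp add: f_def)
  have f_up: "up_right_path (f i) \<and>
      last (path_edges (f i)) = ((K (Suc k) ! i, ?y), (K (Suc k) ! i, ?y + 1))"
    if "i < length (K (Suc k))" for i
  proof (cases "i < length ps")
    case True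
    have "length (path_edges (f i)) \<ge> 1"
      unfolding f_edges[OF True] using ne(2)[OF True] by (cases "path_edges (ps ! i)") auto
    then have "length (f i) \<ge> 2" using length_path_edges[of "f i"] by simp
    moreover have "last (path_edges (f i)) = ((K (Suc k) ! i, ?y), (K (Suc k) ! i, ?y + 1))"
      using f_edges[OF True] seg[OF True] segment_props[OF le[OF True], of ?y] by simp
    moreover have "\<forall>((x, y), b)\<in>set (path_edges (f i)). b = (x + 1, y) \<or> b = (x, y + 1)"
      unfolding f_edges[OF True] set_append
      using ps(1)[OF True] segment_props[OF le[OF True], of ?y]
      unfolding up_right_path_def by blast
    ultimately show ?thesis by (simp add: up_right_path_def)
  next
    case False
    then show ?thesis
      using segment_props[of "-1" "K (Suc k) ! i" ?y] nonneg[OF that] by (simp add: f_def)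
  qed
  have f_old: "((x, int y), (x, int y + 1)) \<in> set (path_edges (f i)) \<longleftrightarrow>
      i < length ps \<and> ((x, int y), (x, int y + 1)) \<in> set (path_edges (ps ! i))"
    if "y \<le> k" "i < length (K (Suc k))" for x y i
  proof (cases "i < length ps")
    case True
    then show ?thesis using f_edges[OF True] segment_props[OF le[OF True], of ?y] that by simp
  next
    case False
    then show ?thesis
      using segment_props[of "-1" "K (Suc k) ! i" ?y] nonneg[OF that(2)] that by (simp add: f_def)
  qed
  have f_new: "((x, ?y), (x, ?y + 1)) \<in> set (path_edges (f i)) \<longleftrightarrow> x = K (Suc k) ! i"
    if "i < length (K (Suc k))" for x i
  proof (cases "i < length ps")
    case True
    have "((x, ?y), (x, ?y + 1)) \<notin> set (path_edges (ps ! i))"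
      using vertical_edge_level[OF ps(1)[OF True], of ?y x] lastp[OF True] by simp
    moreover have "((x, ?y), (x, ?y + 1)) \<in> set (path_edges (segment (K k ! i) (K (Suc k) ! i) ?y)) \<longleftrightarrow>
        x = K (Suc k) ! i"
      using segment_props[OF le[OF True], of ?y] by blast
    ultimately show ?thesis unfolding f_edges[OF True] set_append by blast
  next
    case False
    have "((x, ?y), (x, ?y + 1)) \<in> set (path_edges (segment (-1) (K (Suc k) ! i) ?y)) \<longleftrightarrow>
        x = K (Suc k) ! i"
      using segment_props[of "-1" "K (Suc k) ! i" ?y] nonneg[OF that] by fastforce
    then show ?thesis using False by (simp only: f_def if_False)
  qed
  have old: "edge_count (mset qs) ((x, int y), (x, int y + 1)) = count (mset (K y)) x" if "y \<le> k" for x y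
  proof -
    have "edge_count (mset qs) ((x, int y), (x, int y + 1)) =
        edge_count (mset ps) ((x, int y), (x, int y + 1))"
      unfolding edge_count_mset
      using f_old[OF that] lenK by (intro arg_cong[where f = card]) (auto simp: qs_def)
    then show ?thesis using count[OF that] by simp
  qed
  have new: "edge_count (mset qs) ((x, ?y), (x, ?y + 1)) = count (mset (K (Suc k))) x" for x
    unfolding edge_count_mset count_mset_nth
    using f_new by (intro arg_cong[where f = card]) (auto simp: qs_def)
  have "mset (map (\<lambda>p. hd (path_edges p)) qs) = start_edges e (Suc k) (K 0)"
  proof -
    have *: "map (\<lambda>i. hd (path_edges (f i))) [0..<length ps] = map (\<lambda>p. hd (path_edges p)) ps"
      using f_edges ne(2) by (intro nth_equalityI) auto
    show ?thesis
    proof (cases "e = 0")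
      case True
      then show ?thesis
        using start start_edges_Suc[OF e, of k "K 0"] lenK * by (simp add: qs_def comp_def)
    next
      case False
      then have e1: "e = 1" using e by simp
      then have l: "length ps < length (K (Suc k))" using lenK by simp
      let ?b = "K (Suc k) ! length ps"
      have s: "f (length ps) = (-1, ?y) # segment 0 ?b ?y"
        using segment_simps(2)[of "-1" ?b ?y] nonneg[OF l] by (simp add: f_def)
      have "hd (segment 0 ?b ?y) = (0, ?y)" "segment 0 ?b ?y \<noteq> []"
        using segment_props[of 0 ?b ?y] nonneg[OF l] by (auto simp: up_right_path_def)
      then have "hd (path_edges (f (length ps))) = ((-1, ?y), (0, ?y))"
        unfolding s by (cases "segment 0 ?b ?y") (auto simp: path_edges_Cons)
      then show ?thesis
        using start start_edges_Suc[OF e, of k "K 0"] lenK * e1 by (simp add: qs_def comp_def)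
    qed
  qed
  then show ?case
    using f_up old new by (intro exI[of _ qs]) (auto simp: qs_def le_Suc_eq)
qed

lemma configurations_eq:
  assumes e: "e \<le> 1" and mu: "\<mu> \<in> Sign_plus L" and lam: "lam \<in> Sign_plus (L + e * k)"
  shows "configuration ` path_collections (start_edges e k \<mu>) (vertical_edges lam k) =
    level_config e k ` level_seqs e k \<mu> lam"
proof (intro subset_antisym subsetI)
  fix C assume "C \<in> configuration ` path_collections (start_edges e k \<mu>) (vertical_edges lam k)"
  then obtain P where PC: "P \<in> path_collections (start_edges e k \<mu>) (vertical_edges lam k)"
    "C = configuration P" by auto
  interpret path_collection e k L \<mu> lam P by unfold_locales (fact PC(1) mu lam e)+
  show "C \<in> level_config e k ` level_seqs e k \<mu> lam"
    using ex_levels configuration_eq PC(2) by blast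
next
  fix C assume "C \<in> level_config e k ` level_seqs e k \<mu> lam"
  then obtain K where K: "K \<in> level_seqs e k \<mu> lam" "C = level_config e k K" by auto
  have L: "length \<mu> = L" using Sign_plus_length[OF mu] .
  obtain ps where ps: "length ps = length (K k)"
      "\<forall>i<length ps. up_right_path (ps ! i) \<and>
        last (path_edges (ps ! i)) = ((K k ! i, int k), (K k ! i, int k + 1))"
      "mset (map (\<lambda>p. hd (path_edges p)) ps) = start_edges e k (K 0)"
      "\<forall>y\<le>k. \<forall>x. edge_count (mset ps) ((x, int y), (x, int y + 1)) = count (mset (K y)) x"
    using ex_path_list[OF e, of k K L] K(1) L unfolding level_seqs_def by blast
  have "map (\<lambda>p. last (path_edges p)) ps = map (\<lambda>x. ((x, int k), (x, int k + 1))) (K k)"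
    using ps(1,2) by (intro nth_equalityI) auto
  then have "image_mset (\<lambda>p. last (path_edges p)) (mset ps) = vertical_edges (K k) k"
    by (simp only: vertical_edges_def flip: mset_map)
  moreover have "\<forall>p\<in>#mset ps. up_right_path p" using ps(2) by (auto simp: in_set_conv_nth)
  ultimately have P: "mset ps \<in> path_collections (start_edges e k \<mu>) (vertical_edges lam k)"
    using ps(3) K(1) by (simp add: path_collections_def level_seqs_def)
  \<comment> \<open>The analysis of an arbitrary collection now applies to the one just built, and
    its vertical counts identify its configuration.\<close>
  interpret path_collection e k L \<mu> lam "mset ps" by unfold_locales (fact P mu lam e)+
  have "configuration (mset ps) = level_config e k K"
    using ps(4) by (intro configuration_eq) (auto simp: vertical_def mults_def)
  then show "C \<in> configuration ` path_collections (start_edges e k \<mu>) (vertical_edges lam k)"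
    using P K(2) by force
qed

lemma inj_on_level_config: "inj_on (level_config e k) (level_seqs e k \<mu> lam)"
proof
  fix K K' assume K: "K \<in> level_seqs e k \<mu> lam" and K': "K' \<in> level_seqs e k \<mu> lam"
    and eq: "level_config e k K = level_config e k K'"
  \<comment> \<open>A vertex of the strip missing from the configuration has four zeros, so reading
    0 there recovers every multiplicity.\<close>
  have level: "(case level_config e k K (int x, int (Suc y)) of None \<Rightarrow> 0 | Some (_, _, n, _) \<Rightarrow> n) = mults (K (Suc y)) x"
    if "y < k" for x y and K :: "nat \<Rightarrow> int list"
    using that by (auto simp: level_config_def vertex_data_def Let_def simp del: flow.simps of_nat_Suc)
  show "K = K'"
  proof
    fix y
    consider "y = 0" | "y > k" | y' where "y = Suc y'" "y' < k"
      by (metis not_less not0_implies_Suc Suc_le_eq)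
    then show "K y = K' y"
    proof cases
      case 3
      have "mults (K y) = mults (K' y)"
        using level[OF 3(2), of K] level[OF 3(2), of K'] eq 3(1) by auto
      moreover have "y \<le> k" using 3 by simp
      then have "K y \<in> Sign_plus (length \<mu> + e * y)" "K' y \<in> Sign_plus (length \<mu> + e * y)"
        using K K' by (simp_all add: level_seqs_def)
      ultimately show ?thesis using inj_onD[OF inj_on_mults] by blast
    qed (use K K' in \<open>auto simp: level_seqs_def\<close>)
  qed
qed

section \<open>Weights of configurations and the recursion in the number of rows\<close>

lemma row_ok_flow_0:
  assumes "row_ok e (mults \<kappa>) (mults \<nu>)" "\<kappa> \<in> Sign_below L X" "\<nu> \<in> Sign_below (L + e) X"
  shows "flow e (mults \<kappa>) (mults \<nu>) X = 0"
  using flow_total[OF row_ok_flow[OF assms(1)], of X] Sign_below_sums(1)[OF assms(2)]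
    Sign_below_sums(1)[OF assms(3)] by simp

lemma row_ok_sum_le:
  assumes "row_ok e (mults \<kappa>) (mults \<nu>)" "\<kappa> \<in> Sign_plus L" "\<nu> \<in> Sign_plus (L + e)"
  shows "sum_list \<kappa> \<le> sum_list \<nu>"
proof -
  let ?X = "Suc (nat (sum_list \<kappa> + sum_list \<nu>))"
  note b = Sign_plus_below_cutoff[OF assms(2,3)]
  have "(\<Sum>x<?X. x * mults \<kappa> x) \<le> (\<Sum>x<?X. x * mults \<nu> x)"
    using flow_displacement[OF row_ok_flow[OF assms(1)], of ?X] row_ok_flow_0[OF assms(1) b]
    by (simp only: mult_0_right add_0_right)
  then show ?thesis
    unfolding Sign_below_sums(2)[OF b(1)] Sign_below_sums(2)[OF b(2)]
    using Sign_plus_sum_nonneg[OF assms(2)] Sign_plus_sum_nonneg[OF assms(3)] by linarith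
qed

lemma row_weight_not_ok:
  assumes "path_weights w" "\<kappa> \<in> Sign_plus L" "\<nu> \<in> Sign_plus (L + e)"
    and "\<not> row_ok e (mults \<kappa>) (mults \<nu>)"
  shows "row_weight w e \<kappa> \<nu> = 0"
proof (rule ccontr)
  let ?X = "Suc (nat (sum_list \<kappa> + sum_list \<nu>))"
  assume "row_weight w e \<kappa> \<nu> \<noteq> 0"
  then have "row_prod w e (mults \<kappa>) (mults \<nu>) ?X \<noteq> 0" by (simp add: row_weight_def)
  note f = row_prod_flow[OF assms(1) this]
  have "mults \<nu> x \<le> flow e (mults \<kappa>) (mults \<nu>) x + mults \<kappa> x" for x
  proof (cases "x < ?X")
    case True
    then show ?thesis using f by (metis le_add2)
  next
    case False
    then have "mults \<nu> x = 0"
      using Sign_plus_below_cutoff(2)[OF assms(2,3)] by (intro mults_tail[of \<nu> ?X]) (auto simp: Sign_below_def)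
    then show ?thesis by simp
  qed
  then show False using assms(4) by (simp add: row_ok_def)
qed

text \<open>A vertex left out of the configuration has four zeros and weight 1, so the product over
  interior vertices extends to a full rectangle of \<open>X\<close> columns and \<open>k\<close>
  rows, which factors into rows.\<close>

lemma configuration_weight_level_config:
  assumes u: "\<forall>y<k. 1 - s * u (Suc y) \<noteq> 0"
    and K: "K \<in> level_seqs e k \<mu> lam"
  shows "configuration_weight q s u (level_config e k K) =
    (\<Prod>y<k. row_weight (vertex_weight q s (u (Suc y))) e (K y) (K (Suc y)))"
proof -
  define X where "X = Suc (Max (insert 0 ((\<lambda>y. nat (sum_list (K y))) ` {..k})))"
  define g where "g = (\<lambda>(x, y). (int x, int (Suc y)))"
  define h where "h = (\<lambda>z. case the (level_config e k K z) of (i1, j1, i2, j2) \<Rightarrow>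
    vertex_weight q s (u (nat (snd z))) i1 j1 i2 j2)"
  have sign: "K y \<in> Sign_plus (length \<mu> + e * y)" if "y \<le> k" for y
    using K that by (simp add: level_seqs_def)
  have below: "K y \<in> Sign_below (length \<mu> + e * y) X" if "y \<le> k" for y
  proof (rule Sign_plus_below[OF sign[OF that]])
    have "nat (sum_list (K y)) \<le> Max (insert 0 ((\<lambda>y. nat (sum_list (K y))) ` {..k}))"
      using that by (intro Max_ge) auto
    then show "sum_list (K y) < int X" unfolding X_def by linarith
  qed
  have ok: "row_ok e (mults (K y)) (mults (K (Suc y)))" if "y < k" for y
    using K that by (simp add: level_seqs_def)
  have tail: "vertex_data e K y x = (0, 0, 0, 0)" if y: "y < k" and x: "x \<ge> X" for x y
  proof -
    have z: "mults (K y) x = 0" "mults (K (Suc y)) x = 0" if "x \<ge> X" for x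
      using below[of y] below[of "Suc y"] y that by (auto simp: Sign_below_def intro!: mults_tail)
    have "flow e (mults (K y)) (mults (K (Suc y))) (X + i) = 0" for i
    proof (induction i)
      case 0
      have "K (Suc y) \<in> Sign_below (length \<mu> + e * y + e) X"
        using below[of "Suc y"] y by (simp add: algebra_simps)
      then show ?case using row_ok_flow_0[OF ok[OF y] below] y by simp
    qed (simp add: z)
    from this[of "x - X"] this[of "Suc x - X"] show ?thesis
      using x z by (simp add: vertex_data_def Let_def Suc_diff_le)
  qed
  have config: "level_config e k K (g (x, y)) =
      (if vertex_data e K y x \<noteq> (0, 0, 0, 0) then Some (vertex_data e K y x) else None)"
    if "y < k" for x y
    using that by (simp add: level_config_def g_def del: of_nat_Suc)
  let ?D = "{..<X} \<times> {..<k}"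
  have inj: "inj_on g ?D" by (auto simp: g_def inj_on_def)
  have dom: "dom (level_config e k K) = g ` {z \<in> ?D. vertex_data e K (snd z) (fst z) \<noteq> (0, 0, 0, 0)}"
    (is "_ = g ` ?D'")
  proof (intro subset_antisym subsetI)
    fix z assume z: "z \<in> dom (level_config e k K)"
    obtain x y where xy: "z = (x, y)" by (cases z)
    have *: "0 \<le> x" "1 \<le> y" "y \<le> int k" "vertex_data e K (nat y - 1) (nat x) \<noteq> (0, 0, 0, 0)"
      using z by (auto simp: level_config_def xy split: if_splits)
    then have "nat y - 1 < k" by auto
    then have "nat x < X" using tail *(4) by (meson not_less)
    then have "(nat x, nat y - 1) \<in> ?D'" using * by auto
    moreover have "z = g (nat x, nat y - 1)" using * by (simp add: g_def xy)
    ultimately show "z \<in> g ` ?D'" by blast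
  next
    fix z assume "z \<in> g ` ?D'"
    then obtain x y where "z = g (x, y)" "y < k" "vertex_data e K y x \<noteq> (0, 0, 0, 0)" by auto
    then show "z \<in> dom (level_config e k K)" using config[of y x] by (simp add: domI)
  qed
  have "configuration_weight q s u (level_config e k K) = (\<Prod>z\<in>dom (level_config e k K). h z)"
    unfolding configuration_weight_def h_def by (intro prod.cong refl) auto
  also have "\<dots> = (\<Prod>z\<in>?D'. h (g z))"
    unfolding dom by (subst prod.reindex) (auto intro: inj_on_subset[OF inj])
  also have "\<dots> = (\<Prod>z\<in>?D'. case vertex_data e K (snd z) (fst z) of (i1, j1, i2, j2) \<Rightarrow>
      vertex_weight q s (u (Suc (snd z))) i1 j1 i2 j2)"
  proof (rule prod.cong[OF refl])
    fix z assume z: "z \<in> ?D'"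
    obtain x y where xy: "z = (x, y)" by (cases z)
    then have "the (level_config e k K (g z)) = vertex_data e K y x" "snd (g z) = int (Suc y)"
      using z config[of y x] by (auto simp: g_def)
    then show "h (g z) = (case vertex_data e K (snd z) (fst z) of (i1, j1, i2, j2) \<Rightarrow>
      vertex_weight q s (u (Suc (snd z))) i1 j1 i2 j2)"
      unfolding h_def by (simp only: xy nat_int fst_conv snd_conv)
  qed
  also have "\<dots> = (\<Prod>z\<in>?D. case vertex_data e K (snd z) (fst z) of (i1, j1, i2, j2) \<Rightarrow>
      vertex_weight q s (u (Suc (snd z))) i1 j1 i2 j2)"
    using u by (intro prod.mono_neutral_left) (auto simp: vertex_weight_simps)
  also have "\<dots> = (\<Prod>y<k. \<Prod>x<X. case vertex_data e K y x of (i1, j1, i2, j2) \<Rightarrow>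
      vertex_weight q s (u (Suc y)) i1 j1 i2 j2)"
    by (subst prod.swap) (simp add: prod.cartesian_product case_prod_unfold)
  also have "\<dots> = (\<Prod>y<k. row_weight (vertex_weight q s (u (Suc y))) e (K y) (K (Suc y)))"
  proof (rule prod.cong[OF refl])
    fix y assume y: "y \<in> {..<k}"
    then have "row_weight (vertex_weight q s (u (Suc y))) e (K y) (K (Suc y)) =
        row_prod (vertex_weight q s (u (Suc y))) e (mults (K y)) (mults (K (Suc y))) X"
      using below[of "Suc y"] u
      by (intro row_weight_eq[OF path_weights_vertex_weight below]) (auto simp: add_ac)
    then show "(\<Prod>x<X. case vertex_data e K y x of (i1, j1, i2, j2) \<Rightarrow>
        vertex_weight q s (u (Suc y)) i1 j1 i2 j2) =
        row_weight (vertex_weight q s (u (Suc y))) e (K y) (K (Suc y))"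
      by (simp add: row_prod_def vertex_data_def Let_def del: flow.simps)
  qed
  finally show ?thesis .
qed

definition row_sum ::
  "complex \<Rightarrow> complex \<Rightarrow> (nat \<Rightarrow> complex) \<Rightarrow> nat \<Rightarrow> nat \<Rightarrow> int list \<Rightarrow> int list \<Rightarrow> complex" where
  "row_sum q s u e k \<mu> lam = path_sum q s u (start_edges e k \<mu>) (vertical_edges lam k)"

lemma row_sum_eq:
  assumes "\<forall>y<k. 1 - s * u (Suc y) \<noteq> 0"
    and "e \<le> 1" "\<mu> \<in> Sign_plus L" "lam \<in> Sign_plus (L + e * k)"
  shows "row_sum q s u e k \<mu> lam = (\<Sum>K\<in>level_seqs e k \<mu> lam.
    \<Prod>y<k. row_weight (vertex_weight q s (u (Suc y))) e (K y) (K (Suc y)))"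
  unfolding row_sum_def path_sum_def configurations_eq[OF assms(2-4)]
  by (subst sum.reindex[OF inj_on_level_config])
    (simp add: configuration_weight_level_config[OF assms(1)] cong: sum.cong)

lemma level_seqs_0: "\<mu> \<in> Sign_plus L \<Longrightarrow> level_seqs e 0 \<mu> lam = (if \<mu> = lam then {(\<lambda>_. [])(0 := \<mu>)} else {})"
  using Sign_plus_length[of \<mu> L] by (auto simp: level_seqs_def fun_eq_iff)

lemma row_sum_0:
  assumes "e \<le> 1" "\<mu> \<in> Sign_plus L" "lam \<in> Sign_plus L"
  shows "row_sum q s u e 0 \<mu> lam = (if \<mu> = lam then 1 else 0)"
  using row_sum_eq[of 0 s u e \<mu> L lam q] assms by (simp add: level_seqs_0)

text \<open>Splits off the top row. Sizes weakly increase from level to level, so the signature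
  \<open>\<kappa>\<close> below \<open>lam\<close> ranges over a finite set.\<close>

lemma level_seqs_Suc:
  assumes mu: "\<mu> \<in> Sign_plus L" and lam: "lam \<in> Sign_plus (L + e * Suc k)"
  defines "A \<equiv> {\<kappa> \<in> Sign_below (L + e * k) (Suc (nat (sum_list lam))). row_ok e (mults \<kappa>) (mults lam)}"
  shows "bij_betw (\<lambda>(\<kappa>, K). K(Suc k := lam)) (SIGMA \<kappa>:A. level_seqs e k \<mu> \<kappa>) (level_seqs e (Suc k) \<mu> lam)"
proof (rule bij_betw_byWitness[where f' = "\<lambda>K. (K k, K(Suc k := []))"])
  have L: "length \<mu> = L" using Sign_plus_length[OF mu] .
  show "\<forall>z\<in>SIGMA \<kappa>:A. level_seqs e k \<mu> \<kappa>. (\<lambda>K. (K k, K(Suc k := []))) ((\<lambda>(\<kappa>, K). K(Suc k := lam)) z) = z"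
    by (auto simp: level_seqs_def fun_eq_iff)
  show "\<forall>K\<in>level_seqs e (Suc k) \<mu> lam. (\<lambda>(\<kappa>, K). K(Suc k := lam)) ((\<lambda>K. (K k, K(Suc k := []))) K) = K"
    by (auto simp: level_seqs_def fun_eq_iff)
  show "(\<lambda>(\<kappa>, K). K(Suc k := lam)) ` (SIGMA \<kappa>:A. level_seqs e k \<mu> \<kappa>) \<subseteq> level_seqs e (Suc k) \<mu> lam"
    using lam L by (auto simp: level_seqs_def A_def le_Suc_eq less_Suc_eq)
  show "(\<lambda>K. (K k, K(Suc k := []))) ` level_seqs e (Suc k) \<mu> lam \<subseteq> (SIGMA \<kappa>:A. level_seqs e k \<mu> \<kappa>)"
  proof (intro image_subsetI)
    fix K assume K: "K \<in> level_seqs e (Suc k) \<mu> lam"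
    then have Kk: "K k \<in> Sign_plus (L + e * k)" "row_ok e (mults (K k)) (mults lam)"
      using L by (auto simp: level_seqs_def)
    then have "sum_list (K k) \<le> sum_list lam"
      using row_ok_sum_le[of e "K k" lam "L + e * k"] lam by (simp add: algebra_simps)
    then have "K k \<in> A" using Kk by (auto simp: A_def intro!: Sign_plus_below)
    then show "(K k, K(Suc k := [])) \<in> (SIGMA \<kappa>:A. level_seqs e k \<mu> \<kappa>)"
      using K by (auto simp: level_seqs_def)
  qed
qed

lemma finite_level_seqs:
  assumes "\<mu> \<in> Sign_plus L" "lam \<in> Sign_plus (L + e * k)"
  shows "finite (level_seqs e k \<mu> lam)"
  using assms(2)
proof (induction k arbitrary: lam)
  case 0
  then show ?case using level_seqs_0[OF assms(1)] by simp
next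
  case (Suc k)
  let ?A = "{\<kappa> \<in> Sign_below (L + e * k) (Suc (nat (sum_list lam))). row_ok e (mults \<kappa>) (mults lam)}"
  have "finite (SIGMA \<kappa>:?A. level_seqs e k \<mu> \<kappa>)"
  proof (rule finite_SigmaI)
    show "finite ?A" by (rule finite_subset[OF _ finite_Sign_below]) auto
    show "finite (level_seqs e k \<mu> \<kappa>)" if "\<kappa> \<in> ?A" for \<kappa>
      using that by (intro Suc.IH) (simp add: Sign_below_def)
  qed
  then show ?case using bij_betw_finite[OF level_seqs_Suc[OF assms(1) Suc.prems]] by simp
qed

text \<open>Only finitely many terms are nonzero; the sum is written over all of
  \<open>Sign_plus\<close> to match the recursions assumed in \<open>cauchy_F_rows\<close> and
  \<open>cauchy_G_rows\<close>.\<close>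

lemma row_sum_Suc:
  assumes u: "\<forall>y<Suc k. 1 - s * u (Suc y) \<noteq> 0"
    and e: "e \<le> 1" and mu: "\<mu> \<in> Sign_plus L" and lam: "lam \<in> Sign_plus (L + e * Suc k)"
  shows "row_sum q s u e (Suc k) \<mu> lam = (\<Sum>\<^sub>\<infinity>\<kappa>\<in>Sign_plus (L + e * k).
    row_weight (vertex_weight q s (u (Suc k))) e \<kappa> lam * row_sum q s u e k \<mu> \<kappa>)"
proof -
  let ?w = "\<lambda>y. row_weight (vertex_weight q s (u (Suc y))) e"
  let ?X = "Suc (nat (sum_list lam))"
  let ?A = "{\<kappa> \<in> Sign_below (L + e * k) ?X. row_ok e (mults \<kappa>) (mults lam)}"
  have lam': "lam \<in> Sign_plus (L + e * k + e)" using lam by (simp add: algebra_simps)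
  have w: "path_weights (vertex_weight q s (u (Suc k)))" using u by (intro path_weights_vertex_weight) simp
  have fin: "finite ?A" "\<forall>\<kappa>\<in>?A. finite (level_seqs e k \<mu> \<kappa>)"
    using finite_subset[OF _ finite_Sign_below, of ?A] finite_level_seqs[OF mu]
    by (blast, simp add: Sign_below_def)
  have "row_sum q s u e (Suc k) \<mu> lam = (\<Sum>K\<in>level_seqs e (Suc k) \<mu> lam. \<Prod>y<Suc k. ?w y (K y) (K (Suc y)))"
    by (rule row_sum_eq[OF u e mu lam])
  also have "\<dots> = (\<Sum>(\<kappa>, K)\<in>(SIGMA \<kappa>:?A. level_seqs e k \<mu> \<kappa>). \<Prod>y<Suc k. ?w y ((K(Suc k := lam)) y) ((K(Suc k := lam)) (Suc y)))"
    by (subst sum.reindex_bij_betw[OF level_seqs_Suc[OF mu lam], symmetric]) (simp add: case_prod_unfold)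
  also have "\<dots> = (\<Sum>\<kappa>\<in>?A. \<Sum>K\<in>level_seqs e k \<mu> \<kappa>. \<Prod>y<Suc k. ?w y ((K(Suc k := lam)) y) ((K(Suc k := lam)) (Suc y)))"
    by (rule sum.Sigma[OF fin, symmetric])
  also have "\<dots> = (\<Sum>\<kappa>\<in>?A. \<Sum>K\<in>level_seqs e k \<mu> \<kappa>. ?w k \<kappa> lam * (\<Prod>y<k. ?w y (K y) (K (Suc y))))"
    by (intro sum.cong refl) (auto simp: level_seqs_def)
  also have "\<dots> = (\<Sum>\<kappa>\<in>?A. ?w k \<kappa> lam * row_sum q s u e k \<mu> \<kappa>)"
    unfolding sum_distrib_left[symmetric]
    by (intro sum.cong refl arg_cong2[where f = "(*)"] row_sum_eq[symmetric] e mu)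
      (use u mu in \<open>auto simp: Sign_below_def\<close>)
  \<comment> \<open>Signatures violating \<open>row_ok\<close> are added with row weight 0, and in
    the next step also those of size larger than |lam|.\<close>
  also have "\<dots> = (\<Sum>\<kappa>\<in>Sign_below (L + e * k) ?X. ?w k \<kappa> lam * row_sum q s u e k \<mu> \<kappa>)"
    using row_weight_not_ok[OF w _ lam']
    by (intro sum.mono_neutral_left finite_Sign_below) (auto simp: Sign_below_def)
  also have "\<dots> = (\<Sum>\<^sub>\<infinity>\<kappa>\<in>Sign_plus (L + e * k). ?w k \<kappa> lam * row_sum q s u e k \<mu> \<kappa>)"
    using row_weight_sum_le[OF w _ _ lam'] Sign_plus_sum_nonneg[OF lam']
    by (intro infsum_Sign_plus_finite[symmetric]) fastforce
  finally show ?thesis .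
qed

section \<open>Conjugation of rows and the two identities\<close>

lemma conj_factor_eq:
  assumes "\<nu> \<in> Sign_below L X"
  shows "conj_factor q s \<nu> = (\<Prod>x<X. conj_ratio q s (mults \<nu> x))"
proof -
  have "(\<Prod>x<X. conj_ratio q s (mults \<nu> x)) = (\<Prod>a\<in>int ` {..<X}. conj_ratio q s (count_list \<nu> a))"
    by (subst prod.reindex) (auto simp: mults_def count_mset)
  also have "\<dots> = (\<Prod>a\<in>set \<nu>. conj_ratio q s (count_list \<nu> a))"
  proof (rule prod.mono_neutral_right)
    show "set \<nu> \<subseteq> int ` {..<X}"
    proof
      fix a assume "a \<in> set \<nu>"
      then have "0 \<le> a" "a < int X" using assms by (auto simp: Sign_below_def Sign_plus_def)
      then show "a \<in> int ` {..<X}" by (intro image_eqI[of _ _ "nat a"]) auto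
    qed
    show "\<forall>a\<in>int ` {..<X} - set \<nu>. conj_ratio q s (count_list \<nu> a) = 1"
      by (auto simp: count_list_0_iff)
  qed simp
  finally show ?thesis by (simp add: conj_factor_def conj_ratio_def)
qed

lemma conj_factor_nonzero: "generic_parameters q s \<Longrightarrow> conj_factor q s \<nu> \<noteq> 0"
  using conj_ratio_nonzero[of q s] by (auto simp: conj_factor_def conj_ratio_def)

lemma row_weight_conj:
  assumes "\<kappa> \<in> Sign_plus L" "\<nu> \<in> Sign_plus M"
  shows "row_weight (conj_weight q s v) e \<kappa> \<nu> =
    conj_factor q s \<nu> / conj_factor q s \<kappa> * row_weight (vertex_weight q s v) e \<kappa> \<nu>"
  unfolding conj_factor_eq[OF Sign_plus_below_cutoff(1)[OF assms]]
    conj_factor_eq[OF Sign_plus_below_cutoff(2)[OF assms]]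
  by (simp only: row_weight_def row_prod_def conj_weight_def prod.distrib prod_dividef)

lemma F_skew_row_sum:
  "F_skew q s lam \<mu> u = row_sum q s u 1 (length lam - length \<mu>) \<mu> lam"
  by (simp add: F_skew_def row_sum_def start_edges_def Let_def)

lemma G_skew_row_sum: "G_skew q s k lam \<nu> u = row_sum q s u 0 k \<nu> lam"
  by (simp add: G_skew_def row_sum_def start_edges_def entering_edges_def)

lemma row_sum_1:
  assumes u: "1 - s * u (Suc 0) \<noteq> 0" and e: "e \<le> 1" and mu: "\<mu> \<in> Sign_plus L" and lam: "lam \<in> Sign_plus (L + e)"
  shows "row_sum q s u e 1 \<mu> lam = row_weight (vertex_weight q s (u 1)) e \<mu> lam"
proof -
  have "row_sum q s u e 1 \<mu> lam = (\<Sum>\<^sub>\<infinity>\<kappa>\<in>Sign_plus L.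
      row_weight (vertex_weight q s (u 1)) e \<kappa> lam * row_sum q s u e 0 \<mu> \<kappa>)"
    using row_sum_Suc[of 0 s u e \<mu> L lam q] assms by simp
  also have "\<dots> = (\<Sum>\<^sub>\<infinity>\<kappa>\<in>{\<mu>}. row_weight (vertex_weight q s (u 1)) e \<kappa> lam)"
    using mu e by (intro infsum_cong_neutral) (auto simp: row_sum_0)
  finally show ?thesis by simp
qed

theorem corollary4p5:
  fixes q s :: complex
  assumes generic: "generic_parameters q s"
  shows
    "(\<forall>(M::nat) (\<mu>::int list) (u::nat \<Rightarrow> complex) (v::complex).
        \<mu> \<in> Sign_plus M \<longrightarrow>
        (\<forall>i\<in>{1..M}. 1 - s * u i \<noteq> 0 \<and> 1 - s * v \<noteq> 0 \<and> 1 - u i * v \<noteq> 0 \<and>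
            cmod ((u i - s) / (1 - s * u i) * ((v - s) / (1 - s * v))) < 1) \<longrightarrow>
        (\<lambda>\<nu>. Gc_skew q s 1 \<nu> \<mu> (\<lambda>_. v) * F_fun q s \<nu> u) summable_on Sign_plus M \<and>
        (\<Prod>i=1..M. (1 - q * u i * v) / (1 - u i * v)) * F_fun q s \<mu> u =
          (\<Sum>\<^sub>\<infinity>\<nu>\<in>Sign_plus M. Gc_skew q s 1 \<nu> \<mu> (\<lambda>_. v) * F_fun q s \<nu> u))
     \<and>
     (\<forall>(l::nat) (N::nat) (lam::int list) (u::complex) (v::nat \<Rightarrow> complex).
        lam \<in> Sign_plus l \<longrightarrow>
        1 - s * u \<noteq> 0 \<longrightarrow>
        (\<forall>j\<in>{1..N}. 1 - s * v j \<noteq> 0 \<and> 1 - u * v j \<noteq> 0 \<and>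
            cmod ((u - s) / (1 - s * u) * ((v j - s) / (1 - s * v j))) < 1) \<longrightarrow>
        (\<lambda>\<nu>. F_skew q s \<nu> lam (\<lambda>_. u) * Gc_fun q s N \<nu> v) summable_on Sign_plus (l + 1) \<and>
        (\<Prod>j=1..N. (1 - q * u * v j) / (1 - u * v j)) * Gc_fun q s N lam v =
          (1 - s * u) / (1 - q ^ (l + 1)) *
          (\<Sum>\<^sub>\<infinity>\<nu>\<in>Sign_plus (l + 1). F_skew q s \<nu> lam (\<lambda>_. u) * Gc_fun q s N \<nu> v))"
proof (intro conjI allI impI)
  fix M :: nat and \<mu> :: "int list" and u :: "nat \<Rightarrow> complex" and v :: complex
  assume mu: "\<mu> \<in> Sign_plus M"
    and u: "\<forall>i\<in>{1..M}. 1 - s * u i \<noteq> 0 \<and> 1 - s * v \<noteq> 0 \<and> 1 - u i * v \<noteq> 0 \<and>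
            cmod ((u i - s) / (1 - s * u i) * ((v - s) / (1 - s * v))) < 1"
  let ?f = "\<lambda>\<nu>. Gc_skew q s 1 \<nu> \<mu> (\<lambda>_. v) * F_fun q s \<nu> u"
  have "?f summable_on Sign_plus M \<and> infsum ?f (Sign_plus M) =
      (\<Prod>i=1..M. (1 - q * u i * v) / (1 - u i * v)) * F_fun q s \<mu> u"
  proof (cases "M = 0")
    case True
    \<comment> \<open>For \<open>M = 0\<close> the condition on \<open>v\<close> is vacuous and
      \<open>1 - s * v\<close> may vanish; but only the empty collection occurs, with weight
      1.\<close>
    have "path_sum q s w {#} {#} = 1" for w
    proof -
      have "path_collections {#} {#} = {{#}}" by (auto simp: path_collections_def)
      moreover have "dom (configuration {#}) = {}"
        by (auto simp: configuration_def interior_vertices_def)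
      ultimately show ?thesis by (simp add: path_sum_def configuration_weight_def)
    qed
    then show ?thesis
      using mu True by (simp add: Sign_plus_0 Gc_skew_def conj_factor_def F_fun_def F_skew_def
          G_skew_def vertical_edges_def entering_edges_def)
  next
    case False
    define F where "F j \<nu> = row_sum q s u 1 j [] \<nu>" for j \<nu>
    have nil: "[] \<in> Sign_plus 0" by (simp add: Sign_plus_0)
    have sv: "1 - s * v \<noteq> 0" using u False by force
    have F_Suc: "F (Suc j) \<nu> =
        (\<Sum>\<^sub>\<infinity>\<kappa>\<in>Sign_plus j. row_weight (vertex_weight q s (u (Suc j))) 1 \<kappa> \<nu> * F j \<kappa>)"
      if "j < M" "\<nu> \<in> Sign_plus (Suc j)" for j \<nu>
      using row_sum_Suc[of j s u 1 "[]" 0 \<nu> q] u nil that by (simp add: F_def)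
    have eq: "?f \<nu> = row_weight (conj_weight q s v) 0 \<mu> \<nu> * F M \<nu>" if "\<nu> \<in> Sign_plus M" for \<nu>
      using row_sum_1[of s "\<lambda>_. v" 0 \<mu> M \<nu> q] sv mu that Sign_plus_length[OF that]
      by (simp add: Gc_skew_def G_skew_row_sum row_weight_conj[OF mu that] F_fun_def F_skew_row_sum F_def)
    have FM: "F_fun q s \<mu> u = F M \<mu>"
      using Sign_plus_length[OF mu] by (simp add: F_fun_def F_skew_row_sum F_def)
    have u': "\<And>i. i \<in> {1..M} \<Longrightarrow> 1 - s * u i \<noteq> 0 \<and> 1 - s * v \<noteq> 0 \<and> 1 - u i * v \<noteq> 0 \<and>
            cmod ((u i - s) / (1 - s * u i) * ((v - s) / (1 - s * v))) < 1" using u by blast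
    have "0 < M" using False by simp
    from cauchy_F_rows[where F = F, OF generic u' F_Suc this mu] show ?thesis
      using eq FM by (simp cong: summable_on_cong infsum_cong)
  qed
  then show "?f summable_on Sign_plus M"
    and "(\<Prod>i=1..M. (1 - q * u i * v) / (1 - u i * v)) * F_fun q s \<mu> u = infsum ?f (Sign_plus M)"
    by auto
next
  fix l N :: nat and lam :: "int list" and u :: complex and v :: "nat \<Rightarrow> complex"
  assume lam: "lam \<in> Sign_plus l" and su: "1 - s * u \<noteq> 0"
    and v: "\<forall>j\<in>{1..N}. 1 - s * v j \<noteq> 0 \<and> 1 - u * v j \<noteq> 0 \<and>
            cmod ((u - s) / (1 - s * u) * ((v j - s) / (1 - s * v j))) < 1"
  let ?f = "\<lambda>\<nu>. F_skew q s \<nu> lam (\<lambda>_. u) * Gc_fun q s N \<nu> v"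
  define G where "G L j \<nu> = conj_factor q s \<nu> / conj_factor q s (replicate L 0) *
    row_sum q s v 0 j (replicate L 0) \<nu>" for L j \<nu>
  have zeros: "replicate L 0 \<in> Sign_plus L" for L
    by (induction L) (auto simp: Sign_plus_def Sign_def)
  have G_0: "G L 0 \<nu> = (if \<nu> = replicate L 0 then 1 else 0)" if "\<nu> \<in> Sign_plus L" for L \<nu>
    using row_sum_0[OF _ zeros[of L], of 0 \<nu> q s v] that conj_factor_nonzero[OF generic]
    by (auto simp: G_def)
  have G_Suc: "G L (Suc j) \<nu> =
      (\<Sum>\<^sub>\<infinity>\<kappa>\<in>Sign_plus L. row_weight (conj_weight q s (v (Suc j))) 0 \<kappa> \<nu> * G L j \<kappa>)"
    if "j < N" "\<nu> \<in> Sign_plus L" for L j \<nu>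
  proof -
    have "row_sum q s v 0 (Suc j) (replicate L 0) \<nu> = (\<Sum>\<^sub>\<infinity>\<kappa>\<in>Sign_plus L.
        row_weight (vertex_weight q s (v (Suc j))) 0 \<kappa> \<nu> * row_sum q s v 0 j (replicate L 0) \<kappa>)"
      using row_sum_Suc[of j s v 0 "replicate L 0" L \<nu> q] v zeros that by simp
    then have "G L (Suc j) \<nu> = (\<Sum>\<^sub>\<infinity>\<kappa>\<in>Sign_plus L. conj_factor q s \<nu> / conj_factor q s (replicate L 0) *
        (row_weight (vertex_weight q s (v (Suc j))) 0 \<kappa> \<nu> * row_sum q s v 0 j (replicate L 0) \<kappa>))"
      by (simp only: G_def infsum_cmult_right')
    \<comment> \<open>The ratio of c(\<nu>) to c of the zero signature is split at c(\<kappa>): one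
      factor conjugates the new row, the other belongs to \<open>G L j\<close>.\<close>
    also have "\<dots> = (\<Sum>\<^sub>\<infinity>\<kappa>\<in>Sign_plus L. row_weight (conj_weight q s (v (Suc j))) 0 \<kappa> \<nu> * G L j \<kappa>)"
      using conj_factor_nonzero[OF generic] row_weight_conj[OF _ that(2)]
      by (intro infsum_cong) (simp add: G_def)
    finally show ?thesis .
  qed
  have Gc: "Gc_fun q s N \<nu> v = G L N \<nu>" if "\<nu> \<in> Sign_plus L" for L \<nu>
    using Sign_plus_length[OF that] by (simp add: Gc_fun_def Gc_skew_def G_skew_row_sum G_def)
  have eq: "?f \<nu> = row_weight (vertex_weight q s u) 1 lam \<nu> * G (Suc l) N \<nu>" if "\<nu> \<in> Sign_plus (Suc l)" for \<nu>
    using row_sum_1[of s "\<lambda>_. u" 1 lam l \<nu> q] su lam that Sign_plus_length[OF that] Sign_plus_length[OF lam]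
    by (simp add: F_skew_row_sum Gc[OF that])
  have v': "\<And>j. j \<in> {1..N} \<Longrightarrow> 1 - s * v j \<noteq> 0 \<and> 1 - u * v j \<noteq> 0 \<and>
            cmod ((u - s) / (1 - s * u) * ((v j - s) / (1 - s * v j))) < 1" using v by blast
  note main = cauchy_G_rows[where G = G and N = N, OF generic su v' G_0 G_Suc lam]
  show "?f summable_on Sign_plus (l + 1)"
    using main(1) summable_on_cong[of "Sign_plus (Suc l)" ?f, OF eq] by simp
  have "infsum ?f (Sign_plus (l + 1)) = (1 - q ^ (l + 1)) / (1 - s * u) *
      ((\<Prod>j=1..N. (1 - q * u * v j) / (1 - u * v j)) * G l N lam)"
    using main(2) infsum_cong[of "Sign_plus (Suc l)" ?f, OF eq] by simp
  moreover have "1 - q ^ (l + 1) \<noteq> 0" using generic_power_neq[OF generic, of l] by simp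
  ultimately show "(\<Prod>j=1..N. (1 - q * u * v j) / (1 - u * v j)) * Gc_fun q s N lam v =
      (1 - s * u) / (1 - q ^ (l + 1)) * infsum ?f (Sign_plus (l + 1))"
    using su by (simp add: Gc[OF lam])
qed

end
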